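(* Let $(\mathcal{E},\mathcal{F})$ be a regular Dirichlet form on $L^2(E;m)$, let $\mathcal{K}$, $\mathcal{D}$ be the Kato and Dynkin classes, $\mathcal{S}_F$ the set of finite smooth measures, and $\mathcal{K}_{00}:=\mathcal{K}\cap\mathcal{S}_{00}$, $\mathcal{D}_{00}:=\mathcal{D}\cap\mathcal{S}_{00}$. Then $$\mathcal{K}_{00}=\mathcal{K}\cap\mathcal{S}_F\qquad\text{and}\qquad\mathcal{D}_{00}=\mathcal{D}\cap\mathcal{S}_F.$$
   Context: Setting: $E$ is a locally compact separable metric space, $m$ a positive Radon measure on $E$ with full topological support, $(\mathcal{E},\mathcal{F})$ a regular symmetric Dirichlet form on $L^2(E;m)$, $\mathcal{E}_\alpha(f,g)=\mathcal{E}(f,g)+\alpha\int_E fg\,dm$, and $X=(X_t,\mathbb{P}_x,\zeta)$ the associated $m$-symmetric Hunt process. $C_c$ is the space of continuous functions with compact support. Capacity: for open $A$, $\mathrm{Cap}(A)=\inf\{\mathcal{E}_1(u,u):u\in\mathcal{F},\,u\ge1\ m\text{-a.e. on }A\}$ ($\inf\emptyset=\infty$), and $\mathrm{Cap}(B)=\inf\{\mathrm{Cap}(A):A\supset B\text{ open}\}$ for general $B$. A compact nest is an increasing sequence $\{F_k\}$ of compact sets with $\mathrm{Cap}(K\setminus F_k)\to0$ for every compact $K$. A positive Borel measure $\mu$ on $E$ is smooth if it charges no set of zero capacity and there is a compact nest $\{F_k\}$ with $\mu(F_k)<\infty$ for all $k$. $\mathcal{S}$ is the set of all smooth measures. Each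 $\mu\in\mathcal{S}$ corresponds uniquely (up to equivalence) to a positive continuous additive functional (PCAF) $A^\mu$ via the Revuz correspondence $\mathbb{E}_{hm}[\int_0^\infty e^{-\alpha s}f(X_s)\,dA^\mu_s]=\int_E f\,R_\alpha h\,d\mu$ for all nonnegative Borel $f,h$, where $R_\alpha h(x)=\mathbb{E}_x[\int_0^\infty e^{-\alpha t}h(X_t)dt]$. Put $R_\alpha\mu(x)=\mathbb{E}_x[\int_0^\infty e^{-\alpha t}dA_t^\mu]$, and $\|u\|_{\infty,q}=\inf\{\lambda>0:\mathrm{Cap}(\{|u|\ge\lambda\})=0\}$. $\mathcal{S}_0$: Radon measures $\mu$ for which there is $C>0$ with $\int|f|d\mu\le C\sqrt{\mathcal{E}_1(f,f)}$ for all $f\in\mathcal{F}\cap C_c$; for such $\mu$, $U_1\mu\in\mathcal{F}$ is the element with $\mathcal{E}_1(f,U_1\mu)=\int\tilde f\,d\mu$ for all $f\in\mathcal{F}$ ($\tilde f$ a quasi-continuous version). $\mathcal{S}_{00}$: those $\mu\in\mathcal{S}_0$ with $\mu(E)<\infty$ and $U_1\mu\in L^\infty$. $\mathcal{K}$ (Kato class): $\mu\in\mathcal{S}$ with $\lim_{\alpha\to\infty}\|R_\alpha\mu\|_{\infty,q}=0$. $\mathcal{D}$ (Dynkin class): $\mu\in\mathcal{S}$ with $\|R_1\mu\|_{\infty,q}<\infty$. *)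

theory Defs
  imports "HOL-Probability.Probability"
begin

section \<open>Regular Dirichlet forms\<close>

text \<open>Elements of \<open>L\<^sup>2(E;m)\<close> are represented by Borel functions on the type \<open>'a\<close>, which plays the
  role of \<open>E\<close>; domains of forms are closed under \<open>m\<close>-a.e. equality of such representatives.\<close>

definition L2 :: "'a::topological_space measure \<Rightarrow> ('a \<Rightarrow> real) set" where
  "L2 m = {f \<in> borel_measurable borel. integrable m (\<lambda>x. (f x)\<^sup>2)}"

definition Cc :: "('a::topological_space \<Rightarrow> real) set" where
  "Cc = {f. continuous_on UNIV f \<and> compact (closure {x. f x \<noteq> 0})}"

definition radon :: "'a::topological_space measure \<Rightarrow> bool" where
  "radon \<mu> \<longleftrightarrow> sets \<mu> = sets borel \<and> (\<forall>K. compact K \<longrightarrow> emeasure \<mu> K < \<infinity>)"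

definition form_shift ::
  "'a measure \<Rightarrow> (('a \<Rightarrow> real) \<Rightarrow> ('a \<Rightarrow> real) \<Rightarrow> real) \<Rightarrow> real \<Rightarrow> ('a \<Rightarrow> real) \<Rightarrow> ('a \<Rightarrow> real) \<Rightarrow> real"
  where "form_shift m \<E> \<alpha> f g = \<E> f g + \<alpha> * (\<integral>x. f x * g x \<partial>m)"

locale dirichlet_form =
  fixes m :: "'a::{metric_space, second_countable_topology} measure"
    and \<F> :: "('a \<Rightarrow> real) set"
    and \<E> :: "('a \<Rightarrow> real) \<Rightarrow> ('a \<Rightarrow> real) \<Rightarrow> real"
  assumes locally_compact: "locally compact (UNIV :: 'a set)"
    and radon: "radon m"
    and full_support: "open G \<Longrightarrow> G \<noteq> {} \<Longrightarrow> emeasure m G > 0"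
    and dom_L2: "\<F> \<subseteq> L2 m"
    and dom_AE: "f \<in> \<F> \<Longrightarrow> g \<in> borel_measurable borel \<Longrightarrow> (AE x in m. f x = g x) \<Longrightarrow> g \<in> \<F>"
    and form_AE: "f \<in> \<F> \<Longrightarrow> g \<in> \<F> \<Longrightarrow> h \<in> \<F> \<Longrightarrow> (AE x in m. f x = g x) \<Longrightarrow> \<E> f h = \<E> g h"
    and dom_zero: "(\<lambda>_. 0) \<in> \<F>"
    and dom_add: "f \<in> \<F> \<Longrightarrow> g \<in> \<F> \<Longrightarrow> (\<lambda>x. f x + g x) \<in> \<F>"
    and dom_scale: "f \<in> \<F> \<Longrightarrow> (\<lambda>x. c * f x) \<in> \<F>"
    and dom_dense: "f \<in> L2 m \<Longrightarrow> \<epsilon> > 0 \<Longrightarrow> \<exists>g\<in>\<F>. (\<integral>x. (f x - g x)\<^sup>2 \<partial>m) < \<epsilon>"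
    and form_add: "f \<in> \<F> \<Longrightarrow> g \<in> \<F> \<Longrightarrow> h \<in> \<F> \<Longrightarrow> \<E> (\<lambda>x. f x + g x) h = \<E> f h + \<E> g h"
    and form_scale: "f \<in> \<F> \<Longrightarrow> h \<in> \<F> \<Longrightarrow> \<E> (\<lambda>x. c * f x) h = c * \<E> f h"
    and form_sym: "f \<in> \<F> \<Longrightarrow> g \<in> \<F> \<Longrightarrow> \<E> f g = \<E> g f"
    and form_nonneg: "f \<in> \<F> \<Longrightarrow> \<E> f f \<ge> 0"
    and form_closed: "(\<And>n. u n \<in> \<F>) \<Longrightarrow>
      (\<And>\<epsilon>. \<epsilon> > 0 \<Longrightarrow> \<exists>N. \<forall>i\<ge>N. \<forall>j\<ge>N.
          form_shift m \<E> 1 (\<lambda>x. u i x - u j x) (\<lambda>x. u i x - u j x) < \<epsilon>) \<Longrightarrow>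
      \<exists>v\<in>\<F>. (\<lambda>n. form_shift m \<E> 1 (\<lambda>x. u n x - v x) (\<lambda>x. u n x - v x)) \<longlonglongrightarrow> 0"
    and dom_unit_contraction: "f \<in> \<F> \<Longrightarrow> (\<lambda>x. min (max (f x) 0) 1) \<in> \<F>"
    and form_unit_contraction:
      "f \<in> \<F> \<Longrightarrow> \<E> (\<lambda>x. min (max (f x) 0) 1) (\<lambda>x. min (max (f x) 0) 1) \<le> \<E> f f"

locale regular_dirichlet_form = dirichlet_form m \<F> \<E>
  for m :: "'a::{metric_space, second_countable_topology} measure" and \<F> \<E> +
  assumes core_dense_dom: "f \<in> \<F> \<Longrightarrow> \<epsilon> > 0 \<Longrightarrow>
      \<exists>g\<in>\<F> \<inter> Cc. form_shift m \<E> 1 (\<lambda>x. f x - g x) (\<lambda>x. f x - g x) < \<epsilon>"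
    and core_dense_Cc: "f \<in> Cc \<Longrightarrow> \<epsilon> > 0 \<Longrightarrow> \<exists>g\<in>\<F> \<inter> Cc. \<forall>x. \<bar>f x - g x\<bar> < \<epsilon>"


section \<open>Capacity and smooth measures\<close>

definition cap_open ::
  "'a::topological_space measure \<Rightarrow> ('a \<Rightarrow> real) set \<Rightarrow> (('a \<Rightarrow> real) \<Rightarrow> ('a \<Rightarrow> real) \<Rightarrow> real) \<Rightarrow> 'a set \<Rightarrow> ennreal"
  where "cap_open m \<F> \<E> A =
    (INF u\<in>{u \<in> \<F>. AE x in m. x \<in> A \<longrightarrow> u x \<ge> 1}. ennreal (form_shift m \<E> 1 u u))"

definition cap ::
  "'a::topological_space measure \<Rightarrow> ('a \<Rightarrow> real) set \<Rightarrow> (('a \<Rightarrow> real) \<Rightarrow> ('a \<Rightarrow> real) \<Rightarrow> real) \<Rightarrow> 'a set \<Rightarrow> ennreal"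
  where "cap m \<F> \<E> B = (INF A\<in>{A. open A \<and> B \<subseteq> A}. cap_open m \<F> \<E> A)"

definition compact_nest where
  "compact_nest m \<F> \<E> (K :: nat \<Rightarrow> 'a::topological_space set) \<longleftrightarrow>
    (\<forall>n. compact (K n)) \<and> incseq K \<and>
    (\<forall>C. compact C \<longrightarrow> (\<lambda>n. cap m \<F> \<E> (C - K n)) \<longlonglongrightarrow> 0)"

definition smooth ::
  "'a::topological_space measure \<Rightarrow> ('a \<Rightarrow> real) set \<Rightarrow> (('a \<Rightarrow> real) \<Rightarrow> ('a \<Rightarrow> real) \<Rightarrow> real) \<Rightarrow> 'a measure set"
  where "smooth m \<F> \<E> = {\<mu>. sets \<mu> = sets borel \<and>
    (\<forall>B\<in>sets borel. cap m \<F> \<E> B = 0 \<longrightarrow> emeasure \<mu> B = 0) \<and>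
    (\<exists>K. compact_nest m \<F> \<E> K \<and> (\<forall>n. emeasure \<mu> (K n) < \<infinity>))}"

definition finite_smooth where
  "finite_smooth m \<F> \<E> = {\<mu> \<in> smooth m \<F> \<E>. emeasure \<mu> UNIV < \<infinity>}"

definition quasi_continuous where
  "quasi_continuous m \<F> \<E> (f :: 'a::topological_space \<Rightarrow> real) \<longleftrightarrow>
    (\<forall>\<epsilon>>0. \<exists>G. open G \<and> cap m \<F> \<E> G < \<epsilon> \<and> continuous_on (- G) f)"

text \<open>The norm \<open>\<parallel>u\<parallel>\<^bsub>\<infinity>,q\<^esub>\<close> for \<open>u \<ge> 0\<close>; an empty infimum is \<open>\<infinity>\<close>.\<close>
definition qe_norm ::
  "'a::topological_space measure \<Rightarrow> ('a \<Rightarrow> real) set \<Rightarrow> (('a \<Rightarrow> real) \<Rightarrow> ('a \<Rightarrow> real) \<Rightarrow> real) \<Rightarrow> ('a \<Rightarrow> ennreal) \<Rightarrow> ennreal"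
  where "qe_norm m \<F> \<E> u = Inf {ennreal l |l. 0 < l \<and> cap m \<F> \<E> {x. u x \<ge> ennreal l} = 0}"

definition S_0 ::
  "('a::topological_space) measure \<Rightarrow> ('a \<Rightarrow> real) set \<Rightarrow> (('a \<Rightarrow> real) \<Rightarrow> ('a \<Rightarrow> real) \<Rightarrow> real) \<Rightarrow> 'a measure set"
  where "S_0 m \<F> \<E> = {\<mu>. radon \<mu> \<and>
    (\<exists>C>0. \<forall>f\<in>\<F> \<inter> Cc. (\<integral>\<^sup>+x. ennreal \<bar>f x\<bar> \<partial>\<mu>) \<le> ennreal (C * sqrt (form_shift m \<E> 1 f f)))}"

text \<open>\<open>U\<close> is (a version of) the 1-potential \<open>U\<^sub>1\<mu>\<close>. Quasi-continuous versions \<open>g\<close> of \<open>f\<close> need only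
  agree with a Borel function q.e., hence the completion of \<open>\<mu>\<close>.\<close>
definition one_potential where
  "one_potential m \<F> \<E> \<mu> U \<longleftrightarrow> U \<in> \<F> \<and>
    (\<forall>f\<in>\<F>. \<forall>g. quasi_continuous m \<F> \<E> g \<and> (AE x in m. g x = f x) \<longrightarrow>
       has_bochner_integral (completion \<mu>) g (form_shift m \<E> 1 f U))"

definition S_00 where
  "S_00 m \<F> \<E> = {\<mu> \<in> S_0 m \<F> \<E>. emeasure \<mu> UNIV < \<infinity> \<and>
    (\<exists>U. one_potential m \<F> \<E> \<mu> U \<and> (\<exists>C. AE x in m. \<bar>U x\<bar> \<le> C))}"


section \<open>Hunt processes\<close>

text \<open>The state space with cemetery, \<open>E \<union> {\<partial>}\<close>, is \<open>'a option\<close> with \<open>None\<close> as \<open>\<partial>\<close>, carrying the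
  one-point compactification topology (\<open>\<partial>\<close> is isolated if \<open>E\<close> is compact). Time ranges over
  \<open>[0,\<infinity>]\<close> with \<open>X\<^sub>\<infinity> = \<partial>\<close>, and functions on \<open>E\<close> are extended by \<open>0\<close> at \<open>\<partial>\<close>.\<close>

abbreviation cemetery_top :: "'a::topological_space option topology" where
  "cemetery_top \<equiv> Alexandroff_compactification euclidean"

definition cemetery_borel :: "'a::topological_space option measure" where
  "cemetery_borel = sigma UNIV {U. openin cemetery_top U}"

definition natural_filtration ::
  "(ennreal \<Rightarrow> 'w \<Rightarrow> 'a::topological_space option) \<Rightarrow> ennreal \<Rightarrow> 'w measure" where
  "natural_filtration X t = sigma UNIV {X s -` B |s B. s \<le> t \<and> B \<in> sets cemetery_borel}"

text \<open>The minimum completed admissible filtration \<open>\<F>\<^sub>t = \<Inter>\<^sub>\<nu> \<F>\<^sub>t\<^sup>\<nu>\<close>, where \<open>\<nu>\<close> ranges over all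
  initial distributions and \<open>\<nu> \<bind> P\<close> is the law \<open>P\<^sub>\<nu>\<close>.\<close>
definition completed_filtration ::
  "(ennreal \<Rightarrow> 'w \<Rightarrow> 'a::topological_space option) \<Rightarrow> ('a option \<Rightarrow> 'w measure) \<Rightarrow> ennreal \<Rightarrow> 'w measure" where
  "completed_filtration X P t = sigma UNIV
     {\<Gamma>. \<forall>\<nu>\<in>space (prob_algebra cemetery_borel). \<exists>\<Gamma>'\<in>sets (natural_filtration X t).
        (\<Gamma> - \<Gamma>') \<union> (\<Gamma>' - \<Gamma>) \<in> null_sets (completion (\<nu> \<bind> P))}"

locale hunt_process =
  fixes X :: "ennreal \<Rightarrow> 'w \<Rightarrow> 'a::{metric_space, second_countable_topology} option"
    and \<theta> :: "ennreal \<Rightarrow> 'w \<Rightarrow> 'w"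
    and P :: "'a option \<Rightarrow> 'w measure"
  assumes kernel: "P \<in> cemetery_borel \<rightarrow>\<^sub>M prob_algebra (natural_filtration X \<infinity>)"
    and normal: "AE \<omega> in P x. X 0 \<omega> = x"
    and at_infinity: "X \<infinity> \<omega> = None"
    and absorbing: "X s \<omega> = None \<Longrightarrow> s \<le> t \<Longrightarrow> X t \<omega> = None"
    and shift: "t < \<infinity> \<Longrightarrow> X s (\<theta> t \<omega>) = X (s + t) \<omega>"
    and right_continuous_path: "t < \<infinity> \<Longrightarrow> limitin cemetery_top (\<lambda>s. X s \<omega>) (X t \<omega>) (at_right t)"
    and left_limit_path:
      "0 < t \<Longrightarrow> t < \<infinity> \<Longrightarrow> \<exists>y. limitin cemetery_top (\<lambda>s. X s \<omega>) y (at_left t)"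
    and right_continuous_filtration: "t < \<infinity> \<Longrightarrow>
      sets (completed_filtration X P t) = (\<Inter>s\<in>{t<..}. sets (completed_filtration X P s))"
    and strong_markov:
      "\<nu> \<in> space (prob_algebra cemetery_borel) \<Longrightarrow>
       stopping_time (completed_filtration X P) \<sigma> \<Longrightarrow>
       (\<And>t. \<Gamma> \<inter> {\<omega>. \<sigma> \<omega> \<le> t} \<in> sets (completed_filtration X P t)) \<Longrightarrow>
       B \<in> sets cemetery_borel \<Longrightarrow> s < \<infinity> \<Longrightarrow>
       emeasure (completion (\<nu> \<bind> P)) (\<Gamma> \<inter> {\<omega>. X (\<sigma> \<omega> + s) \<omega> \<in> B}) =
       (\<integral>\<^sup>+\<omega>. indicator \<Gamma> \<omega> * emeasure (P (X (\<sigma> \<omega>) \<omega>)) {\<omega>'. X s \<omega>' \<in> B} \<partial>completion (\<nu> \<bind> P))"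
    and quasi_left_continuous:
      "\<nu> \<in> space (prob_algebra cemetery_borel) \<Longrightarrow>
       (\<And>n::nat. stopping_time (completed_filtration X P) (\<tau> n)) \<Longrightarrow> incseq \<tau> \<Longrightarrow>
       AE \<omega> in completion (\<nu> \<bind> P). (SUP n. \<tau> n \<omega>) < \<infinity> \<longrightarrow>
         limitin cemetery_top (\<lambda>n. X (\<tau> n \<omega>) \<omega>) (X (SUP n. \<tau> n \<omega>) \<omega>) sequentially"

definition lifetime :: "(ennreal \<Rightarrow> 'w \<Rightarrow> 'a option) \<Rightarrow> 'w \<Rightarrow> ennreal" where
  "lifetime X \<omega> = Inf {t. X t \<omega> = None}"

definition transition ::
  "(ennreal \<Rightarrow> 'w \<Rightarrow> 'a option) \<Rightarrow> ('a option \<Rightarrow> 'w measure) \<Rightarrow> ennreal \<Rightarrow> ('a \<Rightarrow> ennreal) \<Rightarrow> 'a \<Rightarrow> ennreal" where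
  "transition X P t f x = (\<integral>\<^sup>+\<omega>. case_option 0 f (X t \<omega>) \<partial>P (Some x))"

definition resolvent ::
  "(ennreal \<Rightarrow> 'w \<Rightarrow> 'a option) \<Rightarrow> ('a option \<Rightarrow> 'w measure) \<Rightarrow> real \<Rightarrow> ('a \<Rightarrow> ennreal) \<Rightarrow> 'a \<Rightarrow> ennreal" where
  "resolvent X P \<alpha> f x =
    (\<integral>\<^sup>+\<omega>. (\<integral>\<^sup>+t\<in>{0..}. ennreal (exp (- \<alpha> * t)) * case_option 0 f (X (ennreal t) \<omega>) \<partial>lborel) \<partial>P (Some x))"

definition symmetric_process ::
  "'a::topological_space measure \<Rightarrow> (ennreal \<Rightarrow> 'w \<Rightarrow> 'a option) \<Rightarrow> ('a option \<Rightarrow> 'w measure) \<Rightarrow> bool" where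
  "symmetric_process m X P \<longleftrightarrow>
    (\<forall>t<\<infinity>. \<forall>f\<in>borel_measurable borel. \<forall>g\<in>borel_measurable borel.
      (\<integral>\<^sup>+x. transition X P t f x * g x \<partial>m) = (\<integral>\<^sup>+x. f x * transition X P t g x \<partial>m))"

text \<open>The process is associated with the form: \<open>R\<^sub>\<alpha>f\<close> is an \<open>m\<close>-version of \<open>G\<^sub>\<alpha>f\<close>, where the resolvent
  \<open>G\<^sub>\<alpha>\<close> of the form is determined by \<open>\<E>\<^sub>\<alpha>(G\<^sub>\<alpha>f, v) = \<integral>fv dm\<close> for all \<open>v\<close> in the domain.\<close>
definition associated ::
  "'a::topological_space measure \<Rightarrow> ('a \<Rightarrow> real) set \<Rightarrow> (('a \<Rightarrow> real) \<Rightarrow> ('a \<Rightarrow> real) \<Rightarrow> real) \<Rightarrow>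
   (ennreal \<Rightarrow> 'w \<Rightarrow> 'a option) \<Rightarrow> ('a option \<Rightarrow> 'w measure) \<Rightarrow> bool" where
  "associated m \<F> \<E> X P \<longleftrightarrow>
    (\<forall>\<alpha>>0. \<forall>f\<in>L2 m. (\<forall>x. f x \<ge> 0) \<longrightarrow>
      (\<exists>u\<in>\<F>. (AE x in m. resolvent X P \<alpha> (\<lambda>y. ennreal (f y)) x = ennreal (u x)) \<and>
         (AE x in m. u x \<ge> 0) \<and>
         (\<forall>v\<in>\<F>. form_shift m \<E> \<alpha> u v = (\<integral>x. f x * v x \<partial>m))))"


section \<open>Additive functionals and the Kato and Dynkin classes\<close>

text \<open>Positive continuous additive functionals with a defining set \<open>\<Lambda>\<close> and an exceptional set \<open>N\<close>.
  The value \<open>\<infinity>\<close> is possible from the lifetime on.\<close>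
definition pcaf ::
  "'a::topological_space measure \<Rightarrow> ('a \<Rightarrow> real) set \<Rightarrow> (('a \<Rightarrow> real) \<Rightarrow> ('a \<Rightarrow> real) \<Rightarrow> real) \<Rightarrow>
   (ennreal \<Rightarrow> 'w \<Rightarrow> 'a option) \<Rightarrow> (ennreal \<Rightarrow> 'w \<Rightarrow> 'w) \<Rightarrow> ('a option \<Rightarrow> 'w measure) \<Rightarrow>
   (ennreal \<Rightarrow> 'w \<Rightarrow> ennreal) \<Rightarrow> bool" where
  "pcaf m \<F> \<E> X \<theta> P A \<longleftrightarrow>
    (\<forall>t<\<infinity>. A t \<in> borel_measurable (completed_filtration X P t)) \<and>
    (\<exists>\<Lambda>\<in>sets (completed_filtration X P \<infinity>). \<exists>N.
      cap m \<F> \<E> N = 0 \<and>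
      (\<forall>x. x \<notin> N \<longrightarrow> (AE \<omega> in completion (P (Some x)). \<omega> \<in> \<Lambda>)) \<and>
      (\<forall>t<\<infinity>. \<theta> t ` \<Lambda> \<subseteq> \<Lambda>) \<and>
      (\<forall>\<omega>\<in>\<Lambda>.
        A 0 \<omega> = 0 \<and>
        continuous_on {0..<\<infinity>} (\<lambda>t. A t \<omega>) \<and>
        (\<forall>t<lifetime X \<omega>. A t \<omega> < \<infinity>) \<and>
        (\<forall>t<\<infinity>. lifetime X \<omega> \<le> t \<longrightarrow> A t \<omega> = A (lifetime X \<omega>) \<omega>) \<and>
        (\<forall>s<\<infinity>. \<forall>t<\<infinity>. A (s + t) \<omega> = A s \<omega> + A t (\<theta> s \<omega>))))"

text \<open>\<open>\<integral>\<^sub>0\<^sup>\<infinity> g(s) da(s)\<close> for a nondecreasing continuous \<open>a : [0,\<infinity>) \<rightarrow> [0,\<infinity>]\<close> with \<open>a(0) = 0\<close>: the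
  Lebesgue--Stieltjes integrals over \<open>[0,t]\<close> increase to it as \<open>t\<close> increases through \<open>{a < \<infinity>}\<close>.
  Since \<open>ennreal\<close> maps negative reals to \<open>0\<close>, the integrator below vanishes on \<open>(-\<infinity>,0]\<close>.\<close>
definition stieltjes :: "(ennreal \<Rightarrow> ennreal) \<Rightarrow> (real \<Rightarrow> ennreal) \<Rightarrow> ennreal" where
  "stieltjes a g = (SUP t\<in>{t. 0 \<le> t \<and> a (ennreal t) < \<infinity>}.
     \<integral>\<^sup>+s\<in>{0..t}. g s \<partial>interval_measure (\<lambda>s. enn2real (a (ennreal (min s t)))))"

definition revuz ::
  "'a::topological_space measure \<Rightarrow> (ennreal \<Rightarrow> 'w \<Rightarrow> 'a option) \<Rightarrow> ('a option \<Rightarrow> 'w measure) \<Rightarrow>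
   (ennreal \<Rightarrow> 'w \<Rightarrow> ennreal) \<Rightarrow> 'a measure \<Rightarrow> bool" where
  "revuz m X P A \<mu> \<longleftrightarrow>
    (\<forall>\<alpha>>0. \<forall>f\<in>borel_measurable borel. \<forall>h\<in>borel_measurable borel.
      (\<integral>\<^sup>+x. h x * (\<integral>\<^sup>+\<omega>. stieltjes (\<lambda>t. A t \<omega>)
           (\<lambda>s. ennreal (exp (- \<alpha> * s)) * case_option 0 f (X (ennreal s) \<omega>))
           \<partial>completion (P (Some x))) \<partial>completion m) =
      (\<integral>\<^sup>+x. f x * resolvent X P \<alpha> h x \<partial>\<mu>))"

text \<open>\<open>R\<^sub>\<alpha>\<mu>\<close>, as a function of the additive functional \<open>A\<^sup>\<mu>\<close>.\<close>
definition af_potential ::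
  "('a option \<Rightarrow> 'w measure) \<Rightarrow> (ennreal \<Rightarrow> 'w \<Rightarrow> ennreal) \<Rightarrow> real \<Rightarrow> 'a \<Rightarrow> ennreal" where
  "af_potential P A \<alpha> x =
    (\<integral>\<^sup>+\<omega>. stieltjes (\<lambda>t. A t \<omega>) (\<lambda>s. ennreal (exp (- \<alpha> * s))) \<partial>completion (P (Some x)))"

text \<open>In the next two definitions \<open>A\<close> is a representative of \<open>A\<^sup>\<mu>\<close>, which is unique up to
  equivalence; the norms do not depend on its choice.\<close>

definition kato_class where
  "kato_class m \<F> \<E> X \<theta> P = {\<mu> \<in> smooth m \<F> \<E>.
    \<exists>A. pcaf m \<F> \<E> X \<theta> P A \<and> revuz m X P A \<mu> \<and>
      ((\<lambda>\<alpha>. qe_norm m \<F> \<E> (af_potential P A \<alpha>)) \<longlongrightarrow> 0) at_top}"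

definition dynkin_class where
  "dynkin_class m \<F> \<E> X \<theta> P = {\<mu> \<in> smooth m \<F> \<E>.
    \<exists>A. pcaf m \<F> \<E> X \<theta> P A \<and> revuz m X P A \<mu> \<and>
      qe_norm m \<F> \<E> (af_potential P A 1) < \<infinity>}"

definition kato_00 where
  "kato_00 m \<F> \<E> X \<theta> P = kato_class m \<F> \<E> X \<theta> P \<inter> S_00 m \<F> \<E>"

definition dynkin_00 where
  "dynkin_00 m \<F> \<E> X \<theta> P = dynkin_class m \<F> \<E> X \<theta> P \<inter> S_00 m \<F> \<E>"

end

theory Submission
  imports Defs
begin

text \<open>
  Members of \<open>S_00\<close> are finite measures, so only one inclusion has content: a finite smooth measure
  \<open>\<mu>\<close> in the Kato or Dynkin class belongs to \<open>S_00\<close>.  Write \<open>R \<alpha>\<close> for the resolvent of the process and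
  \<open>\<mu>R \<alpha>\<close> for the measure \<open>h \<mapsto> \<integral> R \<alpha> h d\<mu>\<close>.

  The Revuz formula with \<open>f = 1\<close> says that \<open>\<mu>R \<alpha>\<close> has a density with respect to \<open>m\<close> which is at most the
  potential \<open>R \<alpha> \<mu>\<close> of the additive functional, and the quasi-everywhere bound on that potential gives
  \<open>\<mu>R \<alpha> \<le> l \<cdot> m\<close> (\<open>revuz_norm_dominates\<close>).  For a Kato measure this is available for some large \<open>\<alpha>\<close>, and
  the resolvent equation carries it to \<open>\<alpha> = 1\<close> (\<open>domination_order_one\<close>).  From here on
  the argument runs on the two facts \<open>\<mu>R 1 \<le> M \<cdot> m\<close> and \<open>\<mu>(E) < \<infinity>\<close>.

  The 1-potential \<open>U\<close> of \<open>\<mu>\<close> is built by approximation instead of by a representation theorem.  Let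
  \<open>G k\<close> be the density of \<open>k \<cdot> \<mu>R(1+k)\<close>; it lies in \<open>L\<^sup>2\<close>, and \<open>u k = R 1 (G k)\<close> lies in the domain with
  \<open>\<E>\<^sub>1(u k, v) = \<integral> G k \<cdot> v dm\<close>.  The resolvent equation and the symmetry of \<open>R 1\<close> give, for \<open>h \<ge> 0\<close>,
  \<open>\<integral> h \<cdot> u k dm = \<integral> (R 1 h - R(1+k) h) d\<mu>\<close>.  Hence \<open>0 \<le> u k \<le> M\<close>, and \<open>\<E>\<^sub>1(u j, u k)\<close> is increasing in
  both indices and bounded.  A family with increasing Gram matrix satisfies
  \<open>\<E>\<^sub>1(u k - u j, u k - u j) \<le> \<E>\<^sub>1(u k, u k) - \<E>\<^sub>1(u j, u j)\<close> for \<open>j \<le> k\<close> and is therefore Cauchy.  Its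
  limit \<open>U\<close> is bounded by \<open>M\<close>, and since \<open>k \<cdot> R(1+k) f \<rightarrow> f\<close> pointwise for continuous \<open>f\<close> of compact
  support, \<open>\<E>\<^sub>1(f, U) = \<integral> f d\<mu>\<close> for all \<open>f\<close> in the core (\<open>representation\<close>).

  Two steps remain.  Applying this formula to \<open>\<bar>f\<bar>\<close>, whose energy is controlled by that of \<open>f\<close>, gives
  \<open>\<integral> \<bar>f\<bar> d\<mu> \<le> C \<cdot> \<E>\<^sub>1(f, f)\<^bsup>1/2\<^esup>\<close>, that is \<open>\<mu> \<in> S_0\<close> (\<open>S_0_of_representation\<close>).  The formula extends from
  the core to every quasi-continuous version \<open>g\<close> of every \<open>f\<close> in the domain because core functions that
  approach \<open>f\<close> fast in energy converge to \<open>g\<close> off a set of capacity zero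
  (\<open>quasi_everywhere_convergence\<close>), which \<open>\<mu>\<close> does not charge
  (\<open>one_potential_of_representation\<close>).
\<close>

section \<open>The state space with cemetery\<close>

text \<open>A neighbourhood of the cemetery is the complement of a compact set, so it is already in the
  \<open>\<sigma>\<close>-algebra generated by the open subsets of \<open>E\<close>. Neighbourhoods of \<open>None\<close> thus need not be
  considered in measurability proofs.\<close>
lemma sets_cemetery_borel:
  "sets (cemetery_borel :: 'a::topological_space option measure) = sigma_sets UNIV ((`) Some ` {G. open G})"
    (is "_ = sigma_sets UNIV ?G")
proof -
  have "U \<in> sigma_sets UNIV ?G" if "openin cemetery_top U" for U :: "'a option set"
  proof -
    consider V where "open V" "U = Some ` V"
      | C :: "'a set" where "closed C" "U = insert None (Some ` (UNIV - C))"
      using \<open>openin cemetery_top U\<close> unfolding openin_Alexandroff_compactification by auto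
    then show ?thesis
    proof cases
      case 1
      then show ?thesis by auto
    next
      case 2
      have o: "Some ` G \<in> sigma_sets UNIV ?G" if "open G" for G :: "'a set"
        using that by auto
      have "U = (UNIV - Some ` UNIV) \<union> Some ` (UNIV - C)"
        using 2 by (auto simp: image_iff)
      moreover have "\<dots> \<in> sigma_sets UNIV ?G"
        using o[of UNIV] o[of "UNIV - C"] 2(1)
        by (intro sigma_sets_Un sigma_sets.Compl) (auto simp: Compl_eq_Diff_UNIV[symmetric] open_Compl)
      ultimately show ?thesis by simp
    qed
  qed
  moreover have "?G \<subseteq> {U. openin cemetery_top U}"
    by auto
  ultimately have "sigma_sets UNIV {U. openin cemetery_top U} = sigma_sets UNIV ?G"
    by (intro sigma_sets_eqI) auto
  then show ?thesis
    by (simp add: cemetery_borel_def)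
qed

lemma space_cemetery_borel [simp]: "space cemetery_borel = UNIV"
  by (simp add: cemetery_borel_def space_measure_of_conv)

lemma Some_image_in_cemetery_borel: 
  assumes "B \<in> sets borel" shows "Some ` B \<in> sets cemetery_borel"
proof -
  have "B \<in> sigma_sets UNIV {G. open G}"
    using assms by (simp add: borel_def)
  then show ?thesis
  proof induction
    case (Basic a)
    then show ?case by (auto simp: sets_cemetery_borel)
  next
    case Empty
    then show ?case by simp
  next
    case (Compl a)
    have "Some ` (UNIV :: 'a set) \<in> sets cemetery_borel"
      by (auto simp: sets_cemetery_borel)
    moreover have "Some ` (UNIV - a) = Some ` UNIV - Some ` a"
      by auto
    ultimately show ?case using Compl by auto
  next
    case (Union a)
    then show ?case by (auto simp: image_UN)
  qed
qed

lemma measurable_case_option_cemetery [measurable]: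
  fixes f :: "'a::topological_space \<Rightarrow> 'b::{zero,topological_space}"
  assumes [measurable]: "f \<in> borel_measurable borel"
  shows "case_option 0 f \<in> borel_measurable cemetery_borel"
proof (rule measurableI)
  fix B :: "'b set" assume [measurable]: "B \<in> sets borel"
  have "UNIV - Some ` UNIV = {None :: 'a option}"
    by (auto simp: image_iff)
  then have None: "{None :: 'a option} \<in> sets cemetery_borel"
    using sets.compl_sets[OF Some_image_in_cemetery_borel[of "UNIV :: 'a set"]] by simp
  have "f -` B \<in> sets borel"
    using measurable_sets[OF assms, of B] by simp
  then have Some: "Some ` (f -` B) \<in> sets cemetery_borel"
    by (rule Some_image_in_cemetery_borel)
  have "case_option 0 f -` B \<inter> space cemetery_borel = (if 0 \<in> B then {None} else {}) \<union> Some ` (f -` B)"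
    by (auto split: option.splits)
  moreover have "(if 0 \<in> B then {None} else {}) \<union> Some ` (f -` B) \<in> sets cemetery_borel"
    using sets.Un[OF None Some] Some by simp
  ultimately show "case_option 0 f -` B \<inter> space cemetery_borel \<in> sets cemetery_borel"
    by simp
qed simp

lemma measurable_Some_cemetery [measurable]: "Some \<in> borel \<rightarrow>\<^sub>M cemetery_borel"
  unfolding cemetery_borel_def
proof (rule measurable_measure_of)
  fix U :: "'a option set"
  assume "U \<in> {U. openin cemetery_top U}"
  then have "openin euclidean {x \<in> topspace euclidean. Some x \<in> U}"
    using openin_continuous_map_preimage[OF continuous_map_Some] by blast
  then have "open (Some -` U)"
    by (simp add: vimage_def)
  then show "Some -` U \<inter> space borel \<in> sets borel" by auto
qed auto

section \<open>Measurability along the paths\<close>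

context hunt_process
begin

abbreviation "\<N> \<equiv> natural_filtration X \<infinity>"

lemma space_natural_filtration [simp]: "space (natural_filtration X t) = UNIV"
  by (simp add: natural_filtration_def space_measure_of_conv)

lemma measurable_X [measurable]: "X t \<in> \<N> \<rightarrow>\<^sub>M cemetery_borel"
proof (rule measurableI)
  fix B assume "B \<in> sets (cemetery_borel :: 'a option measure)"
  then show "X t -` B \<inter> space \<N> \<in> sets \<N>"
    unfolding natural_filtration_def by (auto simp: sets_measure_of_conv intro!: sigma_sets.Basic) 
qed simp

text \<open>The extension of \<open>f\<close> by \<open>0\<close> may be discontinuous at the cemetery, but a path that has reached the
  cemetery stays there, so right-continuity survives the composition.\<close>
lemma right_continuous_extension:
  fixes f :: "'a \<Rightarrow> real"
  assumes f: "continuous_on UNIV f" and t: "t < \<infinity>"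
  shows "((\<lambda>s. case_option 0 f (X s \<omega>)) \<longlongrightarrow> case_option 0 f (X t \<omega>)) (at_right t)"
proof (cases "X t \<omega>")
  case None
  have "eventually (\<lambda>s. case_option 0 f (X s \<omega>) = 0) (at_right t)"
    using absorbing[OF None] by (auto simp: eventually_at_filter intro!: always_eventually)
  then show ?thesis using None by (auto intro: tendsto_eventually)
next
  case (Some y)
  show ?thesis
  proof (rule topological_tendstoI)
    fix S :: "real set" assume S: "open S" "case_option 0 f (X t \<omega>) \<in> S"
    have "open (f -` S)"
      using f S by (simp add: continuous_on_open_vimage)
    then have "openin cemetery_top (Some ` (f -` S))" by simp
    moreover have "X t \<omega> \<in> Some ` (f -` S)" using S Some by auto
    ultimately have "eventually (\<lambda>s. X s \<omega> \<in> Some ` (f -` S)) (at_right t)"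
      using right_continuous_path[OF t, of \<omega>] unfolding limitin_def by blast
    then show "eventually (\<lambda>s. case_option 0 f (X s \<omega>) \<in> S) (at_right t)"
      by eventually_elim auto
  qed
qed

lemma right_continuous_real_time:
  fixes f :: "'a \<Rightarrow> real" and r :: "nat \<Rightarrow> real"
  assumes f: "continuous_on UNIV f" and t: "0 \<le> t" and r: "\<And>n. t < r n" "r \<longlonglongrightarrow> t"
  shows "(\<lambda>n. case_option 0 f (X (ennreal (r n)) \<omega>)) \<longlonglongrightarrow> case_option 0 f (X (ennreal t) \<omega>)"
proof -
  have "filterlim (\<lambda>n. ennreal (r n)) (at_right (ennreal t)) sequentially"
    unfolding filterlim_at
    using r t ennreal_lessI[OF le_less_trans[OF t r(1)] r(1)]
    by (auto intro!: always_eventually tendsto_ennrealI simp: less_imp_neq[symmetric])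
  then show ?thesis
    by (intro filterlim_compose[OF right_continuous_extension[OF f, of "ennreal t" \<omega>]]) simp_all
qed

text \<open>A right-continuous process is jointly measurable, as the limit of its values at the next grid
  times \<open>(i + 1) / (n + 1)\<close>. The limit is taken in \<open>\<real>\<close>, after composition with a continuous function;
  every open \<open>G\<close> is the set where some continuous function is positive.\<close>
lemma measurable_X_pair [measurable]:
  "(\<lambda>(t, \<omega>). X (ennreal t) \<omega>) \<in> borel \<Otimes>\<^sub>M \<N> \<rightarrow>\<^sub>M cemetery_borel"
proof -
  have cont: "(\<lambda>(t, \<omega>). case_option 0 f (X (ennreal t) \<omega>)) \<in> borel_measurable (borel \<Otimes>\<^sub>M \<N>)"
    if f: "continuous_on UNIV f" for f :: "'a \<Rightarrow> real"
  proof -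
    (* The grid point must lie strictly to the right of t, hence i + 1. *)
    define q where "q n i = (of_int i + 1) / real (Suc n)" for n and i :: int
    define j where "j n t = \<lfloor>real (Suc n) * max 0 t\<rfloor>" for n :: nat and t :: real
    have [measurable]: "f \<in> borel_measurable borel"
      using f by (rule borel_measurable_continuous_onI)
    have lim: "(\<lambda>n. case_option 0 f (X (ennreal (q n (j n t))) \<omega>)) \<longlonglongrightarrow> case_option 0 f (X (ennreal (max 0 t)) \<omega>)" for t \<omega>
    proof (rule right_continuous_real_time[OF f])
      have *: "max 0 t < q n (j n t)" "q n (j n t) \<le> max 0 t + 1 / real (Suc n)" for n
      proof -
        define N where "N = real (Suc n)"
        have "N * max 0 t < of_int (j n t) + 1" "of_int (j n t) \<le> N * max 0 t" "0 < N"
          unfolding j_def N_def by linarith+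
        then show "max 0 t < q n (j n t)" "q n (j n t) \<le> max 0 t + 1 / real (Suc n)"
          unfolding q_def N_def[symmetric]
          by (simp_all add: pos_less_divide_eq pos_divide_le_eq ring_distribs mult.commute del: max_less_iff_conj)
      qed
      show "max 0 t < q n (j n t)" for n by (rule *)
      have "(\<lambda>n. max 0 t + 1 / real (Suc n)) \<longlonglongrightarrow> max 0 t + 0"
        by (intro tendsto_intros lim_1_over_n[THEN LIMSEQ_Suc])
      then show "(\<lambda>n. q n (j n t)) \<longlonglongrightarrow> max 0 t"
        using * by (intro tendsto_sandwich[OF _ _ tendsto_const, of "max 0 t" "\<lambda>n. q n (j n t)"])
          (auto intro!: always_eventually less_imp_le)
    qed simp
    have "(\<lambda>z. case_option 0 f (X (ennreal (q n (j n (fst z)))) (snd z))) \<in> borel_measurable (borel \<Otimes>\<^sub>M \<N>)" for n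
    proof (rule measurable_compose_countable[where f="\<lambda>i z. case_option 0 f (X (ennreal (q n i)) (snd z))"])
      show "(\<lambda>z. j n (fst z)) \<in> borel \<Otimes>\<^sub>M \<N> \<rightarrow>\<^sub>M count_space UNIV"
        unfolding j_def by measurable
      show "(\<lambda>z. case_option 0 f (X (ennreal (q n i)) (snd z))) \<in> borel_measurable (borel \<Otimes>\<^sub>M \<N>)" for i
        by (rule measurable_compose[OF measurable_compose[OF measurable_snd measurable_X] measurable_case_option_cemetery]) measurable
    qed
    then have "(\<lambda>z. case_option 0 f (X (ennreal (max 0 (fst z))) (snd z))) \<in> borel_measurable (borel \<Otimes>\<^sub>M \<N>)"
      by (rule borel_measurable_LIMSEQ_real[rotated]) (rule lim)
    moreover have "ennreal (max 0 t) = ennreal t" for t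
      by (cases "0 \<le> t") (auto simp: ennreal_neg)
    ultimately show ?thesis by (simp add: case_prod_beta')
  qed
  have "(\<lambda>z. X (ennreal (fst z)) (snd z)) \<in> borel \<Otimes>\<^sub>M \<N> \<rightarrow>\<^sub>M sigma UNIV ((`) Some ` {G. open G})"
  proof (rule measurable_measure_of)
    fix A :: "'a option set" assume "A \<in> (`) Some ` {G. open G}"
    then obtain G where G: "open G" "A = Some ` G" by auto
    define f where "f = (if G = UNIV then (\<lambda>_. 1) else (\<lambda>y. infdist y (- G)))"
    have f: "continuous_on UNIV f"
      unfolding f_def by (auto intro!: continuous_intros)
    have pos: "0 < f y \<longleftrightarrow> y \<in> G" for y
    proof (cases "G = UNIV")
      case False
      then have "y \<in> - G \<longleftrightarrow> infdist y (- G) = 0"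
        using G by (intro in_closed_iff_infdist_zero) auto
      then show ?thesis using False infdist_nonneg[of y "-G"] unfolding f_def by (auto simp: less_le)
    qed (simp add: f_def)
    have "y \<in> A \<longleftrightarrow> 0 < case_option 0 f y" for y
      using pos unfolding G(2) by (cases y) auto
    then have "(\<lambda>z. X (ennreal (fst z)) (snd z)) -` A \<inter> space (borel \<Otimes>\<^sub>M \<N>) =
       {z \<in> space (borel \<Otimes>\<^sub>M \<N>). 0 < case_option 0 f (X (ennreal (fst z)) (snd z))}"
      by blast
    also have "\<dots> \<in> sets (borel \<Otimes>\<^sub>M \<N>)"
      using cont[OF f] unfolding borel_measurable_iff_greater case_prod_beta' by blast
    finally show "(\<lambda>z. X (ennreal (fst z)) (snd z)) -` A \<inter> space (borel \<Otimes>\<^sub>M \<N>) \<in> sets (borel \<Otimes>\<^sub>M \<N>)" .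
  qed auto
  also have "borel \<Otimes>\<^sub>M \<N> \<rightarrow>\<^sub>M sigma UNIV ((`) Some ` {G. open G}) = borel \<Otimes>\<^sub>M \<N> \<rightarrow>\<^sub>M cemetery_borel"
    by (rule measurable_cong_sets) (auto simp: sets_cemetery_borel sets_measure_of_conv)
  finally show ?thesis by (simp add: case_prod_beta')
qed

lemma sets_P [simp]: "sets (P x) = sets \<N>" and prob_space_P: "prob_space (P x)"
  using measurable_space[OF kernel, of x] by (auto simp: space_prob_algebra)

lemma space_P [simp]: "space (P x) = UNIV"
  by (metis sets_eq_imp_space_eq[OF sets_P] space_natural_filtration)

lemma sigma_finite_P: "sigma_finite_measure (P x)"
  using prob_space_P by (simp add: prob_space_imp_sigma_finite)

lemma measurable_path [measurable]:
  assumes [measurable]: "f \<in> borel_measurable borel"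
  shows "(\<lambda>(t, \<omega>). case_option 0 f (X (ennreal t) \<omega>)) \<in> borel_measurable (borel \<Otimes>\<^sub>M \<N>)"
  using measurable_compose[OF measurable_X_pair measurable_case_option_cemetery[OF assms]]
  by (simp add: case_prod_beta')

text \<open>Extending by \<open>0\<close> is consistent with starting the process at any point of \<open>E \<union> {\<partial>}\<close>, as it never
  leaves the cemetery. This makes the semigroup a kernel on the extended state space.\<close>
lemma nn_integral_P_eq_transition:
  "(\<integral>\<^sup>+\<omega>. case_option 0 f (X t \<omega>) \<partial>P y) = case_option 0 (transition X P t f) y"
proof (cases y)
  case None
  have "AE \<omega> in P None. case_option 0 f (X t \<omega>) = 0"
    using normal[of None] by eventually_elim (auto simp: absorbing)
  then show ?thesis
    using None nn_integral_cong_AE[of _ "\<lambda>_. 0" "P None"] by simp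
qed (simp add: transition_def)

lemma measurable_transition_option:
  assumes [measurable]: "f \<in> borel_measurable borel"
  shows "(\<lambda>(t, y). case_option 0 (transition X P (ennreal t) f) y) \<in> borel_measurable (borel \<Otimes>\<^sub>M cemetery_borel)"
  unfolding nn_integral_P_eq_transition[symmetric] case_prod_beta'
proof (rule nn_integral_measurable_subprob_algebra2[where N=\<N>])
  have "(\<lambda>z. (fst (fst z), snd z)) \<in> (borel \<Otimes>\<^sub>M cemetery_borel) \<Otimes>\<^sub>M \<N> \<rightarrow>\<^sub>M borel \<Otimes>\<^sub>M \<N>"
    by measurable
  from measurable_compose[OF this measurable_path[OF assms]]
  show "(\<lambda>(z, \<omega>). case_option 0 f (X (ennreal (fst z)) \<omega>)) \<in> borel_measurable ((borel \<Otimes>\<^sub>M cemetery_borel) \<Otimes>\<^sub>M \<N>)"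
    by (simp add: case_prod_beta')
  have "P \<in> cemetery_borel \<rightarrow>\<^sub>M subprob_algebra \<N>"
    by (rule measurable_prob_algebraD[OF kernel])
  then show "(\<lambda>z. P (snd z)) \<in> borel \<Otimes>\<^sub>M cemetery_borel \<rightarrow>\<^sub>M subprob_algebra \<N>"
    by measurable
qed

lemma measurable_transition_pair:
  assumes "f \<in> borel_measurable borel"
  shows "(\<lambda>(t, x). transition X P (ennreal t) f x) \<in> borel_measurable (borel \<Otimes>\<^sub>M borel)"
proof -
  have "(\<lambda>(t, x). (t, Some x)) \<in> borel \<Otimes>\<^sub>M borel \<rightarrow>\<^sub>M borel \<Otimes>\<^sub>M cemetery_borel"
    by measurable
  from measurable_compose[OF this measurable_transition_option[OF assms]] show ?thesis
    by (simp add: case_prod_beta')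
qed

lemma measurable_transition [measurable]:
  assumes "f \<in> borel_measurable borel"
  shows "transition X P (ennreal t) f \<in> borel_measurable borel"
    "(\<lambda>t. transition X P (ennreal t) f x) \<in> borel_measurable borel"
    "(\<lambda>(x, t). transition X P (ennreal t) f x) \<in> borel_measurable (borel \<Otimes>\<^sub>M borel)"
proof -
  show "transition X P (ennreal t) f \<in> borel_measurable borel"
    using measurable_compose[OF measurable_Pair1'[of t borel borel] measurable_transition_pair[OF assms]] by simp
  show "(\<lambda>t. transition X P (ennreal t) f x) \<in> borel_measurable borel"
    using measurable_compose[OF measurable_Pair2'[of x borel borel] measurable_transition_pair[OF assms]] by simp
  show "(\<lambda>(x, t). transition X P (ennreal t) f x) \<in> borel_measurable (borel \<Otimes>\<^sub>M borel)"
    using measurable_compose[OF measurable_pair_swap' measurable_transition_pair[OF assms]] by (simp add: case_prod_beta')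
qed

lemma resolvent_eq_laplace:
  assumes [measurable]: "f \<in> borel_measurable borel"
  shows "resolvent X P \<alpha> f x = (\<integral>\<^sup>+t\<in>{0..}. ennreal (exp (- \<alpha> * t)) * transition X P (ennreal t) f x \<partial>lborel)"
proof -
  interpret P: pair_sigma_finite lborel "P (Some x)"
    unfolding pair_sigma_finite_def using sigma_finite_lborel sigma_finite_P by simp
  have [measurable]: "(\<lambda>(t, \<omega>). case_option 0 f (X (ennreal t) \<omega>)) \<in> borel_measurable (lborel \<Otimes>\<^sub>M P (Some x))"
    by (subst measurable_cong_sets[OF sets_pair_measure_cong[OF sets_lborel sets_P] refl]) (rule measurable_path[OF assms])
  have X1: "(\<lambda>\<omega>. case_option 0 f (X (ennreal t) \<omega>)) \<in> borel_measurable (P (Some x))" for t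
    by (subst measurable_cong_sets[OF sets_P refl]) measurable
  have "resolvent X P \<alpha> f x = (\<integral>\<^sup>+\<omega>. (\<integral>\<^sup>+t. ennreal (exp (- \<alpha> * t)) * case_option 0 f (X (ennreal t) \<omega>) * indicator {0..} t \<partial>lborel) \<partial>P (Some x))"
    unfolding resolvent_def by simp
  also have "\<dots> = (\<integral>\<^sup>+t. (\<integral>\<^sup>+\<omega>. ennreal (exp (- \<alpha> * t)) * case_option 0 f (X (ennreal t) \<omega>) * indicator {0..} t \<partial>P (Some x)) \<partial>lborel)"
    by (rule P.Fubini') measurable
  also have "\<dots> = (\<integral>\<^sup>+t. ennreal (exp (- \<alpha> * t)) * transition X P (ennreal t) f x * indicator {0..} t \<partial>lborel)"
    unfolding transition_def using X1 by (auto intro!: nn_integral_cong simp: nn_integral_cmult nn_integral_multc indicator_def)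
  finally show ?thesis .
qed

lemma measurable_resolvent [measurable]:
  assumes [measurable]: "f \<in> borel_measurable borel"
  shows "resolvent X P \<alpha> f \<in> borel_measurable borel"
proof -
  have [measurable]: "(\<lambda>(x, t). transition X P (ennreal t) f x) \<in> borel_measurable (borel \<Otimes>\<^sub>M lborel)"
    by (subst measurable_cong_sets[OF sets_pair_measure_cong[OF refl sets_lborel] refl]) (rule measurable_transition[OF assms])
  have "(\<lambda>x. \<integral>\<^sup>+t. ennreal (exp (- \<alpha> * t)) * transition X P (ennreal t) f x * indicator {0..} t \<partial>lborel) \<in> borel_measurable borel"
    by (intro lborel.borel_measurable_nn_integral) measurable
  then show ?thesis
    by (subst resolvent_eq_laplace[OF assms, abs_def]) 
qed

end

section \<open>Laplace transforms\<close>

lemma nn_integral_exp_Ici: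
  assumes "a > 0"
  shows "(\<integral>\<^sup>+t\<in>{0..}. ennreal (exp (- a * t)) \<partial>lborel) = ennreal (1 / a)"
proof -
  have "((\<lambda>t. - exp (- a * t) / a) \<longlongrightarrow> 0) at_top"
  proof -
    have "LIM t at_top. - a * t :> at_bot"
      using assms by (intro filterlim_tendsto_neg_mult_at_bot[OF tendsto_const _ filterlim_ident]) auto
    then have "((\<lambda>t. exp (- a * t)) \<longlongrightarrow> 0) at_top"
      by (rule filterlim_compose[OF exp_at_bot])
    then show ?thesis
      using tendsto_divide[OF tendsto_minus tendsto_const, of _ 0 at_top a] assms by simp
  qed
  then have "(\<integral>\<^sup>+t\<in>{0..}. ennreal (exp (- a * t)) \<partial>lborel) = ennreal (0 - (- exp (- a * 0) / a))"
    using assms by (intro nn_integral_FTC_atLeast) (auto intro!: derivative_eq_intros)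
  then show ?thesis by simp
qed

text \<open>The analytic content of the resolvent equation: with \<open>r = s + t\<close> the double integral becomes
  \<open>\<integral> exp (-a r) \<phi> r (\<integral>\<^sub>0\<^sup>r exp (-(b-a) t) dt) dr\<close>, and the inner integral times \<open>b - a\<close> is
  \<open>1 - exp (-(b-a) r)\<close>.\<close>
lemma nn_integral_exp_convolution:
  fixes \<phi> :: "real \<Rightarrow> ennreal"
  assumes [measurable]: "\<phi> \<in> borel_measurable borel" and "a \<le> b"
  shows "(\<integral>\<^sup>+t\<in>{0..}. ennreal (exp (- a * t)) * \<phi> t \<partial>lborel) =
    (\<integral>\<^sup>+t\<in>{0..}. ennreal (exp (- b * t)) * \<phi> t \<partial>lborel) + ennreal (b - a) *
     (\<integral>\<^sup>+t\<in>{0..}. ennreal (exp (- b * t)) * (\<integral>\<^sup>+s\<in>{0..}. ennreal (exp (- a * s)) * \<phi> (t + s) \<partial>lborel) \<partial>lborel)"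
    (is "?A = ?B + ennreal (b - a) * ?C")
proof -
  define e where "e t = ennreal ((b - a) * exp (- (b - a) * t))" for t
  have e [measurable]: "e \<in> borel_measurable borel"
    unfolding e_def by measurable
  have "(\<integral>\<^sup>+s\<in>{0..}. ennreal (exp (- a * s)) * \<phi> (t + s) \<partial>lborel) =
        (\<integral>\<^sup>+r\<in>{t..}. ennreal (exp (- a * (r - t))) * \<phi> r \<partial>lborel)" for t
    by (subst nn_integral_real_affine[where t=t and c=1, of "\<lambda>r. _ r * indicator {t..} r"])
      (auto simp: indicator_def intro!: nn_integral_cong)
  moreover have "ennreal (b - a) * ?C = (\<integral>\<^sup>+t. ennreal (b - a) * (ennreal (exp (- b * t)) *
      (\<integral>\<^sup>+s\<in>{0..}. ennreal (exp (- a * s)) * \<phi> (t + s) \<partial>lborel) * indicator {0..} t) \<partial>lborel)"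
    by (rule nn_integral_cmult[symmetric]) measurable
  ultimately have "ennreal (b - a) * ?C = (\<integral>\<^sup>+t. ennreal (b - a) * (ennreal (exp (- b * t)) *
      (\<integral>\<^sup>+r\<in>{t..}. ennreal (exp (- a * (r - t))) * \<phi> r \<partial>lborel) * indicator {0..} t) \<partial>lborel)"
    by simp
  also have "\<dots> = (\<integral>\<^sup>+t. (\<integral>\<^sup>+r. (e t * indicator {0..r} t) * (ennreal (exp (- a * r)) * \<phi> r) \<partial>lborel) \<partial>lborel)"
  proof (rule nn_integral_cong)
    fix t :: real
    have "ennreal (b - a) * (ennreal (exp (- b * t)) *
      (\<integral>\<^sup>+r\<in>{t..}. ennreal (exp (- a * (r - t))) * \<phi> r \<partial>lborel) * indicator {0..} t) =
      (\<integral>\<^sup>+r. (ennreal (b - a) * ennreal (exp (- b * t)) * indicator {0..} t) * (ennreal (exp (- a * (r - t))) * \<phi> r * indicator {t..} r) \<partial>lborel)"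
      by (subst nn_integral_cmult) (auto simp: mult_ac)
    also have "\<dots> = (\<integral>\<^sup>+r. (e t * indicator {0..r} t) * (ennreal (exp (- a * r)) * \<phi> r) \<partial>lborel)"
    proof (rule nn_integral_cong)
      fix r
      have "exp (- b * t) * exp (- a * (r - t)) = exp (- (b - a) * t) * exp (- a * r)"
        by (simp add: exp_add[symmetric] algebra_simps)
      then have "ennreal (b - a) * ennreal (exp (- b * t)) * ennreal (exp (- a * (r - t))) = e t * ennreal (exp (- a * r))"
        using \<open>a \<le> b\<close> unfolding e_def by (simp add: ennreal_mult[symmetric] mult.assoc)
      moreover have "indicator {0..} t * indicator {t..} r = (indicator {0..r} t :: ennreal)"
        by (auto simp: indicator_def)
      moreover have "(ennreal (b - a) * ennreal (exp (- b * t)) * indicator {0..} t) * (ennreal (exp (- a * (r - t))) * \<phi> r * indicator {t..} r) =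
        (ennreal (b - a) * ennreal (exp (- b * t)) * ennreal (exp (- a * (r - t)))) * \<phi> r * (indicator {0..} t * indicator {t..} r)"
        by (simp only: mult_ac)
      ultimately show "(ennreal (b - a) * ennreal (exp (- b * t)) * indicator {0..} t) * (ennreal (exp (- a * (r - t))) * \<phi> r * indicator {t..} r) =
        (e t * indicator {0..r} t) * (ennreal (exp (- a * r)) * \<phi> r)"
        by (simp only: mult_ac)
    qed
    finally show "ennreal (b - a) * (ennreal (exp (- b * t)) *
      (\<integral>\<^sup>+r\<in>{t..}. ennreal (exp (- a * (r - t))) * \<phi> r \<partial>lborel) * indicator {0..} t) = \<dots>" .
  qed
  also have "\<dots> = (\<integral>\<^sup>+r. (\<integral>\<^sup>+t. (e t * indicator {0..r} t) * (ennreal (exp (- a * r)) * \<phi> r) \<partial>lborel) \<partial>lborel)"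
    unfolding indicator_def
    by (rule lborel_pair.Fubini'[symmetric]) simp
  also have "\<dots> = (\<integral>\<^sup>+r. ennreal (1 - exp (- (b - a) * r)) * (ennreal (exp (- a * r)) * \<phi> r) * indicator {0..} r \<partial>lborel)"
  proof (rule nn_integral_cong)
    fix r :: real
    have "(\<integral>\<^sup>+t. (e t * indicator {0..r} t) * (ennreal (exp (- a * r)) * \<phi> r) \<partial>lborel) =
       (\<integral>\<^sup>+t. e t * indicator {0..r} t \<partial>lborel) * (ennreal (exp (- a * r)) * \<phi> r)"
      by (rule nn_integral_multc) simp
    moreover have "(\<integral>\<^sup>+t. e t * indicator {0..r} t \<partial>lborel) = ennreal (1 - exp (- (b - a) * r))" if "0 \<le> r"
      unfolding e_def using that \<open>a \<le> b\<close>
      by (subst nn_integral_FTC_Icc[where F="\<lambda>t. - exp (- (b - a) * t)"]) (auto intro!: derivative_eq_intros simp: algebra_simps)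
    ultimately show "(\<integral>\<^sup>+t. (e t * indicator {0..r} t) * (ennreal (exp (- a * r)) * \<phi> r) \<partial>lborel) =
       ennreal (1 - exp (- (b - a) * r)) * (ennreal (exp (- a * r)) * \<phi> r) * indicator {0..} r"
      by (cases "0 \<le> r") (auto simp: indicator_def)
  qed
  finally have C: "ennreal (b - a) * ?C = \<dots>" .
  have "?B + ennreal (b - a) * ?C = (\<integral>\<^sup>+r. ennreal (exp (- b * r)) * \<phi> r * indicator {0..} r +
      ennreal (1 - exp (- (b - a) * r)) * (ennreal (exp (- a * r)) * \<phi> r) * indicator {0..} r \<partial>lborel)"
    unfolding C by (rule nn_integral_add[symmetric]) measurable
  also have "\<dots> = ?A"
  proof (rule nn_integral_cong)
    fix r :: real
    show "ennreal (exp (- b * r)) * \<phi> r * indicator {0..} r +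
      ennreal (1 - exp (- (b - a) * r)) * (ennreal (exp (- a * r)) * \<phi> r) * indicator {0..} r =
      ennreal (exp (- a * r)) * \<phi> r * indicator {0..} r"
    proof (cases "0 \<le> r")
      case True
      have "exp (- b * r) + (1 - exp (- (b - a) * r)) * exp (- a * r) = exp (- a * r)"
        by (simp add: exp_add[symmetric] algebra_simps)
      moreover have "0 \<le> 1 - exp (- (b - a) * r)"
        using True \<open>a \<le> b\<close> by (simp add: mult_nonpos_nonneg)
      ultimately have "ennreal (exp (- b * r)) + ennreal (1 - exp (- (b - a) * r)) * ennreal (exp (- a * r)) = ennreal (exp (- a * r))"
        by (simp add: ennreal_mult[symmetric] ennreal_plus[symmetric] del: ennreal_plus)
      then have "(ennreal (exp (- b * r)) + ennreal (1 - exp (- (b - a) * r)) * ennreal (exp (- a * r))) * \<phi> r = ennreal (exp (- a * r)) * \<phi> r"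
        by (rule arg_cong)
      then show ?thesis using True by (simp add: distrib_right mult.assoc)
    qed simp
  qed
  finally show ?thesis by simp
qed

section \<open>Semigroup and resolvent\<close>

context hunt_process
begin

text \<open>The strong Markov property at a constant time, transferred from the law of \<open>X\<close> to integrals by
  comparing the distribution of \<open>X (t + s)\<close> with the composition of two kernels.\<close>
lemma transition_semigroup:
  assumes f: "f \<in> borel_measurable borel" and st: "s < \<infinity>" "t < \<infinity>"
  shows "transition X P (t + s) f x = transition X P t (transition X P s f) x"
proof -
  let ?S = "cemetery_borel :: 'a option measure"
  have K: "P \<in> ?S \<rightarrow>\<^sub>M subprob_algebra \<N>"
    by (rule measurable_prob_algebraD[OF kernel])
  define Q where "Q = (\<lambda>y. distr (P y) ?S (X s))"
  have Q: "Q \<in> ?S \<rightarrow>\<^sub>M subprob_algebra ?S"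
    unfolding Q_def by (rule measurable_compose[OF K measurable_distr[OF measurable_X]])
  have X: "X r \<in> P y \<rightarrow>\<^sub>M ?S" for r y
    by (subst measurable_cong_sets[OF sets_P refl]) (rule measurable_X)
  have ret: "return ?S (Some x) \<in> space (prob_algebra ?S)"
    by (simp add: space_prob_algebra prob_space_return)
  have bind: "return ?S (Some x) \<bind> P = P (Some x)"
    by (rule bind_return[OF K]) simp
  have "distr (P (Some x)) ?S (X (t + s)) = distr (P (Some x)) ?S (X t) \<bind> Q"
  proof (rule measure_eqI)
    show "sets (distr (P (Some x)) ?S (X (t + s))) = sets (distr (P (Some x)) ?S (X t) \<bind> Q)"
      using Q by (subst sets_bind[where N="?S"]) (auto simp: Q_def)
    fix B assume "B \<in> sets (distr (P (Some x)) ?S (X (t + s)))"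
    then have B: "B \<in> sets ?S" by simp
    have pre: "X r -` B \<in> sets \<N>" for r
      using measurable_sets[OF measurable_X B] by simp
    have "emeasure (distr (P (Some x)) ?S (X (t + s))) B = emeasure (P (Some x)) (X (t + s) -` B)"
      using B X by (simp add: emeasure_distr)
    also have "\<dots> = emeasure (completion (P (Some x))) (UNIV \<inter> {\<omega>. X (t + s) \<omega> \<in> B})"
      using pre[of "t + s"] by (subst emeasure_completion) (auto simp: vimage_def main_part_sets)
    also have "\<dots> = (\<integral>\<^sup>+\<omega>. indicator UNIV \<omega> * emeasure (P (X t \<omega>)) {\<omega>'. X s \<omega>' \<in> B} \<partial>completion (P (Some x)))"
      using strong_markov[OF ret stopping_time_const[of _ t] _ B st(1), of UNIV]
      by (simp add: bind) (metis (no_types, lifting) completed_filtration_def iso_tuple_UNIV_I sets.empty_sets sets.top space_measure_of_conv Collect_const Int_UNIV_left)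
    also have "\<dots> = (\<integral>\<^sup>+\<omega>. emeasure (Q (X t \<omega>)) B \<partial>P (Some x))"
      using B X by (simp add: nn_integral_completion Q_def emeasure_distr vimage_def)
    also have "\<dots> = (\<integral>\<^sup>+y. emeasure (Q y) B \<partial>distr (P (Some x)) ?S (X t))"
      using X B Q by (subst nn_integral_distr) (auto intro: measurable_emeasure_kernel)
    also have "\<dots> = emeasure (distr (P (Some x)) ?S (X t) \<bind> Q) B"
      using Q B by (subst emeasure_bind[where N="?S"]) auto
    finally show "emeasure (distr (P (Some x)) ?S (X (t + s))) B = \<dots>" .
  qed
  then have "(\<integral>\<^sup>+y. case_option 0 f y \<partial>distr (P (Some x)) ?S (X (t + s))) =
      (\<integral>\<^sup>+y. \<integral>\<^sup>+z. case_option 0 f z \<partial>Q y \<partial>distr (P (Some x)) ?S (X t))"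
    using f Q by (simp add: nn_integral_bind[where B="?S"])
  moreover have "(\<integral>\<^sup>+z. case_option 0 f z \<partial>Q y) = case_option 0 (transition X P s f) y" for y
    unfolding nn_integral_P_eq_transition[symmetric] Q_def using f X by (subst nn_integral_distr) auto
  moreover have "case_option 0 (transition X P s f) \<in> borel_measurable ?S"
    unfolding calculation(2)[symmetric] 
    by (rule nn_integral_measurable_subprob_algebra2[OF _ Q]) (use f in measurable)
  ultimately show ?thesis
    unfolding transition_def[of X P "t + s"] transition_def[of X P t] using f X
    by (simp add: nn_integral_distr)
qed

lemma transition_resolvent:
  assumes [measurable]: "f \<in> borel_measurable borel" and t: "0 \<le> t"
  shows "transition X P (ennreal t) (resolvent X P \<alpha> f) x =
    (\<integral>\<^sup>+s\<in>{0..}. ennreal (exp (- \<alpha> * s)) * transition X P (ennreal (t + s)) f x \<partial>lborel)"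
proof -
  interpret P: pair_sigma_finite lborel "P (Some x)"
    unfolding pair_sigma_finite_def using sigma_finite_lborel sigma_finite_P by simp
  have "(\<lambda>(s, \<omega>). (s, X (ennreal t) \<omega>)) \<in> borel \<Otimes>\<^sub>M \<N> \<rightarrow>\<^sub>M borel \<Otimes>\<^sub>M cemetery_borel"
    by measurable
  from measurable_compose[OF this measurable_transition_option[OF assms(1)]]
  have m: "(\<lambda>(s, \<omega>). case_option 0 (transition X P (ennreal s) f) (X (ennreal t) \<omega>)) \<in> borel_measurable (borel \<Otimes>\<^sub>M \<N>)"
    by (simp add: case_prod_beta' cong: option.case_cong)
  have [measurable]: "(\<lambda>(s, \<omega>). case_option 0 (transition X P (ennreal s) f) (X (ennreal t) \<omega>)) \<in> borel_measurable (lborel \<Otimes>\<^sub>M P (Some x))"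
    by (subst measurable_cong_sets[OF sets_pair_measure_cong[OF sets_lborel sets_P] refl]) (rule m)
  have m1: "(\<lambda>\<omega>. case_option 0 (transition X P (ennreal s) f) (X (ennreal t) \<omega>)) \<in> borel_measurable (P (Some x))" for s
    by measurable
  have "transition X P (ennreal t) (resolvent X P \<alpha> f) x =
     (\<integral>\<^sup>+\<omega>. (\<integral>\<^sup>+s. ennreal (exp (- \<alpha> * s)) * case_option 0 (transition X P (ennreal s) f) (X (ennreal t) \<omega>) * indicator {0..} s \<partial>lborel) \<partial>P (Some x))"
    unfolding transition_def[of X P "ennreal t"]
    by (intro nn_integral_cong) (auto simp: resolvent_eq_laplace[OF assms(1)] split: option.split)
  also have "\<dots> = (\<integral>\<^sup>+s. (\<integral>\<^sup>+\<omega>. ennreal (exp (- \<alpha> * s)) * case_option 0 (transition X P (ennreal s) f) (X (ennreal t) \<omega>) * indicator {0..} s \<partial>P (Some x)) \<partial>lborel)"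
    by (rule P.Fubini') measurable
  also have "\<dots> = (\<integral>\<^sup>+s. ennreal (exp (- \<alpha> * s)) * transition X P (ennreal t) (transition X P (ennreal s) f) x * indicator {0..} s \<partial>lborel)"
    unfolding transition_def[of X P "ennreal t"] using m1
    by (intro nn_integral_cong) (auto simp: nn_integral_cmult nn_integral_multc indicator_def)
  also have "\<dots> = (\<integral>\<^sup>+s\<in>{0..}. ennreal (exp (- \<alpha> * s)) * transition X P (ennreal (t + s)) f x \<partial>lborel)"
    using t by (intro nn_integral_cong) (auto simp: indicator_def transition_semigroup[symmetric] ennreal_plus[symmetric] simp del: ennreal_plus)
  finally show ?thesis .
qed

theorem resolvent_equation:
  assumes [measurable]: "f \<in> borel_measurable borel" and "a \<le> b"
  shows "resolvent X P a f x = resolvent X P b f x + ennreal (b - a) * resolvent X P b (resolvent X P a f) x"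
proof -
  have "resolvent X P b (resolvent X P a f) x = (\<integral>\<^sup>+t\<in>{0..}. ennreal (exp (- b * t)) *
      (\<integral>\<^sup>+s\<in>{0..}. ennreal (exp (- a * s)) * transition X P (ennreal (t + s)) f x \<partial>lborel) \<partial>lborel)"
    by (subst resolvent_eq_laplace) (auto intro!: nn_integral_cong simp: transition_resolvent indicator_def)
  then show ?thesis
    using nn_integral_exp_convolution[of "\<lambda>t. transition X P (ennreal t) f x" a b] \<open>a \<le> b\<close>
    by (simp add: resolvent_eq_laplace)
qed

text \<open>Symmetry passes from the semigroup to its Laplace transform by Tonelli, so \<open>m\<close> must be
  \<open>\<sigma>\<close>-finite.\<close>
lemma resolvent_symmetric:
  assumes "symmetric_process m X P" "sigma_finite_measure m" and sets: "sets m = sets borel"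
    and [measurable]: "f \<in> borel_measurable borel" "g \<in> borel_measurable borel"
  shows "(\<integral>\<^sup>+x. resolvent X P \<alpha> f x * g x \<partial>m) = (\<integral>\<^sup>+x. f x * resolvent X P \<alpha> g x \<partial>m)"
proof -
  interpret m: pair_sigma_finite lborel m
    unfolding pair_sigma_finite_def using sigma_finite_lborel assms by simp
  note [measurable_cong] = sets
  have tr: "(\<lambda>(t, x). transition X P (ennreal t) h x) \<in> borel_measurable (lborel \<Otimes>\<^sub>M m)"
    if "h \<in> borel_measurable borel" for h
    by (subst measurable_cong_sets[OF sets_pair_measure_cong[OF sets_lborel sets] refl])
      (rule measurable_transition_pair[OF that])
  note [measurable] = tr[OF assms(4)] tr[OF assms(5)]
  have "(\<integral>\<^sup>+x. resolvent X P \<alpha> f x * g x \<partial>m) =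
    (\<integral>\<^sup>+x. \<integral>\<^sup>+t. ennreal (exp (- \<alpha> * t)) * transition X P (ennreal t) f x * indicator {0..} t * g x \<partial>lborel \<partial>m)"
    by (intro nn_integral_cong) (simp add: resolvent_eq_laplace nn_integral_multc)
  also have "\<dots> = (\<integral>\<^sup>+t. \<integral>\<^sup>+x. ennreal (exp (- \<alpha> * t)) * transition X P (ennreal t) f x * indicator {0..} t * g x \<partial>m \<partial>lborel)"
    by (rule m.Fubini') measurable
  also have "\<dots> = (\<integral>\<^sup>+t. \<integral>\<^sup>+x. ennreal (exp (- \<alpha> * t)) * f x * indicator {0..} t * transition X P (ennreal t) g x \<partial>m \<partial>lborel)"
  proof (rule nn_integral_cong)
    fix t :: real
    have "(\<integral>\<^sup>+x. transition X P (ennreal t) f x * g x \<partial>m) = (\<integral>\<^sup>+x. f x * transition X P (ennreal t) g x \<partial>m)"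
      using assms(1) unfolding symmetric_process_def by simp
    then have "(\<integral>\<^sup>+x. (ennreal (exp (- \<alpha> * t)) * indicator {0..} t) * (transition X P (ennreal t) f x * g x) \<partial>m) =
       (\<integral>\<^sup>+x. (ennreal (exp (- \<alpha> * t)) * indicator {0..} t) * (f x * transition X P (ennreal t) g x) \<partial>m)"
      by (simp add: nn_integral_cmult)
    then show "(\<integral>\<^sup>+x. ennreal (exp (- \<alpha> * t)) * transition X P (ennreal t) f x * indicator {0..} t * g x \<partial>m) =
      (\<integral>\<^sup>+x. ennreal (exp (- \<alpha> * t)) * f x * indicator {0..} t * transition X P (ennreal t) g x \<partial>m)"
      by (simp add: mult_ac)
  qed
  also have "\<dots> = (\<integral>\<^sup>+x. \<integral>\<^sup>+t. ennreal (exp (- \<alpha> * t)) * f x * indicator {0..} t * transition X P (ennreal t) g x \<partial>lborel \<partial>m)"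
    by (rule m.Fubini'[symmetric]) measurable
  also have "\<dots> = (\<integral>\<^sup>+x. f x * resolvent X P \<alpha> g x \<partial>m)"
  proof (intro nn_integral_cong)
    fix x
    have "(\<integral>\<^sup>+t. ennreal (exp (- \<alpha> * t)) * f x * indicator {0..} t * transition X P (ennreal t) g x \<partial>lborel) =
      (\<integral>\<^sup>+t. f x * (ennreal (exp (- \<alpha> * t)) * transition X P (ennreal t) g x * indicator {0..} t) \<partial>lborel)"
      by (intro nn_integral_cong) (simp add: mult_ac)
    then show "(\<integral>\<^sup>+t. ennreal (exp (- \<alpha> * t)) * f x * indicator {0..} t * transition X P (ennreal t) g x \<partial>lborel) = f x * resolvent X P \<alpha> g x"
      by (simp add: nn_integral_cmult resolvent_eq_laplace)
  qed
  finally show ?thesis .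
qed

lemma transition_mono: "(\<And>x. f x \<le> g x) \<Longrightarrow> transition X P t f x \<le> transition X P t g x"
  unfolding transition_def by (intro nn_integral_mono) (auto split: option.split)

lemma resolvent_mono: "(\<And>x. f x \<le> g x) \<Longrightarrow> resolvent X P \<alpha> f x \<le> resolvent X P \<alpha> g x"
  unfolding resolvent_def by (intro nn_integral_mono mult_right_mono mult_left_mono) (auto split: option.split)

lemma transition_const_le: "transition X P t (\<lambda>_. c) x \<le> c"
proof -
  have "transition X P t (\<lambda>_. c) x \<le> (\<integral>\<^sup>+\<omega>. c \<partial>P (Some x))"
    unfolding transition_def by (intro nn_integral_mono) (auto split: option.split)
  then show ?thesis using prob_space.emeasure_space_1[OF prob_space_P[of "Some x"]] by simp
qed

lemma resolvent_const_le:
  assumes "\<alpha> > 0" shows "resolvent X P \<alpha> (\<lambda>_. c) x \<le> c * ennreal (1 / \<alpha>)"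
proof -
  have "resolvent X P \<alpha> (\<lambda>_. c) x \<le> (\<integral>\<^sup>+t. c * (ennreal (exp (- \<alpha> * t)) * indicator {0..} t) \<partial>lborel)"
    by (subst resolvent_eq_laplace)
       (auto intro!: nn_integral_mono mult_right_mono mult_left_mono transition_const_le simp: mult.assoc[symmetric] mult.commute[of c])
  also have "\<dots> = c * ennreal (1 / \<alpha>)"
    by (subst nn_integral_cmult) (use nn_integral_exp_Ici[OF assms] in auto)
  finally show ?thesis .
qed

lemma transition_tendsto:
  fixes f :: "'a \<Rightarrow> real" and r :: "nat \<Rightarrow> real"
  assumes f: "continuous_on UNIV f" and C: "\<And>x. f x \<le> C" and r: "\<And>n. 0 < r n" "r \<longlonglongrightarrow> 0"
  shows "(\<lambda>n. transition X P (ennreal (r n)) (\<lambda>y. ennreal (f y)) x) \<longlonglongrightarrow> ennreal (f x)"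
proof -
  interpret P: prob_space "P (Some x)" by (rule prob_space_P)
  have [measurable]: "f \<in> borel_measurable borel"
    by (rule borel_measurable_continuous_onI[OF f])
  have ext: "case_option 0 (\<lambda>y. ennreal (f y)) z = ennreal (case_option 0 f z)" for z
    by (auto split: option.split)
  have meas: "(\<lambda>\<omega>. case_option 0 (\<lambda>y. ennreal (f y)) (X t \<omega>)) \<in> borel_measurable (P (Some x))" for t
    by (subst measurable_cong_sets[OF sets_P refl])
       (rule measurable_compose[OF measurable_X measurable_case_option_cemetery], measurable)
  have "(\<lambda>n. transition X P (ennreal (r n)) (\<lambda>y. ennreal (f y)) x) \<longlonglongrightarrow> (\<integral>\<^sup>+\<omega>. ennreal (f x) \<partial>P (Some x))"
    unfolding transition_def
  proof (rule nn_integral_dominated_convergence[where w="\<lambda>_. ennreal C"])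
    show "AE \<omega> in P (Some x). case_option 0 (\<lambda>y. ennreal (f y)) (X (ennreal (r n)) \<omega>) \<le> ennreal C" for n
      using C by (auto intro!: AE_I2 ennreal_leI split: option.split)
    show "AE \<omega> in P (Some x). (\<lambda>n. case_option 0 (\<lambda>y. ennreal (f y)) (X (ennreal (r n)) \<omega>)) \<longlonglongrightarrow> ennreal (f x)"
      using normal[of "Some x"]
    proof eventually_elim
      case (elim \<omega>)
      then show ?case
        using tendsto_ennrealI[OF right_continuous_real_time[OF f _ r, of \<omega>]] unfolding ext by simp
    qed
  qed (use meas P.emeasure_space_1 in auto)
  then show ?thesis using P.emeasure_space_1 by simp
qed

text \<open>After the substitution \<open>t = s / k\<close>, \<open>k \<cdot> R(1+k) f\<close> is the mean of \<open>transition (s / k) f\<close> against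
  \<open>exp (-(1 + 1/k) s) ds\<close>, and both factors converge.\<close>
theorem resolvent_tendsto:
  fixes f :: "'a \<Rightarrow> real"
  assumes f: "continuous_on UNIV f" and C: "\<And>x. f x \<le> C"
  shows "(\<lambda>n. ennreal (real (Suc n)) * resolvent X P (1 + real (Suc n)) (\<lambda>y. ennreal (f y)) x) \<longlonglongrightarrow> ennreal (f x)"
proof -
  have [measurable]: "f \<in> borel_measurable borel"
    by (rule borel_measurable_continuous_onI[OF f])
  define \<phi> where "\<phi> t = transition X P (ennreal t) (\<lambda>y. ennreal (f y)) x" for t
  have [measurable]: "\<phi> \<in> borel_measurable borel"
    unfolding \<phi>_def by (rule measurable_transition) measurable
  have \<phi>_le: "\<phi> t \<le> ennreal C" for t
    unfolding \<phi>_def using C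
    by (intro order_trans[OF transition_mono[of _ "\<lambda>_. ennreal C"] transition_const_le] ennreal_leI)
  define h where "h n s = ennreal (exp (- (1 + 1 / real (Suc n)) * s)) * \<phi> (s / real (Suc n)) * indicator {0..} s" for n s
  have scale: "ennreal (real (Suc n)) * resolvent X P (1 + real (Suc n)) (\<lambda>y. ennreal (f y)) x = (\<integral>\<^sup>+s. h n s \<partial>lborel)" for n
  proof -
    have "resolvent X P (1 + real (Suc n)) (\<lambda>y. ennreal (f y)) x =
       (\<integral>\<^sup>+t. ennreal (exp (- (1 + real (Suc n)) * t)) * \<phi> t * indicator {0..} t \<partial>lborel)"
      unfolding \<phi>_def by (rule resolvent_eq_laplace) measurable
    also have "\<dots> = ennreal (1 / real (Suc n)) * (\<integral>\<^sup>+s. h n s \<partial>lborel)"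
    proof -
      define N where "N = real (Suc n)"
      have "0 < N" unfolding N_def by simp
      have "ennreal (exp (- (1 + N) * (0 + 1 / N * s))) * \<phi> (0 + 1 / N * s) * indicator {0..} (0 + 1 / N * s) = h n s" for s
      proof -
        have "- (1 + N) * (0 + 1 / N * s) = - (1 + 1 / N) * s" "0 + 1 / N * s = s / N"
          using \<open>0 < N\<close> by (simp_all add: field_simps)
        moreover have "indicator {0..} (s / N) = (indicator {0..} s :: ennreal)"
          using \<open>0 < N\<close> by (simp add: indicator_def zero_le_divide_iff)
        ultimately show ?thesis
          unfolding h_def N_def[symmetric] by simp
      qed
      then show ?thesis
        unfolding N_def[symmetric] using \<open>0 < N\<close>
        by (subst nn_integral_real_affine[where t=0 and c="1 / N"]) simp_all
    qed
    finally show ?thesis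
      by (simp add: mult.assoc[symmetric] ennreal_mult[symmetric] del: of_nat_Suc)
  qed
  have "(\<lambda>n. \<integral>\<^sup>+s. h n s \<partial>lborel) \<longlonglongrightarrow> (\<integral>\<^sup>+s. ennreal (exp (- 1 * s)) * indicator {0..} s * ennreal (f x) \<partial>lborel)"
  proof (rule nn_integral_dominated_convergence[where w="\<lambda>s. ennreal (exp (- 1 * s)) * indicator {0..} s * ennreal C"])
    show "h n \<in> borel_measurable lborel" for n
      unfolding h_def by measurable
    show "AE s in lborel. h n s \<le> ennreal (exp (- 1 * s)) * indicator {0..} s * ennreal C" for n
    proof (rule AE_I2)
      fix s :: real
      have "exp (- (1 + 1 / real (Suc n)) * s) \<le> exp (- 1 * s)" if "0 \<le> s"
        using that by (simp add: field_simps)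
      then show "h n s \<le> ennreal (exp (- 1 * s)) * indicator {0..} s * ennreal C"
        unfolding h_def by (auto simp: indicator_def intro!: mult_mono \<phi>_le ennreal_leI)
    qed
    show "(\<integral>\<^sup>+s. ennreal (exp (- 1 * s)) * indicator {0..} s * ennreal C \<partial>lborel) < \<infinity>"
      using nn_integral_exp_Ici[of 1] by (subst nn_integral_multc) (auto simp: ennreal_mult_less_top)
    show "AE s in lborel. (\<lambda>n. h n s) \<longlonglongrightarrow> ennreal (exp (- 1 * s)) * indicator {0..} s * ennreal (f x)"
      using AE_lborel_singleton[of 0]
    proof eventually_elim
      case (elim s)
      show ?case
      proof (cases "0 < s")
        case True
        have lim: "(\<lambda>n. s / real (Suc n)) \<longlonglongrightarrow> 0"
          using tendsto_mult[OF tendsto_const[of s] lim_1_over_n[THEN LIMSEQ_Suc]] by simp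
        then have "(\<lambda>n. \<phi> (s / real (Suc n))) \<longlonglongrightarrow> ennreal (f x)"
          unfolding \<phi>_def using True by (intro transition_tendsto[OF f C]) auto
        moreover have "(\<lambda>n. exp (- (1 + 1 / real (Suc n)) * s)) \<longlonglongrightarrow> exp (- (1 + 0) * s)"
          by (intro tendsto_intros lim_1_over_n[THEN LIMSEQ_Suc])
        then have "(\<lambda>n. ennreal (exp (- (1 + 1 / real (Suc n)) * s))) \<longlonglongrightarrow> ennreal (exp (- 1 * s))"
          by (intro tendsto_ennrealI) simp
        ultimately show ?thesis
          using True unfolding h_def by (auto intro!: tendsto_mult_ennreal)
      next
        case False
        then show ?thesis using elim by (simp add: h_def indicator_def)
      qed
    qed
  qed measurable
  also have "(\<integral>\<^sup>+s. ennreal (exp (- 1 * s)) * indicator {0..} s * ennreal (f x) \<partial>lborel) = ennreal (f x)"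
    using nn_integral_exp_Ici[of 1] by (subst nn_integral_multc) auto
  finally show ?thesis unfolding scale .
qed

end

section \<open>Measure-theoretic preliminaries\<close>

lemma sigma_finite_radon:
  fixes m :: "'a::{metric_space, second_countable_topology} measure"
  assumes lc: "locally compact (UNIV :: 'a set)" and "radon m"
  shows "sigma_finite_measure m"
proof
  have sets: "sets m = sets borel" and fin: "compact K \<Longrightarrow> emeasure m K < \<infinity>" for K
    using \<open>radon m\<close> by (auto simp: radon_def)
  define B where "B = {U :: 'a set. open U \<and> emeasure m U \<noteq> \<infinity>}"
  have "\<exists>U\<in>B. x \<in> U" for x
  proof -
    have "\<exists>U V. openin (top_of_set UNIV) U \<and> compact V \<and> x \<in> U \<and> U \<subseteq> V \<and> V \<subseteq> UNIV"
      using lc unfolding locally_def by (metis UNIV_I openin_subtopology_self)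
    then obtain U V where UV: "open U" "compact V" "x \<in> U" "U \<subseteq> V"
      by auto
    then have "emeasure m U \<le> emeasure m V"
      using compact_imp_closed[of V] by (intro emeasure_mono) (auto simp: sets)
    then show ?thesis using UV fin[of V] by (auto simp: B_def)
  qed
  then have "\<Union>B = UNIV" by blast
  moreover obtain B' where "B' \<subseteq> B" "countable B'" "\<Union>B' = \<Union>B"
    using Lindelof[of B] by (auto simp: B_def)
  ultimately show "\<exists>A. countable A \<and> A \<subseteq> sets m \<and> \<Union>A = space m \<and> (\<forall>a\<in>A. emeasure m a \<noteq> \<infinity>)"
    using sets_eq_imp_space_eq[OF sets] by (intro exI[of _ B']) (auto simp: B_def sets)
qed

text \<open>The almost everywhere limit of a sequence that is Cauchy in the mean is its limit in the mean, by
  Fatou's lemma.\<close>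
lemma integral_tendsto_of_L1_Cauchy:
  fixes u :: "nat \<Rightarrow> 'a \<Rightarrow> real"
  assumes u [measurable]: "\<And>n. integrable M (u n)" and h [measurable]: "h \<in> borel_measurable M"
    and lim: "AE x in M. (\<lambda>n. u n x) \<longlonglongrightarrow> h x"
    and cauchy: "\<And>n k. k \<le> n \<Longrightarrow> (\<integral>x. \<bar>u n x - u k x\<bar> \<partial>M) \<le> c k" and c: "c \<longlonglongrightarrow> 0"
  shows "integrable M h \<and> (\<lambda>n. \<integral>x. u n x \<partial>M) \<longlonglongrightarrow> (\<integral>x. h x \<partial>M)"
proof -
  have bound: "(\<integral>\<^sup>+x. ennreal \<bar>u k x - h x\<bar> \<partial>M) \<le> ennreal (c k)" for k
  proof -
    have "(\<integral>\<^sup>+x. ennreal \<bar>u k x - h x\<bar> \<partial>M) = (\<integral>\<^sup>+x. liminf (\<lambda>n. ennreal \<bar>u (n + k) x - u k x\<bar>) \<partial>M)"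
    proof (rule nn_integral_cong_AE)
      show "AE x in M. ennreal \<bar>u k x - h x\<bar> = liminf (\<lambda>n. ennreal \<bar>u (n + k) x - u k x\<bar>)"
        using lim
      proof eventually_elim
        case (elim x)
        have "(\<lambda>n. ennreal \<bar>u (n + k) x - u k x\<bar>) \<longlonglongrightarrow> ennreal \<bar>h x - u k x\<bar>"
          using LIMSEQ_ignore_initial_segment[OF elim, of k] by (intro tendsto_intros tendsto_ennrealI)
        from lim_imp_Liminf[OF _ this] show ?case by (simp add: abs_minus_commute)
      qed
    qed
    also have "\<dots> \<le> liminf (\<lambda>n. \<integral>\<^sup>+x. ennreal \<bar>u (n + k) x - u k x\<bar> \<partial>M)"
      by (rule nn_integral_liminf) measurable
    also have "\<dots> \<le> liminf (\<lambda>n :: nat. ennreal (c k))"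
    proof (rule Liminf_mono, rule always_eventually, rule allI)
      fix n
      have "(\<integral>\<^sup>+x. ennreal \<bar>u (n + k) x - u k x\<bar> \<partial>M) = ennreal (\<integral>x. \<bar>u (n + k) x - u k x\<bar> \<partial>M)"
        by (intro nn_integral_eq_integral) (auto intro!: u)
      then show "(\<integral>\<^sup>+x. ennreal \<bar>u (n + k) x - u k x\<bar> \<partial>M) \<le> ennreal (c k)"
        using cauchy[of k "n + k"] by (simp add: ennreal_leI)
    qed
    finally show ?thesis by (simp add: Liminf_const)
  qed
  have "integrable M (\<lambda>x. u 0 x - h x)"
    using bound[of 0] by (intro integrableI_bounded) (auto simp: order.strict_trans1[OF _ ennreal_less_top])
  then have h_int: "integrable M h"
    using Bochner_Integration.integrable_diff[OF u[of 0], of "\<lambda>x. u 0 x - h x"] by simp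
  moreover have "(\<lambda>n. \<integral>\<^sup>+x. ennreal (norm (u n x - h x)) \<partial>M) \<longlonglongrightarrow> 0"
  proof (rule tendsto_sandwich[OF _ _ tendsto_const])
    show "(\<lambda>n. ennreal (c n)) \<longlonglongrightarrow> 0"
      using tendsto_ennrealI[OF c] by simp
  qed (use bound in auto)
  ultimately show ?thesis
    by (intro conjI tendsto_L1_int[OF u h_int])
qed

section \<open>Energy\<close>

lemma Cc_diff:
  assumes "f \<in> Cc" "g \<in> Cc" shows "(\<lambda>x. f x - g x) \<in> (Cc :: ('a::t2_space \<Rightarrow> real) set)"
proof -
  let ?K = "closure {x. f x \<noteq> 0} \<union> closure {x. g x \<noteq> 0}"
  have K: "compact ?K" using assms by (auto simp: Cc_def)
  have "{x. f x - g x \<noteq> 0} \<subseteq> {x. f x \<noteq> 0} \<union> {x. g x \<noteq> 0}"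
    by auto
  also have "\<dots> \<subseteq> ?K"
    by (intro Un_mono closure_subset)
  finally have "closure {x. f x - g x \<noteq> 0} \<subseteq> ?K"
    using K by (intro closure_minimal compact_imp_closed)
  then have "compact (closure {x. f x - g x \<noteq> 0})"
    using compact_Int_closed[OF K closed_closure, of "{x. f x - g x \<noteq> 0}"] by (simp add: Int_absorb1)
  then show ?thesis using assms by (auto simp: Cc_def intro!: continuous_intros)
qed

lemma Cc_abs: "f \<in> Cc \<Longrightarrow> (\<lambda>x. \<bar>f x\<bar>) \<in> Cc"
  by (auto simp: Cc_def intro!: continuous_intros)

lemma Cc_bounded:
  assumes "f \<in> (Cc :: ('a::t2_space \<Rightarrow> real) set)" obtains C where "C > 0" "\<And>x. \<bar>f x\<bar> \<le> C"
proof -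
  have "compact (f ` closure {x. f x \<noteq> 0})"
    using assms by (auto simp: Cc_def intro!: compact_continuous_image intro: continuous_on_subset)
  then obtain C where C: "\<And>x. x \<in> closure {x. f x \<noteq> 0} \<Longrightarrow> \<bar>f x\<bar> \<le> C"
    using compact_imp_bounded[of "f ` closure {x. f x \<noteq> 0}"] unfolding bounded_iff by auto
  have "\<bar>f x\<bar> \<le> max C 1" for x
  proof (cases "f x = 0")
    case False
    then have "x \<in> closure {x. f x \<noteq> 0}" using closure_subset[of "{x. f x \<noteq> 0}"] by blast
    then show ?thesis using C[of x] by simp
  qed simp
  then show ?thesis by (intro that[of "max C 1"]) auto
qed

context dirichlet_form
begin

abbreviation "E1 \<equiv> form_shift m \<E> 1"

definition energy_norm where "energy_norm f = sqrt (E1 f f)"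

lemma sets_m [measurable_cong, simp]: "sets m = sets borel"
  using radon by (simp add: radon_def)

lemma space_m [simp]: "space m = UNIV"
  using sets_eq_imp_space_eq[OF sets_m] by simp

lemma sigma_finite_m: "sigma_finite_measure m"
  using locally_compact radon by (rule sigma_finite_radon)

lemma dom_measurable [measurable_dest]: "f \<in> \<F> \<Longrightarrow> f \<in> borel_measurable borel"
  and dom_square_integrable: "f \<in> \<F> \<Longrightarrow> integrable m (\<lambda>x. (f x)\<^sup>2)"
  using dom_L2 by (auto simp: L2_def)

lemma L2_integrable_mult:
  assumes "f \<in> L2 m" "g \<in> L2 m" shows "integrable m (\<lambda>x. f x * g x)"
proof (rule Bochner_Integration.integrable_bound)
  show "integrable m (\<lambda>x. (f x)\<^sup>2 + (g x)\<^sup>2)"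
    using assms by (auto simp: L2_def)
  have "\<bar>a * b\<bar> \<le> a\<^sup>2 + b\<^sup>2" for a b :: real
  proof -
    have "0 \<le> \<bar>a\<bar> * \<bar>b\<bar>" by simp
    moreover have "2 * \<bar>a\<bar> * \<bar>b\<bar> \<le> a\<^sup>2 + b\<^sup>2"
      using sum_squares_bound[of "\<bar>a\<bar>" "\<bar>b\<bar>"] by simp
    ultimately show ?thesis unfolding abs_mult by linarith
  qed
  then show "AE x in m. norm (f x * g x) \<le> norm ((f x)\<^sup>2 + (g x)\<^sup>2)"
    by simp
qed (use assms in \<open>auto simp: L2_def\<close>)

lemma dom_mult_integrable: "f \<in> \<F> \<Longrightarrow> g \<in> \<F> \<Longrightarrow> integrable m (\<lambda>x. f x * g x)"
  using L2_integrable_mult dom_L2 by blast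

lemma dom_diff: "f \<in> \<F> \<Longrightarrow> g \<in> \<F> \<Longrightarrow> (\<lambda>x. f x - g x) \<in> \<F>"
  using dom_add[of f "\<lambda>x. -1 * g x"] dom_scale[of g "-1"] by simp

lemma dom_sum: "(\<And>i. i \<in> I \<Longrightarrow> f i \<in> \<F>) \<Longrightarrow> (\<lambda>x. \<Sum>i\<in>I. f i x) \<in> \<F>"
proof (induction I rule: infinite_finite_induct)
  case (insert i I)
  then show ?case using dom_add[of "f i" "\<lambda>x. \<Sum>i\<in>I. f i x"] by simp
qed (auto simp: dom_zero)

lemma E1_sym: "f \<in> \<F> \<Longrightarrow> g \<in> \<F> \<Longrightarrow> E1 f g = E1 g f"
  by (simp add: form_shift_def form_sym mult.commute)

lemma E1_add: "f \<in> \<F> \<Longrightarrow> g \<in> \<F> \<Longrightarrow> h \<in> \<F> \<Longrightarrow> E1 (\<lambda>x. f x + g x) h = E1 f h + E1 g h"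
  by (simp add: form_shift_def form_add dom_mult_integrable distrib_right)

lemma E1_scale: "f \<in> \<F> \<Longrightarrow> h \<in> \<F> \<Longrightarrow> E1 (\<lambda>x. c * f x) h = c * E1 f h"
  by (simp add: form_shift_def form_scale mult.assoc distrib_left)

lemma E1_diff: "f \<in> \<F> \<Longrightarrow> g \<in> \<F> \<Longrightarrow> h \<in> \<F> \<Longrightarrow> E1 (\<lambda>x. f x - g x) h = E1 f h - E1 g h"
  using E1_add[of f "\<lambda>x. -1 * g x" h] E1_scale[of g h "-1"] dom_scale[of g "-1"] by simp

lemma E1_nonneg: "f \<in> \<F> \<Longrightarrow> 0 \<le> E1 f f"
  by (simp add: form_shift_def form_nonneg)

lemma L2_le_E1: "f \<in> \<F> \<Longrightarrow> (\<integral>x. (f x)\<^sup>2 \<partial>m) \<le> E1 f f"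
  by (simp add: form_shift_def form_nonneg power2_eq_square)

lemma energy_norm_nonneg [simp]: "f \<in> \<F> \<Longrightarrow> 0 \<le> energy_norm f"
  by (simp add: energy_norm_def E1_nonneg)

lemma energy_norm_power2: "f \<in> \<F> \<Longrightarrow> (energy_norm f)\<^sup>2 = E1 f f"
  by (simp add: energy_norm_def E1_nonneg)

lemma E1_diff_self:
  assumes "f \<in> \<F>" "g \<in> \<F>"
  shows "E1 (\<lambda>x. f x - g x) (\<lambda>x. f x - g x) = E1 f f - 2 * E1 f g + E1 g g"
  using assms E1_diff[of f g "\<lambda>x. f x - g x"] E1_sym[of f "\<lambda>x. f x - g x"] E1_sym[of g "\<lambda>x. f x - g x"]
    E1_diff[of f g f] E1_diff[of f g g] E1_sym[of g f] dom_diff[of f g] by simp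

lemma E1_Cauchy_Schwarz:
  assumes [simp]: "f \<in> \<F>" "g \<in> \<F>"
  shows "\<bar>E1 f g\<bar> \<le> energy_norm f * energy_norm g"
proof -
  have quad: "0 \<le> E1 f f - 2 * t * E1 f g + t\<^sup>2 * E1 g g" for t
    using E1_nonneg[OF dom_diff[OF assms(1) dom_scale[OF assms(2), of t]]]
      E1_diff_self[OF assms(1) dom_scale[OF assms(2), of t]]
      E1_sym[OF assms(1) dom_scale[OF assms(2), of t]] E1_sym[OF assms(2) dom_scale[OF assms(2), of t]]
      E1_scale[OF assms(2), of _ t] dom_scale[of g t] E1_sym[of f g]
    by (simp add: power2_eq_square mult_ac)
  have "(E1 f g)\<^sup>2 \<le> E1 f f * E1 g g"
  proof (cases "E1 g g = 0")
    case True
    have "E1 f g = 0"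
    proof (rule ccontr)
      assume "E1 f g \<noteq> 0"
      then show False using quad[of "(E1 f f + 1) / (2 * E1 f g)"] True by simp
    qed
    then show ?thesis using True by simp
  next
    case False
    then have pos: "0 < E1 g g" using E1_nonneg[of g] by simp
    have "0 \<le> E1 g g * (E1 f f - 2 * (E1 f g / E1 g g) * E1 f g + (E1 f g / E1 g g)\<^sup>2 * E1 g g)"
      using quad[of "E1 f g / E1 g g"] pos by (intro mult_nonneg_nonneg) auto
    also have "\<dots> = E1 f f * E1 g g - (E1 f g)\<^sup>2"
      using pos by (simp add: field_simps power2_eq_square)
    finally show ?thesis by simp
  qed
  then have "sqrt ((E1 f g)\<^sup>2) \<le> sqrt (E1 f f * E1 g g)" by (rule real_sqrt_le_mono)
  then show ?thesis by (simp add: energy_norm_def real_sqrt_mult)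
qed

lemma energy_norm_scale: "f \<in> \<F> \<Longrightarrow> energy_norm (\<lambda>x. c * f x) = \<bar>c\<bar> * energy_norm f"
  using E1_scale[of f "\<lambda>x. c * f x" c] E1_sym[of f "\<lambda>x. c * f x"] E1_scale[of f f c] dom_scale[of f c]
  by (simp add: energy_norm_def real_sqrt_mult mult.assoc[symmetric])

lemma energy_norm_triangle:
  assumes [simp]: "f \<in> \<F>" "g \<in> \<F>"
  shows "energy_norm (\<lambda>x. f x + g x) \<le> energy_norm f + energy_norm g"
proof (rule power2_le_imp_le)
  have "(energy_norm (\<lambda>x. f x + g x))\<^sup>2 = E1 f f + 2 * E1 f g + E1 g g"
    using E1_add[of f g "\<lambda>x. f x + g x"] E1_sym[of f "\<lambda>x. f x + g x"] E1_sym[of g "\<lambda>x. f x + g x"]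
      E1_add[of f g f] E1_add[of f g g] E1_sym[of g f] dom_add[of f g]
    by (simp add: energy_norm_power2)
  also have "\<dots> \<le> (energy_norm f + energy_norm g)\<^sup>2"
    using E1_Cauchy_Schwarz[of f g] by (simp add: power2_sum energy_norm_power2)
  finally show "(energy_norm (\<lambda>x. f x + g x))\<^sup>2 \<le> (energy_norm f + energy_norm g)\<^sup>2" .
qed simp

lemma energy_norm_diff_le:
  assumes "f \<in> \<F>" "g \<in> \<F>"
  shows "energy_norm (\<lambda>x. f x - g x) \<le> energy_norm f + energy_norm g"
  using energy_norm_triangle[OF assms(1) dom_scale[OF assms(2), of "-1"]] energy_norm_scale[OF assms(2), of "-1"]
  by simp

lemma energy_norm_commute:
  assumes "f \<in> \<F>" "g \<in> \<F>"
  shows "energy_norm (\<lambda>x. f x - g x) = energy_norm (\<lambda>x. g x - f x)"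
  using energy_norm_scale[OF dom_diff[OF assms], of "-1"] by simp

lemma energy_norm_diff_triangle:
  assumes "f \<in> \<F>" "g \<in> \<F>" "h \<in> \<F>"
  shows "energy_norm (\<lambda>x. f x - g x) \<le> energy_norm (\<lambda>x. f x - h x) + energy_norm (\<lambda>x. g x - h x)"
  using energy_norm_diff_le[OF dom_diff[OF assms(1,3)] dom_diff[OF assms(2,3)]] by simp

lemma energy_norm_sum:
  assumes "\<And>i. i \<in> I \<Longrightarrow> f i \<in> \<F>"
  shows "energy_norm (\<lambda>x. \<Sum>i\<in>I. f i x) \<le> (\<Sum>i\<in>I. energy_norm (f i))"
  using assms
proof (induction I rule: infinite_finite_induct)
  case (insert i I)
  then show ?case
    using energy_norm_triangle[of "f i" "\<lambda>x. \<Sum>i\<in>I. f i x"] dom_sum[of I f] by simp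
qed (use energy_norm_scale[OF dom_zero, of 0] in auto)

lemma E1_tendsto:
  assumes [simp]: "\<And>n. u n \<in> \<F>" "v \<in> \<F>" "f \<in> \<F>"
    and lim: "(\<lambda>n. energy_norm (\<lambda>x. u n x - v x)) \<longlonglongrightarrow> 0"
  shows "(\<lambda>n. E1 f (u n)) \<longlonglongrightarrow> E1 f v"
proof -
  have "(\<lambda>n. E1 f (u n) - E1 f v) \<longlonglongrightarrow> 0"
  proof (rule Lim_null_comparison)
    show "\<forall>\<^sub>F n in sequentially. norm (E1 f (u n) - E1 f v) \<le> energy_norm (\<lambda>x. u n x - v x) * energy_norm f"
      using E1_Cauchy_Schwarz[OF dom_diff[OF assms(1,2)] assms(3)] E1_diff[OF assms(1,2,3)]
        E1_sym[OF assms(1,3)] E1_sym[OF assms(2,3)]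
      by (intro always_eventually allI) simp
    show "(\<lambda>n. energy_norm (\<lambda>x. u n x - v x) * energy_norm f) \<longlonglongrightarrow> 0"
      by (rule tendsto_mult_left_zero[OF lim])
  qed
  then show ?thesis by (rule LIM_zero_cancel)
qed

lemma energy_complete:
  assumes [simp]: "\<And>n. u n \<in> \<F>"
    and cauchy: "\<And>n k. k \<le> n \<Longrightarrow> energy_norm (\<lambda>x. u n x - u k x) \<le> c k" and c: "c \<longlonglongrightarrow> 0"
  obtains v where "v \<in> \<F>" "(\<lambda>n. energy_norm (\<lambda>x. u n x - v x)) \<longlonglongrightarrow> 0"
proof -
  have "\<exists>v\<in>\<F>. (\<lambda>n. E1 (\<lambda>x. u n x - v x) (\<lambda>x. u n x - v x)) \<longlonglongrightarrow> 0"
  proof (rule form_closed)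
    fix \<epsilon> :: real assume "\<epsilon> > 0"
    then have "\<forall>\<^sub>F n in sequentially. c n < sqrt \<epsilon>"
      using c by (auto intro: order_tendstoD)
    then obtain M where M: "\<And>n. n \<ge> M \<Longrightarrow> c n < sqrt \<epsilon>"
      by (auto simp: eventually_sequentially)
    have "energy_norm (\<lambda>x. u i x - u j x) < sqrt \<epsilon>" if "i \<ge> M" "j \<ge> M" for i j
      using cauchy[of i j] cauchy[of j i] M[of i] M[of j] that energy_norm_commute[of "u i" "u j"]
      by (cases "i \<le> j") (force, force)
    then show "\<exists>N. \<forall>i\<ge>N. \<forall>j\<ge>N. E1 (\<lambda>x. u i x - u j x) (\<lambda>x. u i x - u j x) < \<epsilon>"
      by (auto simp: energy_norm_def)
  qed simp
  then obtain v where "v \<in> \<F>" and "(\<lambda>n. E1 (\<lambda>x. u n x - v x) (\<lambda>x. u n x - v x)) \<longlonglongrightarrow> 0"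
    by blast
  then show ?thesis
    using tendsto_real_sqrt[of _ 0] by (intro that) (auto simp: energy_norm_def)
qed

lemma nn_integral_square_le: "f \<in> \<F> \<Longrightarrow> (\<integral>\<^sup>+x. ennreal ((f x)\<^sup>2) \<partial>m) \<le> ennreal ((energy_norm f)\<^sup>2)"
  using L2_le_E1[of f] dom_square_integrable[of f]
  by (simp add: nn_integral_eq_integral energy_norm_power2 ennreal_leI)

text \<open>The energy norm dominates the \<open>L\<^sup>2\<close> norm, and in \<open>L\<^sup>2\<close> the distance of \<open>w\<close> to \<open>v\<close> is at least
  that of \<open>max 0 (h - v)\<close> to \<open>0\<close> as soon as \<open>h \<le> w\<close>.\<close>
lemma AE_le_energy_limit:
  assumes [measurable]: "h \<in> borel_measurable borel" and [measurable, simp]: "\<And>n. w n \<in> \<F>" "v \<in> \<F>"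
    and le: "\<And>n. n \<ge> k \<Longrightarrow> AE x in m. h x \<le> w n x"
    and lim: "(\<lambda>n. energy_norm (\<lambda>x. w n x - v x)) \<longlonglongrightarrow> 0"
  shows "AE x in m. h x \<le> v x"
proof -
  let ?g = "\<lambda>x. ennreal ((max 0 (h x - v x))\<^sup>2)"
  have "(\<integral>\<^sup>+x. ?g x \<partial>m) \<le> ennreal ((energy_norm (\<lambda>x. w n x - v x))\<^sup>2)" if "n \<ge> k" for n
  proof -
    have "(\<integral>\<^sup>+x. ?g x \<partial>m) \<le> (\<integral>\<^sup>+x. ennreal ((w n x - v x)\<^sup>2) \<partial>m)"
    proof (rule nn_integral_mono_AE)
      show "AE x in m. ?g x \<le> ennreal ((w n x - v x)\<^sup>2)"
        using le[OF that] by eventually_elim (auto intro!: ennreal_leI power_mono simp: max_def)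
    qed
    also have "\<dots> \<le> ennreal ((energy_norm (\<lambda>x. w n x - v x))\<^sup>2)"
      using nn_integral_square_le[OF dom_diff[of "w n" v]] by simp
    finally show ?thesis .
  qed
  moreover have "(\<lambda>n. ennreal ((energy_norm (\<lambda>x. w n x - v x))\<^sup>2)) \<longlonglongrightarrow> ennreal (0\<^sup>2)"
    by (intro tendsto_ennrealI tendsto_power lim)
  ultimately have "(\<integral>\<^sup>+x. ?g x \<partial>m) \<le> ennreal (0\<^sup>2)"
    by (intro Lim_bounded2[where N=k]) auto
  then have "(\<integral>\<^sup>+x. ?g x \<partial>m) = 0" by simp
  then have "AE x in m. ?g x = 0"
    by (subst (asm) nn_integral_0_iff_AE) auto
  then show ?thesis by eventually_elim (auto simp: max_def split: if_splits)
qed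

text \<open>The squared \<open>L\<^sup>2\<close> distances are summable, so the series of the squared differences is finite almost
  everywhere.\<close>
lemma AE_fast_energy_limit:
  assumes [measurable, simp]: "\<And>n. w n \<in> \<F>" "v \<in> \<F>"
    and fast: "\<And>n. energy_norm (\<lambda>x. w n x - v x) \<le> (1/8) ^ n"
  shows "AE x in m. (\<lambda>n. w n x) \<longlonglongrightarrow> v x"
proof -
  have d: "(\<lambda>x. w n x - v x) \<in> \<F>" for n by (simp add: dom_diff)
  have "(\<integral>\<^sup>+x. (\<Sum>n. ennreal ((w n x - v x)\<^sup>2)) \<partial>m) = (\<Sum>n. \<integral>\<^sup>+x. ennreal ((w n x - v x)\<^sup>2) \<partial>m)"
    by (rule nn_integral_suminf) measurable
  also have "\<dots> \<le> (\<Sum>n. ennreal ((1/64) ^ n))"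
  proof (intro suminf_le)
    fix n
    have "(energy_norm (\<lambda>x. w n x - v x))\<^sup>2 \<le> ((1/8) ^ n)\<^sup>2"
      using fast d by (intro power_mono) auto
    also have "((1/8::real) ^ n)\<^sup>2 = (1/64) ^ n"
      by (simp add: power2_eq_square power_mult_distrib[symmetric])
    finally show "(\<integral>\<^sup>+x. ennreal ((w n x - v x)\<^sup>2) \<partial>m) \<le> ennreal ((1/64) ^ n)"
      using nn_integral_square_le[OF d, of n] by (meson ennreal_leI order_trans)
  qed auto
  also have "\<dots> < \<infinity>"
    by (subst suminf_ennreal2) (auto intro!: summable_geometric)
  finally have "AE x in m. (\<Sum>n. ennreal ((w n x - v x)\<^sup>2)) \<noteq> \<infinity>"
    by (intro nn_integral_PInf_AE) auto
  then show ?thesis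
  proof eventually_elim
    case (elim x)
    then have "summable (\<lambda>n. (w n x - v x)\<^sup>2)"
      by (intro summable_suminf_not_top) auto
    then have "(\<lambda>n. sqrt ((w n x - v x)\<^sup>2)) \<longlonglongrightarrow> sqrt 0"
      by (intro tendsto_real_sqrt summable_LIMSEQ_zero)
    then have "(\<lambda>n. w n x - v x) \<longlonglongrightarrow> 0" by (simp add: tendsto_rabs_zero_iff)
    then show ?case by (rule LIM_zero_cancel)
  qed
qed

definition clamp01 :: "('a \<Rightarrow> real) \<Rightarrow> 'a \<Rightarrow> real" where "clamp01 f = (\<lambda>x. min (max (f x) 0) 1)"

lemma clamp01_dom [simp]: "f \<in> \<F> \<Longrightarrow> clamp01 f \<in> \<F>"
  unfolding clamp01_def by (rule dom_unit_contraction)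

lemma energy_norm_clamp01:
  assumes [measurable]: "f \<in> \<F>" shows "energy_norm (clamp01 f) \<le> energy_norm f"
proof -
  have "(\<integral>x. clamp01 f x * clamp01 f x \<partial>m) \<le> (\<integral>x. f x * f x \<partial>m)"
  proof (rule integral_mono[OF dom_mult_integrable dom_mult_integrable])
    fix x
    have "(clamp01 f x)\<^sup>2 \<le> (f x)\<^sup>2"
      unfolding clamp01_def abs_le_square_iff[symmetric] by (auto simp: min_def max_def)
    then show "clamp01 f x * clamp01 f x \<le> f x * f x" by (simp add: power2_eq_square)
  qed (use assms in auto)
  then show ?thesis
    using form_unit_contraction[OF assms] unfolding energy_norm_def form_shift_def clamp01_def by simp
qed

text \<open>The positive and negative parts of a function bounded by \<open>C\<close> are \<open>C\<close> times the unit contractions of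
  \<open>f / C\<close> and \<open>- f / C\<close>. The factor \<open>2\<close> comes from the triangle inequality.\<close>
lemma abs_dom:
  assumes "f \<in> \<F>" "C > 0" and C: "\<And>x. \<bar>f x\<bar> \<le> C"
  shows "(\<lambda>x. \<bar>f x\<bar>) \<in> \<F>" "energy_norm (\<lambda>x. \<bar>f x\<bar>) \<le> 2 * energy_norm f"
proof -
  define p where "p c = (\<lambda>x. C * clamp01 (\<lambda>x. c * f x) x)" for c
  have dom: "p c \<in> \<F>" for c
    unfolding p_def using assms by (intro dom_scale clamp01_dom)
  have le: "energy_norm (p c) \<le> energy_norm f" if "\<bar>c\<bar> = 1 / C" for c
  proof -
    have "energy_norm (p c) = C * energy_norm (clamp01 (\<lambda>x. c * f x))"
      unfolding p_def using assms by (simp add: energy_norm_scale dom_scale)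
    also have "\<dots> \<le> C * energy_norm (\<lambda>x. c * f x)"
      using assms by (simp add: energy_norm_clamp01 dom_scale)
    finally show ?thesis using that assms by (simp add: energy_norm_scale)
  qed
  have eq: "(\<lambda>x. p (1 / C) x + p (- (1 / C)) x) = (\<lambda>x. \<bar>f x\<bar>)"
  proof
    fix x
    have split: "min (max y 0) 1 + min (max (- y) 0) 1 = \<bar>y\<bar>" if "\<bar>y\<bar> \<le> 1" for y :: real
      using that by (auto simp: min_def max_def)
    have "\<bar>1 / C * f x\<bar> \<le> 1" using C[of x] \<open>C > 0\<close> by (simp add: abs_mult)
    from split[OF this] have "clamp01 (\<lambda>x. 1 / C * f x) x + clamp01 (\<lambda>x. - (1 / C) * f x) x = \<bar>f x\<bar> / C"
      unfolding clamp01_def using \<open>C > 0\<close> by (simp add: abs_mult)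
    then have "C * (clamp01 (\<lambda>x. 1 / C * f x) x + clamp01 (\<lambda>x. - (1 / C) * f x) x) = \<bar>f x\<bar>"
      using \<open>C > 0\<close> by simp
    then show "p (1 / C) x + p (- (1 / C)) x = \<bar>f x\<bar>"
      unfolding p_def by (simp only: distrib_left)
  qed
  show "(\<lambda>x. \<bar>f x\<bar>) \<in> \<F>"
    using dom_add[OF dom dom, of "1 / C" "- (1 / C)"] by (simp add: eq)
  show "energy_norm (\<lambda>x. \<bar>f x\<bar>) \<le> 2 * energy_norm f"
    using energy_norm_triangle[OF dom dom, of "1 / C" "- (1 / C)"] le[of "1 / C"] le[of "- (1 / C)"] assms
    by (simp add: eq)
qed

lemma abs_Cc_dom:
  assumes "f \<in> \<F> \<inter> Cc"
  shows "(\<lambda>x. \<bar>f x\<bar>) \<in> \<F> \<inter> Cc" "energy_norm (\<lambda>x. \<bar>f x\<bar>) \<le> 2 * energy_norm f"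
proof -
  obtain C where "C > 0" "\<And>x. \<bar>f x\<bar> \<le> C" using Cc_bounded[of f] assms by blast
  then show "(\<lambda>x. \<bar>f x\<bar>) \<in> \<F> \<inter> Cc" "energy_norm (\<lambda>x. \<bar>f x\<bar>) \<le> 2 * energy_norm f"
    using assms abs_dom[of f C] Cc_abs[of f] by auto
qed

section \<open>Capacity and quasi-everywhere convergence\<close>

lemma cap_le_of_potential:
  assumes "u \<in> \<F>" "AE x in m. x \<in> A \<longrightarrow> 1 \<le> u x" "open A" "B \<subseteq> A"
  shows "cap m \<F> \<E> B \<le> ennreal ((energy_norm u)\<^sup>2)"
proof -
  have "cap m \<F> \<E> B \<le> cap_open m \<F> \<E> A"
    unfolding cap_def using assms by (intro INF_lower) auto
  also have "\<dots> \<le> ennreal (E1 u u)"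
    unfolding cap_open_def using assms by (intro INF_lower) auto
  finally show ?thesis using assms by (simp add: energy_norm_power2)
qed

lemma potential_of_cap_less:
  assumes "cap m \<F> \<E> B < ennreal (e\<^sup>2)" "0 < e"
  obtains A u where "open A" "B \<subseteq> A" "u \<in> \<F>" "AE x in m. x \<in> A \<longrightarrow> 1 \<le> u x" "energy_norm u < e"
proof -
  obtain A where A: "open A" "B \<subseteq> A" "cap_open m \<F> \<E> A < ennreal (e\<^sup>2)"
    using assms unfolding cap_def INF_less_iff by auto
  then obtain u where u: "u \<in> \<F>" "AE x in m. x \<in> A \<longrightarrow> 1 \<le> u x" "ennreal (E1 u u) < ennreal (e\<^sup>2)"
    unfolding cap_open_def INF_less_iff by auto
  then have "(energy_norm u)\<^sup>2 < e\<^sup>2"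
    by (simp add: energy_norm_power2 ennreal_less_iff E1_nonneg)
  then show ?thesis using A u assms(2) power_less_imp_less_base[of "energy_norm u" 2 e] by (intro that) auto
qed

lemma cap_mono: "A \<subseteq> B \<Longrightarrow> cap m \<F> \<E> A \<le> cap m \<F> \<E> B"
  unfolding cap_def by (intro INF_superset_mono) auto

text \<open>Exceptional sets need not be Borel, whereas smoothness of a measure is a condition on Borel sets.
  The envelope is a countable intersection of open sets.\<close>
lemma cap_zero_borel:
  assumes "cap m \<F> \<E> B = 0"
  obtains D where "D \<in> sets borel" "B \<subseteq> D" "cap m \<F> \<E> D = 0"
proof -
  have "\<exists>A. open A \<and> B \<subseteq> A \<and> cap m \<F> \<E> A \<le> ennreal ((1 / real (Suc n))\<^sup>2)" for n
  proof -
    have "cap m \<F> \<E> B < ennreal ((1 / real (Suc n))\<^sup>2)"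
      using assms by (simp add: ennreal_zero_less_divide power_one_over[symmetric])
    then obtain A u where Au: "open A" "B \<subseteq> A" "u \<in> \<F>" "AE x in m. x \<in> A \<longrightarrow> 1 \<le> u x" "energy_norm u < 1 / real (Suc n)"
      by (rule potential_of_cap_less) auto
    then have "cap m \<F> \<E> A \<le> ennreal ((energy_norm u)\<^sup>2)"
      by (intro cap_le_of_potential) auto
    also have "\<dots> \<le> ennreal ((1 / real (Suc n))\<^sup>2)"
      using Au by (intro ennreal_leI power_mono) auto
    finally show ?thesis using Au by auto
  qed
  then obtain A where A: "\<And>n. open (A n)" "\<And>n. B \<subseteq> A n" "\<And>n. cap m \<F> \<E> (A n) \<le> ennreal ((1 / real (Suc n))\<^sup>2)"
    by metis
  have "cap m \<F> \<E> (\<Inter>n. A n) \<le> ennreal ((1 / real (Suc n))\<^sup>2)" for n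
    using cap_mono[of "\<Inter>n. A n" "A n"] A(3)[of n] by (meson INF_lower UNIV_I order_trans)
  moreover have "(\<lambda>n. ennreal ((1 / real (Suc n))\<^sup>2)) \<longlonglongrightarrow> ennreal (0\<^sup>2)"
    by (intro tendsto_ennrealI tendsto_power lim_1_over_n[THEN LIMSEQ_Suc])
  ultimately have "cap m \<F> \<E> (\<Inter>n. A n) \<le> ennreal (0\<^sup>2)"
    by (intro Lim_bounded2[where N=0]) auto
  then show ?thesis
    using A by (intro that[of "\<Inter>n. A n"]) auto
qed

lemma emeasure_le_cap:
  assumes "B \<in> sets borel" shows "emeasure m B \<le> cap m \<F> \<E> B"
  unfolding cap_def cap_open_def
proof (intro INF_greatest)
  fix A u assume "A \<in> {A. open A \<and> B \<subseteq> A}" and "u \<in> {u \<in> \<F>. AE x in m. x \<in> A \<longrightarrow> 1 \<le> u x}"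
  then have A: "open A" "B \<subseteq> A" and u: "u \<in> \<F>" and AE: "AE x in m. x \<in> A \<longrightarrow> 1 \<le> u x" by auto
  have "emeasure m B = (\<integral>\<^sup>+x. indicator B x \<partial>m)"
    using assms by simp
  also have "\<dots> \<le> (\<integral>\<^sup>+x. ennreal ((u x)\<^sup>2) \<partial>m)"
  proof (rule nn_integral_mono_AE)
    show "AE x in m. indicator B x \<le> ennreal ((u x)\<^sup>2)"
      using AE
    proof eventually_elim
      case (elim x)
      then show ?case using A ennreal_leI[of 1 "(u x)\<^sup>2"] one_le_power[of "u x" 2] by (auto simp: indicator_def)
    qed
  qed
  also have "\<dots> \<le> ennreal (E1 u u)"
    using nn_integral_square_le[OF u] by (simp add: energy_norm_power2 u)
  finally show "emeasure m B \<le> ennreal (E1 u u)" .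
qed

lemma AE_of_cap_zero:
  assumes "cap m \<F> \<E> B = 0" shows "AE x in m. x \<notin> B"
proof -
  obtain D where D: "D \<in> sets borel" "B \<subseteq> D" "cap m \<F> \<E> D = 0"
    using cap_zero_borel[OF assms] .
  then have "D \<in> null_sets m" using emeasure_le_cap[of D] by auto
  then have "AE x in m. x \<notin> D" by (rule AE_not_in)
  then show ?thesis using D(2) by (auto elim: eventually_mono)
qed

text \<open>Countable subadditivity of the square root of the capacity, for geometrically decreasing bounds.
  The sum of the truncated potentials converges in energy and dominates each of them.\<close>
lemma potential_Union:
  assumes [simp]: "\<And>n. u n \<in> \<F>" and ge: "\<And>n. AE x in m. x \<in> A n \<longrightarrow> 1 \<le> u n x"
    and le: "\<And>n. energy_norm (u n) \<le> e / 2 ^ n"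
  obtains v where "v \<in> \<F>" "AE x in m. x \<in> (\<Union>n. A n) \<longrightarrow> 1 \<le> v x" "energy_norm v \<le> 2 * e"
proof -
  have e: "0 \<le> e" using order_trans[OF energy_norm_nonneg[of "u 0"] le[of 0]] by simp
  define w where "w n = (\<lambda>x. \<Sum>i<n. clamp01 (u i) x)" for n :: nat
  have w [simp]: "w n \<in> \<F>" for n unfolding w_def by (intro dom_sum) simp
  have norm_c: "energy_norm (clamp01 (u i)) \<le> e * (1/2) ^ i" for i
    using order_trans[OF energy_norm_clamp01 le, of i] by (simp add: power_one_over)
  have cauchy: "energy_norm (\<lambda>x. w n x - w k x) \<le> 2 * e * (1/2) ^ k" if "k \<le> n" for n k
  proof -
    have "(\<lambda>x. w n x - w k x) = (\<lambda>x. \<Sum>i=k..<n. clamp01 (u i) x)"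
      unfolding w_def using that
      by (auto simp: fun_eq_iff lessThan_atLeast0 sum_diff_nat_ivl)
    then have "energy_norm (\<lambda>x. w n x - w k x) \<le> (\<Sum>i=k..<n. energy_norm (clamp01 (u i)))"
      using energy_norm_sum[of "{k..<n}" "\<lambda>i. clamp01 (u i)"] by simp
    also have "\<dots> \<le> (\<Sum>i=k..<n. e * (1/2) ^ i)"
      by (intro sum_mono norm_c)
    also have "\<dots> \<le> 2 * e * (1/2) ^ k"
    proof -
      have "(\<Sum>i=k..<n. (1/2::real) ^ i) = 2 * (1/2) ^ k - 2 * (1/2) ^ n"
        using that by (induction n rule: dec_induct) auto
      then show ?thesis using e by (simp add: sum_distrib_left[symmetric] right_diff_distrib)
    qed
    finally show ?thesis .
  qed
  obtain v where v [simp]: "v \<in> \<F>" and lim: "(\<lambda>n. energy_norm (\<lambda>x. w n x - v x)) \<longlonglongrightarrow> 0"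
  proof (rule energy_complete[OF w cauchy])
    have "(\<lambda>k. 2 * e * (1/2) ^ k) \<longlonglongrightarrow> 2 * e * 0"
      by (intro tendsto_intros LIMSEQ_power_zero) auto
    then show "(\<lambda>k. 2 * e * (1/2) ^ k) \<longlonglongrightarrow> 0" by simp
  qed
  have "energy_norm v \<le> 2 * e"
  proof (rule LIMSEQ_le_const)
    show "(\<lambda>n. 2 * e + energy_norm (\<lambda>x. w n x - v x)) \<longlonglongrightarrow> 2 * e"
      using tendsto_add[OF tendsto_const lim, of "2 * e"] by simp
    have "energy_norm (w n) \<le> 2 * e" for n
      using cauchy[of 0 n] by (simp add: w_def)
    then have "energy_norm v \<le> 2 * e + energy_norm (\<lambda>x. w n x - v x)" for n
      using energy_norm_diff_le[of "w n" "\<lambda>x. w n x - v x"] dom_diff[of "w n" v]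
      by (simp add: order_trans[OF _ add_right_mono])
    then show "\<exists>N. \<forall>n\<ge>N. energy_norm v \<le> 2 * e + energy_norm (\<lambda>x. w n x - v x)"
      by blast
  qed
  moreover have "AE x in m. clamp01 (u k) x \<le> v x" for k
  proof (rule AE_le_energy_limit[OF _ w v _ lim])
    show "AE x in m. clamp01 (u k) x \<le> w n x" if "n \<ge> Suc k" for n
    proof (rule AE_I2)
      fix x
      have "(\<Sum>i\<in>{k}. clamp01 (u i) x) \<le> (\<Sum>i<n. clamp01 (u i) x)"
        using that by (intro sum_mono2) (auto simp: clamp01_def)
      then show "clamp01 (u k) x \<le> w n x" by (simp add: w_def)
    qed
    show "clamp01 (u k) \<in> borel_measurable borel" by (intro dom_measurable) simp
  qed
  then have "AE x in m. \<forall>k. clamp01 (u k) x \<le> v x \<and> (x \<in> A k \<longrightarrow> 1 \<le> u k x)"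
    using ge by (auto simp: AE_all_countable)
  then have "AE x in m. x \<in> (\<Union>n. A n) \<longrightarrow> 1 \<le> v x"
    by eventually_elim (fastforce simp: clamp01_def)
  ultimately show ?thesis using that v by blast
qed

text \<open>Off an open set \<open>H\<close> of small capacity the \<open>w n\<close> converge uniformly, to a continuous \<open>\<phi>\<close>, and \<open>g\<close> is
  continuous as well. The set of points outside \<open>H\<close> with \<open>\<phi> \<noteq> g\<close> is then open up to \<open>H\<close> and
  \<open>m\<close>-null. A function that is at least \<open>1\<close> almost everywhere on \<open>H\<close> is therefore at least \<open>1\<close> almost
  everywhere on the larger open set, whose capacity is just as small. So \<open>w n \<rightarrow> g\<close> quasi-everywhere,
  for whichever quasi-continuous version \<open>g\<close> was given.\<close>
lemma quasi_everywhere_convergence: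
  assumes f: "f \<in> \<F>" and w: "\<And>n. w n \<in> \<F> \<inter> Cc"
    and fast: "\<And>n. energy_norm (\<lambda>x. w n x - f x) \<le> (1/8) ^ n"
    and g: "quasi_continuous m \<F> \<E> g" "AE x in m. g x = f x"
  shows "cap m \<F> \<E> {x. \<not> (\<lambda>n. w n x) \<longlonglongrightarrow> g x} = 0"
proof -
  have wF [simp]: "w n \<in> \<F>" and wC: "w n \<in> Cc" and cont: "continuous_on S (w n)" for n S
    using w by (auto simp: Cc_def intro: continuous_on_subset)
  define d where "d n = (\<lambda>x. \<bar>w (Suc n) x - w n x\<bar>)" for n
  have diff: "(\<lambda>x. w (Suc n) x - w n x) \<in> \<F> \<inter> Cc" for n
    using wF wC by (auto intro!: dom_diff Cc_diff)
  have dF: "d n \<in> \<F>" and dC: "continuous_on UNIV (d n)" for n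
    using abs_Cc_dom(1)[OF diff] unfolding d_def by (auto simp: Cc_def)
  have d_norm: "energy_norm (d n) \<le> 4 * (1/8) ^ n" for n
  proof -
    have "energy_norm (d n) \<le> 2 * energy_norm (\<lambda>x. w (Suc n) x - w n x)"
      unfolding d_def by (rule abs_Cc_dom(2)[OF diff])
    also have "\<dots> \<le> 2 * ((1/8) ^ Suc n + (1/8) ^ n)"
      using energy_norm_diff_triangle[OF wF wF f, of "Suc n" n] fast[of "Suc n"] fast[of n] by simp
    also have "\<dots> \<le> 4 * (1/8) ^ n"
      by simp
    finally show ?thesis .
  qed
  (* The energy of d n decays like 8^(-n): enough for uniform convergence off the sets A n, on
     which the potential 2^n * d n still has norm of order 4^(-n). *)
  define A where "A n = {x. (1/2) ^ n < d n x}" for n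
  have openA: "open (A n)" for n
    unfolding A_def by (intro open_Collect_less dC continuous_on_const)
  have AE_lim: "AE x in m. (\<lambda>n. w n x) \<longlonglongrightarrow> f x"
    using wF f fast by (rule AE_fast_energy_limit)
  have "cap m \<F> \<E> {x. \<not> (\<lambda>n. w n x) \<longlonglongrightarrow> g x} \<le> 0 + ennreal e" if "e > 0" for e :: real
  proof -
    define r where "r = sqrt e / 2"
    have r: "r > 0" using \<open>e > 0\<close> by (simp add: r_def)
    then obtain G where G: "open G" "cap m \<F> \<E> G < ennreal (r\<^sup>2)" "continuous_on (- G) g"
      using g(1) unfolding quasi_continuous_def by (meson ennreal_less_zero_iff zero_less_power)
    obtain A0 u0 where u0: "open A0" "G \<subseteq> A0" "u0 \<in> \<F>" "AE x in m. x \<in> A0 \<longrightarrow> 1 \<le> u0 x" "energy_norm u0 < r"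
      using potential_of_cap_less[OF G(2) r] .
    have "(\<lambda>k. 8 * (1/4) ^ k) \<longlonglongrightarrow> (8 * 0 :: real)"
      by (intro tendsto_intros LIMSEQ_power_zero) auto
    then have "\<forall>\<^sub>F k in sequentially. 8 * (1/4) ^ k < r"
      using r by (intro order_tendstoD) auto
    then obtain k where k: "8 * (1/4) ^ k < r"
      by (auto simp: eventually_sequentially)
    obtain v where v: "v \<in> \<F>" "AE x in m. x \<in> (\<Union>n. A (n + k)) \<longrightarrow> 1 \<le> v x" "energy_norm v \<le> 2 * (4 * (1/4) ^ k)"
    proof (rule potential_Union)
      show "(\<lambda>x. 2 ^ (n + k) * d (n + k) x) \<in> \<F>" for n
        using dF by (rule dom_scale)
      show "AE x in m. x \<in> A (n + k) \<longrightarrow> 1 \<le> 2 ^ (n + k) * d (n + k) x" for n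
        by (rule AE_I2) (auto simp: A_def power_one_over field_simps)
      show "energy_norm (\<lambda>x. 2 ^ (n + k) * d (n + k) x) \<le> 4 * (1/4) ^ k / 2 ^ n" for n
      proof -
        have "energy_norm (\<lambda>x. 2 ^ (n + k) * d (n + k) x) \<le> 2 ^ (n + k) * (4 * (1/8) ^ (n + k))"
          using d_norm[of "n + k"] dF by (simp add: energy_norm_scale)
        also have "\<dots> = 4 * (1/4) ^ (n + k)"
          by (simp add: power_mult_distrib[symmetric] mult.left_commute)
        also have "\<dots> = 4 * (1/4) ^ k * (1/4) ^ n"
          by (simp add: power_add)
        also have "\<dots> \<le> 4 * (1/4) ^ k * (1/2) ^ n"
          by (intro mult_left_mono power_mono) auto
        finally show ?thesis by (simp add: power_one_over)
      qed
    qed (use that in blast)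
    define H where "H = A0 \<union> (\<Union>n. A (n + k))"
    have openH: "open H" unfolding H_def using u0(1) openA by auto
    have "uniformly_convergent_on (- H) (\<lambda>n x. \<Sum>i<n. w (Suc i + k) x - w (i + k) x)"
    proof (rule Weierstrass_m_test')
      show "norm (w (Suc n + k) x - w (n + k) x) \<le> (1/2) ^ k * (1/2) ^ n" if "x \<in> - H" for n x
      proof -
        have "x \<notin> A (n + k)" using that by (auto simp: H_def)
        then show ?thesis by (simp add: A_def d_def power_add mult.commute)
      qed
      show "summable (\<lambda>n. (1/2::real) ^ k * (1/2) ^ n)"
        by (intro summable_mult summable_geometric) auto
    qed
    moreover have "(\<Sum>i<n. w (Suc i + k) x - w (i + k) x) = w (n + k) x - w k x" for n x
      by (induction n) auto
    ultimately obtain s where s: "uniform_limit (- H) (\<lambda>n x. w (n + k) x - w k x) s sequentially"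
      unfolding uniformly_convergent_on_def by auto
    define \<phi> where "\<phi> x = s x + w k x" for x
    have "continuous_on (- H) s"
      by (rule uniform_limit_theorem[OF _ s]) (auto intro!: always_eventually continuous_intros cont)
    then have "continuous_on (- H) (\<lambda>x. \<phi> x - g x)"
      unfolding \<phi>_def using G(3) u0(2) 
      by (intro continuous_intros cont) (auto simp: H_def intro: continuous_on_subset)
    then have "closed {x \<in> - H. \<phi> x - g x = 0}"
      using openH by (intro continuous_closed_preimage_constant) auto
    then have openHD: "open (- {x \<in> - H. \<phi> x - g x = 0})"
      by (rule open_Compl)
    have lim\<phi>: "(\<lambda>n. w n x) \<longlonglongrightarrow> \<phi> x" if "x \<in> - H" for x
    proof -
      have "(\<lambda>n. w (n + k) x - w k x) \<longlonglongrightarrow> s x"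
        using s that by (rule tendsto_uniform_limitI)
      then have "(\<lambda>n. (w (n + k) x - w k x) + w k x) \<longlonglongrightarrow> \<phi> x"
        unfolding \<phi>_def by (intro tendsto_intros)
      then show ?thesis by (simp add: LIMSEQ_offset)
    qed
    (* Truncation makes the summands nonnegative, so that the sum is at least 1 on the union. *)
    define p where "p x = clamp01 u0 x + clamp01 v x" for x
    have "AE x in m. x \<in> - {x \<in> - H. \<phi> x - g x = 0} \<longrightarrow> 1 \<le> p x"
      using AE_lim g(2) u0(4) v(2)
    proof eventually_elim
      case (elim x)
      have "x \<in> H" if "x \<in> - {x \<in> - H. \<phi> x - g x = 0}"
        using that elim(1,2) lim\<phi>[of x] LIMSEQ_unique by fastforce
      then show ?case using elim(3,4) by (auto simp: H_def p_def clamp01_def)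
    qed
    moreover have "{x. \<not> (\<lambda>n. w n x) \<longlonglongrightarrow> g x} \<subseteq> - {x \<in> - H. \<phi> x - g x = 0}"
    proof -
      have "(\<lambda>n. w n x) \<longlonglongrightarrow> g x" if "x \<in> - H" "\<phi> x - g x = 0" for x
        using lim\<phi>[OF that(1)] that(2) by simp
      then show ?thesis by blast
    qed
    moreover have "p \<in> \<F>"
      unfolding p_def using u0(3) v(1) by (intro dom_add clamp01_dom)
    ultimately have "cap m \<F> \<E> {x. \<not> (\<lambda>n. w n x) \<longlonglongrightarrow> g x} \<le> ennreal ((energy_norm p)\<^sup>2)"
      using openHD by (intro cap_le_of_potential)
    also have "\<dots> \<le> ennreal ((2 * r)\<^sup>2)"
    proof (intro ennreal_leI power_mono)
      have "energy_norm p \<le> energy_norm (clamp01 u0) + energy_norm (clamp01 v)"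
        unfolding p_def using u0 v by (intro energy_norm_triangle) auto
      also have "\<dots> \<le> 2 * r"
        using energy_norm_clamp01[OF u0(3)] energy_norm_clamp01[OF v(1)] u0(5) v(3) k by simp
      finally show "energy_norm p \<le> 2 * r" .
      show "0 \<le> energy_norm p"
        unfolding p_def using u0 v by (intro energy_norm_nonneg dom_add) auto
    qed
    also have "\<dots> = 0 + ennreal e"
      using \<open>e > 0\<close> by (simp add: r_def)
    finally show ?thesis .
  qed
  then have "cap m \<F> \<E> {x. \<not> (\<lambda>n. w n x) \<longlonglongrightarrow> g x} \<le> 0"
    by (rule ennreal_le_epsilon)
  then show ?thesis by simp
qed

end

section \<open>Measures represented by an element of the domain\<close>

context regular_dirichlet_form
begin

lemma Cc_integrable:
  fixes \<mu> :: "'a measure"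
  assumes "sets \<mu> = sets borel" "emeasure \<mu> UNIV < \<infinity>" and f: "f \<in> Cc"
  shows "integrable \<mu> f"
proof -
  have [measurable_cong]: "sets \<mu> = sets borel" by fact
  have [measurable]: "f \<in> borel_measurable borel"
    using f by (auto simp: Cc_def intro: borel_measurable_continuous_onI)
  interpret finite_measure \<mu>
    using assms sets_eq_imp_space_eq[OF assms(1)] by (intro finite_measureI) auto
  obtain C where "\<And>x. \<bar>f x\<bar> \<le> C" using Cc_bounded[OF f] by blast
  then show ?thesis by (intro integrable_const_bound[where B=C]) auto
qed

lemma integral_abs_le_energy:
  fixes \<mu> :: "'a measure"
  assumes \<mu>: "sets \<mu> = sets borel" "emeasure \<mu> UNIV < \<infinity>" and U: "U \<in> \<F>"
    and rep: "\<And>f. f \<in> \<F> \<inter> Cc \<Longrightarrow> (\<integral>x. f x \<partial>\<mu>) = E1 f U" and f: "f \<in> \<F> \<inter> Cc"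
  shows "(\<integral>x. \<bar>f x\<bar> \<partial>\<mu>) \<le> 2 * energy_norm U * energy_norm f"
proof -
  have "(\<integral>x. \<bar>f x\<bar> \<partial>\<mu>) = E1 (\<lambda>x. \<bar>f x\<bar>) U"
    using rep[OF abs_Cc_dom(1)[OF f]] .
  also have "\<dots> \<le> energy_norm (\<lambda>x. \<bar>f x\<bar>) * energy_norm U"
    using E1_Cauchy_Schwarz[of "\<lambda>x. \<bar>f x\<bar>" U] abs_Cc_dom(1)[OF f] U by simp
  also have "\<dots> \<le> (2 * energy_norm f) * energy_norm U"
    by (intro mult_right_mono abs_Cc_dom(2)[OF f] energy_norm_nonneg U)
  finally show ?thesis by (simp add: mult_ac)
qed

lemma S_0_of_representation:
  fixes \<mu> :: "'a measure"
  assumes \<mu>: "sets \<mu> = sets borel" "emeasure \<mu> UNIV < \<infinity>" and U: "U \<in> \<F>"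
    and rep: "\<And>f. f \<in> \<F> \<inter> Cc \<Longrightarrow> (\<integral>x. f x \<partial>\<mu>) = E1 f U"
  shows "\<mu> \<in> S_0 m \<F> \<E>"
proof -
  have "emeasure \<mu> K < \<infinity>" for K
    using emeasure_mono[of K UNIV \<mu>] \<mu> by (auto simp: order.strict_trans1)
  then have "Defs.radon \<mu>"
    using \<mu> by (simp add: radon_def)
  moreover have "(\<integral>\<^sup>+x. ennreal \<bar>f x\<bar> \<partial>\<mu>) \<le> ennreal ((2 * energy_norm U + 1) * sqrt (E1 f f))" if f: "f \<in> \<F> \<inter> Cc" for f
  proof -
    have "(\<integral>\<^sup>+x. ennreal \<bar>f x\<bar> \<partial>\<mu>) = ennreal (\<integral>x. \<bar>f x\<bar> \<partial>\<mu>)"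
      using f by (intro nn_integral_eq_integral Cc_integrable[OF \<mu>] Cc_abs) auto
    moreover have "(\<integral>x. \<bar>f x\<bar> \<partial>\<mu>) \<le> (2 * energy_norm U + 1) * sqrt (E1 f f)"
      using integral_abs_le_energy[OF \<mu> U rep f] E1_nonneg[of f] f
      by (simp add: energy_norm_def distrib_right add_increasing2)
    ultimately show ?thesis by (simp add: ennreal_leI)
  qed
  moreover have "0 < 2 * energy_norm U + 1"
    using energy_norm_nonneg[OF U] by linarith
  ultimately show ?thesis unfolding S_0_def by blast
qed

text \<open>Core functions approaching \<open>f\<close> fast in energy are Cauchy in \<open>L\<^sup>1(\<mu>)\<close>, by
  \<open>integral_abs_le_energy\<close>, and they converge \<open>\<mu>\<close>-almost everywhere to any quasi-continuous version
  of \<open>f\<close>. That version agrees with their Borel limit \<open>h\<close> off a \<open>\<mu>\<close>-null set and so is measurable for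
  the completion.\<close>
lemma one_potential_of_representation:
  fixes \<mu> :: "'a measure"
  assumes \<mu>: "sets \<mu> = sets borel" "emeasure \<mu> UNIV < \<infinity>" and U: "U \<in> \<F>"
    and rep: "\<And>f. f \<in> \<F> \<inter> Cc \<Longrightarrow> (\<integral>x. f x \<partial>\<mu>) = E1 f U"
    and null: "\<And>B. B \<in> sets borel \<Longrightarrow> cap m \<F> \<E> B = 0 \<Longrightarrow> emeasure \<mu> B = 0"
  shows "one_potential m \<F> \<E> \<mu> U"
proof -
  have [measurable_cong]: "sets \<mu> = sets borel" by fact
  have "has_bochner_integral (completion \<mu>) g (E1 f U)"
    if f: "f \<in> \<F>" and g: "quasi_continuous m \<F> \<E> g" "AE x in m. g x = f x" for f g
  proof -
    have "\<exists>w\<in>\<F> \<inter> Cc. energy_norm (\<lambda>x. w x - f x) \<le> (1/8) ^ n" for n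
    proof -
      obtain w where w: "w \<in> \<F> \<inter> Cc" "E1 (\<lambda>x. f x - w x) (\<lambda>x. f x - w x) < ((1/8) ^ n)\<^sup>2"
        using core_dense_dom[OF f, of "((1/8) ^ n)\<^sup>2"] by auto
      have "energy_norm (\<lambda>x. f x - w x) < (1/8) ^ n"
        by (rule power_less_imp_less_base[where n=2]) (use w f in \<open>simp_all add: energy_norm_power2 dom_diff\<close>)
      then show ?thesis using w f energy_norm_commute[of f w] by (intro bexI[of _ w]) auto
    qed
    then obtain w where w: "\<And>n. w n \<in> \<F> \<inter> Cc" and fast: "\<And>n. energy_norm (\<lambda>x. w n x - f x) \<le> (1/8) ^ n"
      by metis
    have wF [simp, measurable]: "w n \<in> \<F>" for n using w by simp
    have w_int: "integrable \<mu> (w n)" for n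
      using w by (intro Cc_integrable[OF \<mu>]) auto
    define h where "h x = lim (\<lambda>n. w n x)" for x
    have h_meas: "h \<in> borel_measurable borel"
      unfolding h_def by measurable
    have h: "h \<in> borel_measurable \<mu>"
      using h_meas by simp
    obtain D where D: "D \<in> sets borel" "{x. \<not> (\<lambda>n. w n x) \<longlonglongrightarrow> g x} \<subseteq> D" "cap m \<F> \<E> D = 0"
      using cap_zero_borel[OF quasi_everywhere_convergence[OF f w fast g]] .
    have "D \<in> null_sets \<mu>" using D null[of D] \<mu> by auto
    then have "AE x in \<mu>. x \<notin> D" by (rule AE_not_in)
    then have lim: "AE x in \<mu>. (\<lambda>n. w n x) \<longlonglongrightarrow> g x"
      using D(2) by (auto elim!: eventually_mono)
    then have gh: "AE x in \<mu>. g x = h x"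
      by eventually_elim (simp add: h_def limI)
    have "integrable \<mu> h \<and> (\<lambda>n. \<integral>x. w n x \<partial>\<mu>) \<longlonglongrightarrow> (\<integral>x. h x \<partial>\<mu>)"
    proof (rule integral_tendsto_of_L1_Cauchy[OF w_int h])
      show "AE x in \<mu>. (\<lambda>n. w n x) \<longlonglongrightarrow> h x"
        using lim gh by eventually_elim simp
      fix n k :: nat assume "k \<le> n"
      have d: "(\<lambda>x. w n x - w k x) \<in> \<F> \<inter> Cc"
        using w by (auto intro!: dom_diff Cc_diff)
      have "energy_norm (\<lambda>x. w n x - w k x) \<le> (1/8) ^ n + (1/8) ^ k"
        using energy_norm_diff_triangle[OF wF wF f, of n k] fast[of n] fast[of k] by simp
      also have "\<dots> \<le> 2 * (1/8) ^ k"
        using \<open>k \<le> n\<close> power_decreasing[of k n "1/8 :: real"] by simp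
      finally have "2 * energy_norm U * energy_norm (\<lambda>x. w n x - w k x) \<le> 2 * energy_norm U * (2 * (1/8) ^ k)"
        using energy_norm_nonneg[OF U] by (intro mult_left_mono) auto
      with integral_abs_le_energy[OF \<mu> U rep d]
      show "(\<integral>x. \<bar>w n x - w k x\<bar> \<partial>\<mu>) \<le> 2 * energy_norm U * (2 * (1/8) ^ k)"
        by (rule order_trans)
    next
      have "(\<lambda>k. 2 * energy_norm U * (2 * (1/8) ^ k)) \<longlonglongrightarrow> 2 * energy_norm U * (2 * 0)"
        by (intro tendsto_intros LIMSEQ_power_zero) auto
      then show "(\<lambda>k. 2 * energy_norm U * (2 * (1/8) ^ k)) \<longlonglongrightarrow> 0" by simp
    qed
    moreover have "(\<lambda>n. \<integral>x. w n x \<partial>\<mu>) \<longlonglongrightarrow> E1 f U"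
    proof -
      have "(\<lambda>n. E1 U (w n)) \<longlonglongrightarrow> E1 U f"
      proof (rule E1_tendsto[OF wF f U])
        show "(\<lambda>n. energy_norm (\<lambda>x. w n x - f x)) \<longlonglongrightarrow> 0"
          using fast f by (intro tendsto_sandwich[OF _ _ tendsto_const LIMSEQ_power_zero[of "1/8 :: real"]])
            (auto intro!: always_eventually energy_norm_nonneg dom_diff)
      qed
      moreover have "(\<integral>x. w n x \<partial>\<mu>) = E1 U (w n)" for n
        using rep[OF w] E1_sym[OF wF U] by simp
      ultimately show ?thesis using E1_sym[OF f U] by simp
    qed
    ultimately have "integrable \<mu> h" and "(\<integral>x. h x \<partial>\<mu>) = E1 f U"
      using LIMSEQ_unique by blast+
    then have hb: "has_bochner_integral (completion \<mu>) h (E1 f U)"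
      using h by (simp add: has_bochner_integral_iff integrable_completion integral_completion)
    have gh': "AE x in completion \<mu>. g x = h x"
      using gh by (rule AE_completion)
    have g_meas: "g \<in> borel_measurable (completion \<mu>)"
    proof (rule measurableI)
      fix B :: "real set" assume B: "B \<in> sets borel"
      have "AE x in completion \<mu>. x \<in> h -` B \<inter> space \<mu> \<longleftrightarrow> x \<in> g -` B \<inter> space \<mu>"
        using gh' by eventually_elim auto
      from completion.in_sets_AE[OF this sets_completionI_sets[OF measurable_sets[OF h B]]]
      show "g -` B \<inter> space (completion \<mu>) \<in> sets (completion \<mu>)"
        by simp
    qed simp
    have "h \<in> borel_measurable (completion \<mu>)"
      using h by (rule measurable_completion)
    from has_bochner_integral_cong_AE[OF g_meas this gh', of "E1 f U"] hb show ?thesis by blast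
  qed
  then show ?thesis using U unfolding one_potential_def by blast
qed

end

section \<open>The resolvent as a kernel\<close>

text \<open>Daniell's principle for functionals on nonnegative Borel functions, used below to turn
  \<open>h \<mapsto> \<integral> R \<alpha> h d\<mu>\<close> into a measure.\<close>
lemma measure_of_functional:
  fixes L :: "('a::topological_space \<Rightarrow> ennreal) \<Rightarrow> ennreal"
  assumes cmult: "\<And>c f. f \<in> borel_measurable borel \<Longrightarrow> L (\<lambda>x. c * f x) = c * L f"
    and add: "\<And>f g. f \<in> borel_measurable borel \<Longrightarrow> g \<in> borel_measurable borel \<Longrightarrow> L (\<lambda>x. f x + g x) = L f + L g"
    and SUP: "\<And>F. (\<And>i. F i \<in> borel_measurable borel) \<Longrightarrow> incseq F \<Longrightarrow> L (\<lambda>x. SUP i. F i x) = (SUP i :: nat. L (F i))"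
  obtains \<nu> where "sets \<nu> = sets borel" "\<And>f. f \<in> borel_measurable borel \<Longrightarrow> (\<integral>\<^sup>+x. f x \<partial>\<nu>) = L f"
proof -
  define \<nu> where "\<nu> = measure_of UNIV (sets borel) (\<lambda>B. L (indicator B))"
  have zero: "L (\<lambda>_. 0) = 0" using cmult[of "\<lambda>_. 0" 0] by simp
  have "indicator {} = (\<lambda>_ :: 'a. 0 :: ennreal)" by (simp add: fun_eq_iff)
  then have zero': "L (indicator {}) = 0" using zero by metis
  have sets: "sets \<nu> = sets borel"
    unfolding \<nu>_def by (metis sets.sets_measure_of_eq space_borel)
  have em: "emeasure \<nu> B = L (indicator B)" if "B \<in> sets borel" for B
  proof (rule emeasure_measure_of[OF \<nu>_def])
    show "positive (sets \<nu>) (\<lambda>B. L (indicator B))"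
      using zero' by (simp add: positive_def)
    show "countably_additive (sets \<nu>) (\<lambda>B. L (indicator B))"
    proof (rule countably_additiveI)
      fix A :: "nat \<Rightarrow> 'a set" assume A: "range A \<subseteq> sets \<nu>" "disjoint_family A"
      then have Am [measurable]: "A i \<in> sets borel" for i using sets by auto
      define F where "F n x = (\<Sum>i<n. indicator (A i) x :: ennreal)" for n x
      have Fm: "F n \<in> borel_measurable borel" for n unfolding F_def by measurable
      have LF: "L (F n) = (\<Sum>i<n. L (indicator (A i)))" for n
      proof (induction n)
        case (Suc n)
        have "F (Suc n) = (\<lambda>x. F n x + indicator (A n) x)" by (simp add: F_def fun_eq_iff)
        then show ?case using Suc add[OF Fm[of n], of "indicator (A n)"] by simp
      qed (simp add: F_def zero)
      have "(\<lambda>x. SUP n. F n x) = indicator (\<Union>i. A i)"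
        using suminf_indicator[OF A(2)] by (simp add: F_def fun_eq_iff suminf_eq_SUP[symmetric])
      moreover have "incseq F"
        unfolding F_def by (auto simp: incseq_def le_fun_def intro!: sum_mono2)
      ultimately show "(\<Sum>i. L (indicator (A i))) = L (indicator (\<Union>i. A i))"
        using SUP[of F, OF Fm] by (simp add: LF suminf_eq_SUP)
    qed
    show "sets borel \<subseteq> Pow UNIV" by simp
    show "B \<in> sets \<nu>" using that sets by simp
  qed
  have "(\<integral>\<^sup>+x. f x \<partial>\<nu>) = L f" if "f \<in> borel_measurable borel" for f
    using that
  proof (induction f rule: borel_measurable_induct)
    case (cong f g)
    then have "f = g" by (simp add: fun_eq_iff)
    then show ?case using cong by simp
  next
    case (set A)
    then show ?case using em sets by simp
  next
    case (mult u c)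
    then show ?case using sets cmult by (subst nn_integral_cmult) (auto cong: measurable_cong_sets)
  next
    case (add u v)
    then show ?case using sets assms(2)[of u v] by (subst nn_integral_add) (auto cong: measurable_cong_sets simp: add.commute)
  next
    case (seq U)
    have "(\<integral>\<^sup>+x. (SUP i. U i) x \<partial>\<nu>) = (SUP i. \<integral>\<^sup>+x. U i x \<partial>\<nu>)"
      using seq sets by (simp add: image_comp nn_integral_monotone_convergence_SUP cong: measurable_cong_sets)
    moreover have "(SUP i. U i) = (\<lambda>x. SUP i. U i x)" by (auto simp: fun_eq_iff image_comp)
    ultimately show ?case using seq SUP[of U] by simp
  qed
  then show ?thesis using that sets by blast
qed

context hunt_process
begin

lemma measurable_path_P [measurable]:
  "f \<in> borel_measurable borel \<Longrightarrow> (\<lambda>\<omega>. case_option 0 f (X t \<omega>)) \<in> borel_measurable (P y)"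
  by (subst measurable_cong_sets[OF sets_P refl])
     (rule measurable_compose[OF measurable_X measurable_case_option_cemetery])

lemma transition_cmult:
  "f \<in> borel_measurable borel \<Longrightarrow> transition X P t (\<lambda>x. c * f x) y = c * transition X P t f y"
  unfolding transition_def
  by (subst nn_integral_cmult[symmetric]) (auto intro!: nn_integral_cong split: option.split)

lemma transition_add:
  "f \<in> borel_measurable borel \<Longrightarrow> g \<in> borel_measurable borel \<Longrightarrow>
    transition X P t (\<lambda>x. f x + g x) y = transition X P t f y + transition X P t g y"
  unfolding transition_def
  by (subst nn_integral_add[symmetric]) (auto intro!: nn_integral_cong split: option.split)

lemma transition_SUP:
  fixes F :: "nat \<Rightarrow> 'a \<Rightarrow> ennreal"
  assumes "\<And>i. F i \<in> borel_measurable borel" "incseq F"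
  shows "transition X P t (\<lambda>x. SUP i. F i x) y = (SUP i. transition X P t (F i) y)"
  unfolding transition_def using assms
  by (subst nn_integral_monotone_convergence_SUP[symmetric])
     (auto intro!: nn_integral_cong simp: incseq_def le_fun_def split: option.split)

lemma resolvent_cmult:
  assumes [measurable]: "f \<in> borel_measurable borel"
  shows "resolvent X P \<alpha> (\<lambda>x. c * f x) y = c * resolvent X P \<alpha> f y"
  using assms by (subst (1 2) resolvent_eq_laplace, simp_all)
    (subst nn_integral_cmult[symmetric], auto simp: transition_cmult mult_ac)

lemma resolvent_add:
  assumes [measurable]: "f \<in> borel_measurable borel" "g \<in> borel_measurable borel"
  shows "resolvent X P \<alpha> (\<lambda>x. f x + g x) y = resolvent X P \<alpha> f y + resolvent X P \<alpha> g y"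
  using assms by (subst (1 2 3) resolvent_eq_laplace, simp_all)
    (subst nn_integral_add[symmetric], auto simp: transition_add distrib_left distrib_right)

lemma resolvent_SUP:
  fixes F :: "nat \<Rightarrow> 'a \<Rightarrow> ennreal"
  assumes [measurable]: "\<And>i. F i \<in> borel_measurable borel" and "incseq F"
  shows "resolvent X P \<alpha> (\<lambda>x. SUP i. F i x) y = (SUP i. resolvent X P \<alpha> (F i) y)"
proof -
  have "resolvent X P \<alpha> (\<lambda>x. SUP i. F i x) y =
      (\<integral>\<^sup>+t. (SUP i. ennreal (exp (- \<alpha> * t)) * transition X P (ennreal t) (F i) y * indicator {0..} t) \<partial>lborel)"
    using assms by (subst resolvent_eq_laplace)
      (auto intro!: nn_integral_cong simp: transition_SUP SUP_mult_left_ennreal SUP_mult_right_ennreal)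
  also have "\<dots> = (SUP i. \<integral>\<^sup>+t. ennreal (exp (- \<alpha> * t)) * transition X P (ennreal t) (F i) y * indicator {0..} t \<partial>lborel)"
    using assms by (intro nn_integral_monotone_convergence_SUP)
      (auto simp: incseq_def le_fun_def intro!: mult_right_mono mult_left_mono transition_mono)
  finally show ?thesis by (simp add: resolvent_eq_laplace)
qed

lemma resolvent_antimono:
  assumes "f \<in> borel_measurable borel" "a \<le> b"
  shows "resolvent X P b f x \<le> resolvent X P a f x"
  using resolvent_equation[OF assms, of x] by simp

end

section \<open>Finite measures with bounded potential\<close>

locale symmetric_hunt_process =
  regular_dirichlet_form m \<F> \<E> + hunt_process X \<theta> P
  for m :: "'a::{metric_space, second_countable_topology} measure" and \<F> \<E>
    and X :: "ennreal \<Rightarrow> 'w \<Rightarrow> 'a option" and \<theta> P +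
  assumes symmetric: "symmetric_process m X P"
    and associated: "associated m \<F> \<E> X P"
begin

abbreviation "R \<equiv> resolvent X P"

lemma R_symmetric:
  "f \<in> borel_measurable borel \<Longrightarrow> g \<in> borel_measurable borel \<Longrightarrow>
    (\<integral>\<^sup>+x. R \<alpha> f x * g x \<partial>m) = (\<integral>\<^sup>+x. f x * R \<alpha> g x \<partial>m)"
  by (intro resolvent_symmetric[OF symmetric sigma_finite_m sets_m])

lemma nn_integral_R_1_le:
  assumes [measurable]: "h \<in> borel_measurable borel"
  shows "(\<integral>\<^sup>+x. R 1 h x \<partial>m) \<le> (\<integral>\<^sup>+x. h x \<partial>m)"
proof -
  have "(\<integral>\<^sup>+x. R 1 h x \<partial>m) = (\<integral>\<^sup>+x. h x * R 1 (\<lambda>_. 1) x \<partial>m)"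
    using R_symmetric[of h "\<lambda>_. 1" 1] by simp
  also have "\<dots> \<le> (\<integral>\<^sup>+x. h x * 1 \<partial>m)"
    using resolvent_const_le[of 1 1] by (intro nn_integral_mono mult_left_mono) auto
  finally show ?thesis by simp
qed

text \<open>In the Revuz formula with \<open>f = 1\<close> the inner integral stops at the lifetime, while \<open>af_potential\<close>
  does not, so that only an inequality results. The potential is bounded quasi-everywhere and hence
  \<open>m\<close>-almost everywhere.\<close>
lemma revuz_norm_dominates:
  assumes "revuz m X P A \<mu>" "\<alpha> > 0"
    and "qe_norm m \<F> \<E> (af_potential P A \<alpha>) < \<infinity>"
  obtains l :: real where "l > 0"
    "\<And>h. h \<in> borel_measurable borel \<Longrightarrow> (\<integral>\<^sup>+x. R \<alpha> h x \<partial>\<mu>) \<le> ennreal l * (\<integral>\<^sup>+x. h x \<partial>m)"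
proof -
  obtain l where l: "0 < l" "cap m \<F> \<E> {x. af_potential P A \<alpha> x \<ge> ennreal l} = 0"
    using assms(3) unfolding qe_norm_def Inf_less_iff by auto
  have bound: "AE x in m. af_potential P A \<alpha> x \<le> ennreal l"
    using AE_of_cap_zero[OF l(2)] by eventually_elim auto
  have "(\<integral>\<^sup>+x. R \<alpha> h x \<partial>\<mu>) \<le> ennreal l * (\<integral>\<^sup>+x. h x \<partial>m)"
    if [measurable]: "h \<in> borel_measurable borel" for h
  proof -
    have "(\<integral>\<^sup>+x. R \<alpha> h x \<partial>\<mu>) = (\<integral>\<^sup>+x. h x * (\<integral>\<^sup>+\<omega>. stieltjes (\<lambda>t. A t \<omega>)
         (\<lambda>s. ennreal (exp (- \<alpha> * s)) * case_option 0 (\<lambda>_. 1) (X (ennreal s) \<omega>))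
         \<partial>completion (P (Some x))) \<partial>completion m)"
      using assms(1,2) that borel_measurable_const[of 1] unfolding revuz_def by simp
    also have "\<dots> \<le> (\<integral>\<^sup>+x. h x * af_potential P A \<alpha> x \<partial>completion m)"
      unfolding af_potential_def stieltjes_def
      by (intro nn_integral_mono mult_left_mono SUP_mono')
        (auto intro!: nn_integral_mono mult_right_mono mult_left_le split: option.split)
    also have "\<dots> = (\<integral>\<^sup>+x. h x * af_potential P A \<alpha> x \<partial>m)"
      by (rule nn_integral_completion)
    also have "\<dots> \<le> (\<integral>\<^sup>+x. ennreal l * h x \<partial>m)"
    proof (rule nn_integral_mono_AE)
      show "AE x in m. h x * af_potential P A \<alpha> x \<le> ennreal l * h x"
        using bound by eventually_elim (subst mult.commute, simp add: mult_right_mono)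
    qed
    also have "\<dots> = ennreal l * (\<integral>\<^sup>+x. h x \<partial>m)"
      by (rule nn_integral_cmult) measurable
    finally show ?thesis .
  qed
  then show ?thesis using that l(1) by blast
qed

text \<open>By the resolvent equation \<open>\<mu>R 1 = \<mu>R \<alpha> + (\<alpha> - 1) (\<mu>R \<alpha>) R 1\<close>, and \<open>R 1\<close> does not increase the
  total mass of \<open>h \<cdot> m\<close> since it is symmetric and sub-Markov.\<close>
lemma domination_order_one:
  assumes \<mu> [measurable_cong]: "sets \<mu> = sets borel" and "1 \<le> \<alpha>" "0 < l"
    and dom: "\<And>h. h \<in> borel_measurable borel \<Longrightarrow> (\<integral>\<^sup>+x. R \<alpha> h x \<partial>\<mu>) \<le> ennreal l * (\<integral>\<^sup>+x. h x \<partial>m)"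
    and h [measurable]: "h \<in> borel_measurable borel"
  shows "(\<integral>\<^sup>+x. R 1 h x \<partial>\<mu>) \<le> ennreal (\<alpha> * l) * (\<integral>\<^sup>+x. h x \<partial>m)"
proof -
  have "(\<integral>\<^sup>+x. R 1 h x \<partial>\<mu>) = (\<integral>\<^sup>+x. R \<alpha> h x + ennreal (\<alpha> - 1) * R \<alpha> (R 1 h) x \<partial>\<mu>)"
    using resolvent_equation[OF h \<open>1 \<le> \<alpha>\<close>] by simp
  also have "\<dots> = (\<integral>\<^sup>+x. R \<alpha> h x \<partial>\<mu>) + ennreal (\<alpha> - 1) * (\<integral>\<^sup>+x. R \<alpha> (R 1 h) x \<partial>\<mu>)"
    by (subst nn_integral_add) (auto simp: nn_integral_cmult)
  also have "\<dots> \<le> ennreal l * (\<integral>\<^sup>+x. h x \<partial>m) + ennreal (\<alpha> - 1) * (ennreal l * (\<integral>\<^sup>+x. h x \<partial>m))"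
    using nn_integral_R_1_le[OF h]
    by (intro add_mono mult_left_mono order_trans[OF dom]) (auto intro: mult_left_mono)
  also have "\<dots> = (ennreal l + ennreal (\<alpha> - 1) * ennreal l) * (\<integral>\<^sup>+x. h x \<partial>m)"
    by (simp add: distrib_right mult.assoc)
  also have "ennreal l + ennreal (\<alpha> - 1) * ennreal l = ennreal (\<alpha> * l)"
    using assms(2,3) by (simp add: ennreal_mult[symmetric] ennreal_plus[symmetric] algebra_simps del: ennreal_plus)
  finally show ?thesis .
qed

end

text \<open>The condition \<open>dominated\<close> says that the measure \<open>\<mu>R 1\<close> is at most \<open>M \<cdot> m\<close>, which is the form in
  which boundedness of the 1-potential can be expressed before that potential exists.\<close>
locale bounded_potential = symmetric_hunt_process m \<F> \<E> X \<theta> P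
  for m :: "'a::{metric_space, second_countable_topology} measure" and \<F> \<E>
    and X :: "ennreal \<Rightarrow> 'w \<Rightarrow> 'a option" and \<theta> P +
  fixes \<mu> :: "'a measure" and M :: real
  assumes sets_\<mu> [measurable_cong]: "sets \<mu> = sets borel"
    and finite_\<mu>: "emeasure \<mu> UNIV < \<infinity>"
    and M_pos: "0 < M"
    and dominated: "h \<in> borel_measurable borel \<Longrightarrow> (\<integral>\<^sup>+x. R 1 h x \<partial>\<mu>) \<le> ennreal M * (\<integral>\<^sup>+x. h x \<partial>m)"
begin

lemma resolvent_total_mass:
  assumes "0 < \<alpha>" shows "ennreal \<alpha> * (\<integral>\<^sup>+x. R \<alpha> (\<lambda>_. c) x \<partial>\<mu>) \<le> c * emeasure \<mu> UNIV"
proof -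
  have "(\<integral>\<^sup>+x. R \<alpha> (\<lambda>_. c) x \<partial>\<mu>) \<le> (\<integral>\<^sup>+x. c * ennreal (1 / \<alpha>) \<partial>\<mu>)"
    using assms by (intro nn_integral_mono resolvent_const_le)
  also have "\<dots> = c * ennreal (1 / \<alpha>) * emeasure \<mu> UNIV"
    using sets_eq_imp_space_eq[OF sets_\<mu>] by simp
  finally have "ennreal \<alpha> * (\<integral>\<^sup>+x. R \<alpha> (\<lambda>_. c) x \<partial>\<mu>) \<le> ennreal \<alpha> * (c * ennreal (1 / \<alpha>) * emeasure \<mu> UNIV)"
    by (rule mult_left_mono) simp
  also have "\<dots> = (ennreal \<alpha> * ennreal (1 / \<alpha>)) * (c * emeasure \<mu> UNIV)"
    by (simp add: mult_ac)
  also have "ennreal \<alpha> * ennreal (1 / \<alpha>) = 1"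
    using assms by (simp add: ennreal_mult[symmetric])
  finally show ?thesis by simp
qed

lemma scaled_resolvent_mass:
  assumes "0 < k" shows "ennreal k * (\<integral>\<^sup>+x. R (1 + k) (\<lambda>_. c) x \<partial>\<mu>) \<le> c * emeasure \<mu> UNIV"
proof -
  have "ennreal k * (\<integral>\<^sup>+x. R (1 + k) (\<lambda>_. c) x \<partial>\<mu>) \<le> ennreal (1 + k) * (\<integral>\<^sup>+x. R (1 + k) (\<lambda>_. c) x \<partial>\<mu>)"
    using assms by (intro mult_right_mono ennreal_leI) auto
  then show ?thesis using resolvent_total_mass[of "1 + k" c] assms by (simp add: order_trans)
qed

text \<open>\<open>G\<close> is the density of the measure \<open>k \<cdot> \<mu>R(1+k)\<close>. Absolute continuity follows from
  \<open>R(1+k) \<le> R 1\<close> and \<open>dominated\<close>, finiteness of the density from the total mass.\<close>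
lemma approximate_density:
  assumes k: "0 < k"
  obtains G :: "'a \<Rightarrow> real" where "G \<in> borel_measurable borel" "\<And>x. 0 \<le> G x"
    "\<And>h. h \<in> borel_measurable borel \<Longrightarrow>
      (\<integral>\<^sup>+x. h x * ennreal (G x) \<partial>m) = ennreal k * (\<integral>\<^sup>+x. R (1 + k) h x \<partial>\<mu>)"
proof -
  interpret m: sigma_finite_measure m by (rule sigma_finite_m)
  obtain \<nu> where sets_\<nu> [measurable_cong]: "sets \<nu> = sets borel"
    and \<nu>: "\<And>h. h \<in> borel_measurable borel \<Longrightarrow> (\<integral>\<^sup>+x. h x \<partial>\<nu>) = ennreal k * (\<integral>\<^sup>+x. R (1 + k) h x \<partial>\<mu>)"
  proof (rule measure_of_functional[of "\<lambda>h. ennreal k * (\<integral>\<^sup>+x. R (1 + k) h x \<partial>\<mu>)"])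
    fix c and f :: "'a \<Rightarrow> ennreal" assume [measurable]: "f \<in> borel_measurable borel"
    show "ennreal k * (\<integral>\<^sup>+x. R (1 + k) (\<lambda>x. c * f x) x \<partial>\<mu>) = c * (ennreal k * (\<integral>\<^sup>+x. R (1 + k) f x \<partial>\<mu>))"
      by (simp add: resolvent_cmult nn_integral_cmult mult_ac)
  next
    fix f g :: "'a \<Rightarrow> ennreal" assume [measurable]: "f \<in> borel_measurable borel" "g \<in> borel_measurable borel"
    show "ennreal k * (\<integral>\<^sup>+x. R (1 + k) (\<lambda>x. f x + g x) x \<partial>\<mu>) =
      ennreal k * (\<integral>\<^sup>+x. R (1 + k) f x \<partial>\<mu>) + ennreal k * (\<integral>\<^sup>+x. R (1 + k) g x \<partial>\<mu>)"
      by (simp add: resolvent_add nn_integral_add distrib_left)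
  next
    fix F :: "nat \<Rightarrow> 'a \<Rightarrow> ennreal" assume F [measurable]: "\<And>i. F i \<in> borel_measurable borel" and "incseq F"
    have "incseq (\<lambda>i. R (1 + k) (F i))"
      using \<open>incseq F\<close> by (auto simp: incseq_def le_fun_def intro!: resolvent_mono)
    then have "(\<integral>\<^sup>+x. (SUP i. R (1 + k) (F i) x) \<partial>\<mu>) = (SUP i. \<integral>\<^sup>+x. R (1 + k) (F i) x \<partial>\<mu>)"
      by (intro nn_integral_monotone_convergence_SUP) measurable
    then show "ennreal k * (\<integral>\<^sup>+x. R (1 + k) (\<lambda>x. SUP i. F i x) x \<partial>\<mu>) =
      (SUP i. ennreal k * (\<integral>\<^sup>+x. R (1 + k) (F i) x \<partial>\<mu>))"
      using F \<open>incseq F\<close> by (simp add: resolvent_SUP SUP_mult_left_ennreal)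
  qed (use that in blast)
  have "absolutely_continuous m \<nu>"
    unfolding absolutely_continuous_def
  proof
    fix B assume "B \<in> null_sets m"
    then have [measurable]: "B \<in> sets borel" and "emeasure m B = 0" by auto
    have "(\<integral>\<^sup>+x. R (1 + k) (indicator B) x \<partial>\<mu>) \<le> (\<integral>\<^sup>+x. R 1 (indicator B) x \<partial>\<mu>)"
      using k by (intro nn_integral_mono resolvent_antimono) auto
    also have "\<dots> \<le> ennreal M * (\<integral>\<^sup>+x. indicator B x \<partial>m)"
      by (rule dominated) simp
    finally have "(\<integral>\<^sup>+x. indicator B x \<partial>\<nu>) = 0"
      using \<nu>[of "indicator B"] \<open>emeasure m B = 0\<close> by simp
    then show "B \<in> null_sets \<nu>"
      using sets_\<nu> by (auto simp: null_sets_def)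
  qed
  then obtain f where f [measurable]: "f \<in> borel_measurable m" and f\<nu>: "density m f = \<nu>"
    using m.Radon_Nikodym[of \<nu>] sets_\<nu> by auto
  have f_int: "(\<integral>\<^sup>+x. f x * h x \<partial>m) = (\<integral>\<^sup>+x. h x \<partial>\<nu>)" if "h \<in> borel_measurable borel" for h
    using that unfolding f\<nu>[symmetric] by (simp add: nn_integral_density)
  have "(\<integral>\<^sup>+x. f x \<partial>m) = ennreal k * (\<integral>\<^sup>+x. R (1 + k) (\<lambda>_. 1) x \<partial>\<mu>)"
    using f_int[of "\<lambda>_. 1"] \<nu>[of "\<lambda>_. 1"] by simp
  also have "\<dots> < \<infinity>"
    using scaled_resolvent_mass[OF k, of 1] finite_\<mu> by (simp add: order.strict_trans1)
  finally have "AE x in m. f x \<noteq> \<infinity>"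
    by (intro nn_integral_PInf_AE) auto
  then have fin: "AE x in m. ennreal (enn2real (f x)) = f x"
    by eventually_elim (simp add: less_top)
  show ?thesis
  proof (rule that[of "\<lambda>x. enn2real (f x)"])
    fix h :: "'a \<Rightarrow> ennreal" assume h: "h \<in> borel_measurable borel"
    have "(\<integral>\<^sup>+x. h x * ennreal (enn2real (f x)) \<partial>m) = (\<integral>\<^sup>+x. f x * h x \<partial>m)"
      using fin by (intro nn_integral_cong_AE) (auto elim!: eventually_mono simp: mult.commute)
    then show "(\<integral>\<^sup>+x. h x * ennreal (enn2real (f x)) \<partial>m) = ennreal k * (\<integral>\<^sup>+x. R (1 + k) h x \<partial>\<mu>)"
      using f_int[OF h] \<nu>[OF h] by simp
  qed (use f in auto)
qed

text \<open>The 1-potential of \<open>\<mu>\<close> as the limit in energy of the potentials \<open>u n\<close> of \<open>G n \<cdot> m\<close>, where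
  \<open>G n\<close> is the density of \<open>k n \<cdot> \<mu>R(1 + k n)\<close>.\<close>
theorem representation:
  "\<exists>U\<in>\<F>. (\<forall>f\<in>\<F> \<inter> Cc. (\<integral>x. f x \<partial>\<mu>) = E1 f U) \<and> (AE x in m. \<bar>U x\<bar> \<le> M)"
proof -
  define k where "k n = real (Suc n)" for n
  have k: "0 < k n" for n by (simp add: k_def)
  have "\<exists>G. G \<in> borel_measurable borel \<and> (\<forall>x. 0 \<le> G x) \<and> (\<forall>h\<in>borel_measurable borel.
      (\<integral>\<^sup>+x. h x * ennreal (G x) \<partial>m) = ennreal (k n) * (\<integral>\<^sup>+x. R (1 + k n) h x \<partial>\<mu>))" for n
    using approximate_density[OF k] by metis
  then obtain G where G [measurable]: "\<And>n. G n \<in> borel_measurable borel" and G_nonneg: "\<And>n x. 0 \<le> G n x"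
    and G_int: "\<And>n h. h \<in> borel_measurable borel \<Longrightarrow>
      (\<integral>\<^sup>+x. h x * ennreal (G n x) \<partial>m) = ennreal (k n) * (\<integral>\<^sup>+x. R (1 + k n) h x \<partial>\<mu>)"
    by metis
  have G_mass: "(\<integral>\<^sup>+x. ennreal (G n x) \<partial>m) \<le> emeasure \<mu> UNIV" for n
    using G_int[of "\<lambda>_. 1" n] scaled_resolvent_mass[OF k, of n 1] by simp
  (* The resolvent equation under \<open>\<mu>\<close>: \<open>\<mu>R 1 - \<mu>R(1 + k n)\<close> has density \<open>R 1 (G n)\<close>. *)
  have R_split: "(\<integral>\<^sup>+x. R 1 h x \<partial>\<mu>) = (\<integral>\<^sup>+x. R (1 + k n) h x \<partial>\<mu>) + (\<integral>\<^sup>+x. h x * R 1 (\<lambda>y. ennreal (G n y)) x \<partial>m)"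
    if [measurable]: "h \<in> borel_measurable borel" for h n
  proof -
    have "(\<integral>\<^sup>+x. R 1 h x \<partial>\<mu>) = (\<integral>\<^sup>+x. R (1 + k n) h x + ennreal (k n) * R (1 + k n) (R 1 h) x \<partial>\<mu>)"
      using resolvent_equation[OF that, of 1 "1 + k n"] k[of n] by simp
    also have "\<dots> = (\<integral>\<^sup>+x. R (1 + k n) h x \<partial>\<mu>) + ennreal (k n) * (\<integral>\<^sup>+x. R (1 + k n) (R 1 h) x \<partial>\<mu>)"
      by (subst nn_integral_add) (auto simp: nn_integral_cmult)
    also have "ennreal (k n) * (\<integral>\<^sup>+x. R (1 + k n) (R 1 h) x \<partial>\<mu>) = (\<integral>\<^sup>+x. R 1 h x * ennreal (G n x) \<partial>m)"
      by (rule G_int[symmetric]) measurable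
    also have "\<dots> = (\<integral>\<^sup>+x. h x * R 1 (\<lambda>y. ennreal (G n y)) x \<partial>m)"
      by (rule R_symmetric) measurable
    finally show ?thesis .
  qed
  (* Taking \<open>h = G n\<close> in the defining property of \<open>G n\<close> bounds its square integral. *)
  have G_L2: "G n \<in> L2 m" for n
  proof -
    have "(\<integral>\<^sup>+x. ennreal ((G n x)\<^sup>2) \<partial>m) = (\<integral>\<^sup>+x. ennreal (G n x) * ennreal (G n x) \<partial>m)"
      using G_nonneg by (simp add: power2_eq_square ennreal_mult)
    also have "\<dots> = ennreal (k n) * (\<integral>\<^sup>+x. R (1 + k n) (\<lambda>y. ennreal (G n y)) x \<partial>\<mu>)"
      by (rule G_int) measurable
    also have "\<dots> \<le> ennreal (k n) * (\<integral>\<^sup>+x. R 1 (\<lambda>y. ennreal (G n y)) x \<partial>\<mu>)"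
      using k[of n] by (intro mult_left_mono nn_integral_mono resolvent_antimono) auto
    also have "\<dots> \<le> ennreal (k n) * (ennreal M * emeasure \<mu> UNIV)"
      by (intro mult_left_mono order_trans[OF dominated] G_mass) auto
    also have "\<dots> < \<infinity>"
      using finite_\<mu> by (simp add: ennreal_mult_less_top)
    finally have "integrable m (\<lambda>x. (G n x)\<^sup>2)"
      by (intro integrableI_bounded) auto
    then show ?thesis by (simp add: L2_def)
  qed
  have "\<forall>n. \<exists>u. u \<in> \<F> \<and> (AE x in m. R 1 (\<lambda>y. ennreal (G n y)) x = ennreal (u x)) \<and> (AE x in m. u x \<ge> 0) \<and>
      (\<forall>v\<in>\<F>. E1 u v = (\<integral>x. G n x * v x \<partial>m))"
  proof
    fix n
    have "\<forall>x. 0 \<le> G n x" using G_nonneg by simp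
    from associated[unfolded associated_def, THEN spec[of _ 1], THEN mp, OF zero_less_one, THEN bspec, OF G_L2[of n], THEN mp, OF this]
    show "\<exists>u. u \<in> \<F> \<and> (AE x in m. R 1 (\<lambda>y. ennreal (G n y)) x = ennreal (u x)) \<and> (AE x in m. u x \<ge> 0) \<and>
      (\<forall>v\<in>\<F>. E1 u v = (\<integral>x. G n x * v x \<partial>m))"
      unfolding Bex_def .
  qed
  from choice[OF this] obtain u where uF [simp, measurable]: "\<And>n. u n \<in> \<F>"
    and u_R: "\<And>n. AE x in m. R 1 (\<lambda>y. ennreal (G n y)) x = ennreal (u n x)"
    and u_nonneg: "\<And>n. AE x in m. 0 \<le> u n x"
    and u_E1: "\<And>n v. v \<in> \<F> \<Longrightarrow> E1 (u n) v = (\<integral>x. G n x * v x \<partial>m)"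
    by blast

  have u_int: "(\<integral>\<^sup>+x. h x * ennreal (u n x) \<partial>m) = (\<integral>\<^sup>+x. h x * R 1 (\<lambda>y. ennreal (G n y)) x \<partial>m)" for h n
    using u_R[of n] by (intro nn_integral_cong_AE) (auto elim!: eventually_mono)
  have u_dom: "(\<integral>\<^sup>+x. h x * ennreal (u n x) \<partial>m) \<le> ennreal M * (\<integral>\<^sup>+x. h x \<partial>m)"
    if "h \<in> borel_measurable borel" for h n
  proof -
    have "(\<integral>\<^sup>+x. h x * ennreal (u n x) \<partial>m) \<le> (\<integral>\<^sup>+x. R 1 h x \<partial>\<mu>)"
      unfolding u_int R_split[OF that, of n] by (rule add_increasing) simp_all
    also note dominated[OF that]
    finally show ?thesis .
  qed

  have u_le: "AE x in m. u n x \<le> M" for n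
  proof -
    (* Subtracting \<open>M \<cdot> m(B)\<close> requires it to be finite, which square integrability of \<open>u n\<close> ensures. *)
    define B where "B = {x. M < u n x}"
    have [measurable]: "B \<in> sets borel" unfolding B_def by measurable
    have "ennreal (M\<^sup>2) * emeasure m B = (\<integral>\<^sup>+x. ennreal (M\<^sup>2) * indicator B x \<partial>m)"
      by (subst nn_integral_cmult) auto
    also have "\<dots> \<le> (\<integral>\<^sup>+x. ennreal ((u n x)\<^sup>2) \<partial>m)"
      using M_pos by (intro nn_integral_mono) (auto simp: indicator_def B_def intro!: ennreal_leI power_mono)
    also have "\<dots> < \<infinity>"
      using nn_integral_square_le[OF uF[of n]] by (simp add: order.strict_trans1)
    finally have B_fin: "emeasure m B < \<infinity>"
      using M_pos by (auto simp: ennreal_mult_less_top)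
    have "ennreal M * emeasure m B + (\<integral>\<^sup>+x. indicator B x * ennreal (u n x - M) \<partial>m) =
        (\<integral>\<^sup>+x. ennreal M * indicator B x + indicator B x * ennreal (u n x - M) \<partial>m)"
      by (subst nn_integral_add) (auto simp: nn_integral_cmult)
    also have "\<dots> = (\<integral>\<^sup>+x. indicator B x * ennreal (u n x) \<partial>m)"
      using M_pos by (intro nn_integral_cong) (auto simp: indicator_def B_def ennreal_plus[symmetric] simp del: ennreal_plus)
    also have "\<dots> \<le> ennreal M * emeasure m B + 0"
      using u_dom[of "indicator B" n] by simp
    finally have "(\<integral>\<^sup>+x. indicator B x * ennreal (u n x - M) \<partial>m) \<le> 0"
      using B_fin by (subst (asm) ennreal_add_left_cancel_le) (auto simp: ennreal_mult_eq_top_iff)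
    then have "AE x in m. indicator B x * ennreal (u n x - M) = 0"
      by (subst (asm) le_zero_eq, subst (asm) nn_integral_0_iff_AE) auto
    then show ?thesis
      by eventually_elim (auto simp: B_def indicator_def split: if_splits)
  qed

  define q where "q i j = E1 (u i) (u j)" for i j
  have q_sym: "q i j = q j i" for i j
    unfolding q_def by (rule E1_sym) auto
  have q_nn: "ennreal (q i j) = (\<integral>\<^sup>+x. ennreal (G i x) * R 1 (\<lambda>y. ennreal (G j y)) x \<partial>m)"
    and q_nonneg: "0 \<le> q i j" for i j
  proof -
    have pos: "AE x in m. 0 \<le> G i x * u j x"
      using u_nonneg[of j] by eventually_elim (simp add: G_nonneg)
    have q_eq: "q i j = (\<integral>x. G i x * u j x \<partial>m)"
      unfolding q_def by (rule u_E1) simp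
    have "integrable m (\<lambda>x. G i x * u j x)"
      using G_L2 dom_L2 uF by (intro L2_integrable_mult) auto
    then have "ennreal (q i j) = (\<integral>\<^sup>+x. ennreal (G i x * u j x) \<partial>m)"
      unfolding q_eq using pos by (rule nn_integral_eq_integral[symmetric])
    then show "ennreal (q i j) = (\<integral>\<^sup>+x. ennreal (G i x) * R 1 (\<lambda>y. ennreal (G j y)) x \<partial>m)"
      using u_int[of "\<lambda>x. ennreal (G i x)" j] by (simp add: ennreal_mult' G_nonneg)
    show "0 \<le> q i j"
      unfolding q_eq by (rule integral_nonneg_AE[OF pos])
  qed
  (* In \<open>\<mu>R 1 = \<mu>R(1 + k j) + R 1 (G j) \<cdot> m\<close>, evaluated at \<open>G i\<close>, the left side does not depend on
     \<open>j\<close> and the first summand decreases; it is finite and can be cancelled. *)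
  have q_mono: "q i j \<le> q i l" if "j \<le> l" for i j l
  proof -
    let ?h = "\<lambda>x. ennreal (G i x)"
    have "(\<integral>\<^sup>+x. R (1 + k j) ?h x \<partial>\<mu>) + ennreal (q i j) = (\<integral>\<^sup>+x. R 1 ?h x \<partial>\<mu>)"
      unfolding q_nn by (rule R_split[symmetric]) measurable
    also have "\<dots> = (\<integral>\<^sup>+x. R (1 + k l) ?h x \<partial>\<mu>) + ennreal (q i l)"
      unfolding q_nn by (rule R_split) measurable
    also have "\<dots> \<le> (\<integral>\<^sup>+x. R (1 + k j) ?h x \<partial>\<mu>) + ennreal (q i l)"
      using that by (intro add_right_mono nn_integral_mono resolvent_antimono) (auto simp: k_def)
    finally have le: "(\<integral>\<^sup>+x. R (1 + k j) ?h x \<partial>\<mu>) + ennreal (q i j) \<le> (\<integral>\<^sup>+x. R (1 + k j) ?h x \<partial>\<mu>) + ennreal (q i l)" .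
    have "(\<integral>\<^sup>+x. R (1 + k j) ?h x \<partial>\<mu>) \<le> (\<integral>\<^sup>+x. R 1 ?h x \<partial>\<mu>)"
      using k[of j] by (intro nn_integral_mono resolvent_antimono) auto
    also have "\<dots> \<le> ennreal M * emeasure \<mu> UNIV"
      by (intro order_trans[OF dominated] mult_left_mono G_mass) auto
    also have "\<dots> < \<infinity>"
      using finite_\<mu> by (simp add: ennreal_mult_less_top)
    finally have "ennreal (q i j) \<le> ennreal (q i l)"
      using le by (subst (asm) ennreal_add_left_cancel_le) auto
    then show ?thesis using q_nonneg by simp
  qed
  have q_bounded: "q n n \<le> M * enn2real (emeasure \<mu> UNIV)" for n
  proof -
    have "ennreal (q n n) = (\<integral>\<^sup>+x. ennreal (G n x) * ennreal (u n x) \<partial>m)"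
      unfolding q_nn u_int ..
    also have "\<dots> \<le> ennreal M * emeasure \<mu> UNIV"
      by (intro order_trans[OF u_dom] mult_left_mono G_mass) auto
    also have "\<dots> = ennreal (M * enn2real (emeasure \<mu> UNIV))"
      using M_pos finite_\<mu> by (simp add: ennreal_mult)
    finally show ?thesis
      using M_pos by (subst (asm) ennreal_le_iff) (auto intro!: mult_nonneg_nonneg)
  qed
  have q_inc: "incseq (\<lambda>n. q n n)"
  proof (rule incseq_SucI)
    fix n
    have "q n n \<le> q n (Suc n)" by (rule q_mono) simp
    also have "\<dots> = q (Suc n) n" by (rule q_sym)
    also have "\<dots> \<le> q (Suc n) (Suc n)" by (rule q_mono) simp
    finally show "q n n \<le> q (Suc n) (Suc n)" .
  qed
  obtain a where a: "(\<lambda>n. q n n) \<longlonglongrightarrow> a" and "\<forall>n. q n n \<le> a"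
    by (rule incseq_convergent[OF q_inc allI[OF q_bounded]])
  then have q_le: "q n n \<le> a" for n by blast
  have cauchy: "energy_norm (\<lambda>x. u n x - u j x) \<le> sqrt (a - q j j)" if "j \<le> n" for n j
  proof -
    have "E1 (\<lambda>x. u n x - u j x) (\<lambda>x. u n x - u j x) = q n n - 2 * q n j + q j j"
      unfolding q_def by (rule E1_diff_self) auto
    also have "\<dots> \<le> a - q j j"
      using q_mono[OF that, of j] q_sym[of n j] q_le[of n] by simp
    finally show ?thesis unfolding energy_norm_def by (rule real_sqrt_le_mono)
  qed
  have "(\<lambda>j. sqrt (a - q j j)) \<longlonglongrightarrow> sqrt (a - a)"
    by (intro tendsto_intros a)
  then have sqrt_lim: "(\<lambda>j. sqrt (a - q j j)) \<longlonglongrightarrow> 0" by simp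
  obtain U where U [simp]: "U \<in> \<F>" and lim: "(\<lambda>n. energy_norm (\<lambda>x. u n x - U x)) \<longlonglongrightarrow> 0"
    using cauchy by (rule energy_complete[OF uF _ sqrt_lim])

  have "AE x in m. 0 \<le> U x"
    by (rule AE_le_energy_limit[OF _ uF U u_nonneg lim]) simp
  moreover have "AE x in m. - M \<le> - U x"
  proof (rule AE_le_energy_limit[where w="\<lambda>n x. - u n x"])
    show "(\<lambda>x. - u n x) \<in> \<F>" for n using dom_scale[of "u n" "-1"] by simp
    show "(\<lambda>x. - U x) \<in> \<F>" using dom_scale[of U "-1"] by simp
    show "AE x in m. - M \<le> - u n x" for n using u_le by simp
    show "(\<lambda>n. energy_norm (\<lambda>x. - u n x - - U x)) \<longlonglongrightarrow> 0"
      using lim energy_norm_commute[OF uF U] by (simp add: add.commute)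
  qed simp
  ultimately have U_bound: "AE x in m. \<bar>U x\<bar> \<le> M"
    by eventually_elim auto

  have rep: "(\<integral>x. f x \<partial>\<mu>) = E1 f U" if f: "f \<in> \<F> \<inter> Cc" for f
  proof (rule LIMSEQ_unique)
    have fF: "f \<in> \<F>" and f_cont: "continuous_on UNIV f" using f by (auto simp: Cc_def)
    have [measurable]: "f \<in> borel_measurable borel" using fF by measurable
    show "(\<lambda>n. E1 f (u n)) \<longlonglongrightarrow> E1 f U"
      by (rule E1_tendsto[OF uF U fF lim])
    obtain C where C: "\<And>x. \<bar>f x\<bar> \<le> C" using Cc_bounded[of f] f by blast
    (* \<open>ennreal\<close> truncates at 0, so this applies to \<open>f\<close> and \<open>- f\<close> and yields both parts of the integral. *)
    have conv: "(\<lambda>n. enn2real (\<integral>\<^sup>+x. ennreal (g x) * ennreal (G n x) \<partial>m)) \<longlonglongrightarrow> enn2real (\<integral>\<^sup>+x. ennreal (g x) \<partial>\<mu>)"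
      if g: "continuous_on UNIV g" "\<And>x. g x \<le> C" for g :: "'a \<Rightarrow> real"
    proof -
      have [measurable]: "g \<in> borel_measurable borel" by (rule borel_measurable_continuous_onI[OF g(1)])
      have bound: "ennreal (k n) * R (1 + k n) (\<lambda>y. ennreal (g y)) x \<le> ennreal C" for n x
      proof -
        have "R (1 + k n) (\<lambda>y. ennreal (g y)) x \<le> R (1 + k n) (\<lambda>_. ennreal C) x"
          using g(2) by (intro resolvent_mono ennreal_leI)
        also have "\<dots> \<le> ennreal C * ennreal (1 / (1 + k n))"
          using k[of n] by (intro resolvent_const_le) simp
        finally have "ennreal (k n) * R (1 + k n) (\<lambda>y. ennreal (g y)) x \<le> ennreal (k n) * (ennreal C * ennreal (1 / (1 + k n)))"
          by (rule mult_left_mono) simp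
        also have "\<dots> = ennreal C * ennreal (k n / (1 + k n))"
          using k[of n] by (simp add: ennreal_mult[symmetric] mult.left_commute)
        also have "\<dots> \<le> ennreal C * ennreal 1"
          using k[of n] by (intro mult_left_mono ennreal_leI) auto
        finally show ?thesis by simp
      qed
      have "(\<lambda>n. \<integral>\<^sup>+x. ennreal (k n) * R (1 + k n) (\<lambda>y. ennreal (g y)) x \<partial>\<mu>) \<longlonglongrightarrow> (\<integral>\<^sup>+x. ennreal (g x) \<partial>\<mu>)"
      proof (rule nn_integral_dominated_convergence[where w="\<lambda>_. ennreal C"])
        show "(\<integral>\<^sup>+x. ennreal C \<partial>\<mu>) < \<infinity>"
          using finite_\<mu> sets_eq_imp_space_eq[OF sets_\<mu>] by (simp add: ennreal_mult_less_top)
        show "AE x in \<mu>. (\<lambda>n. ennreal (k n) * R (1 + k n) (\<lambda>y. ennreal (g y)) x) \<longlonglongrightarrow> ennreal (g x)"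
          unfolding k_def by (intro AE_I2 resolvent_tendsto[OF g])
      qed (use bound in auto)
      moreover have "(\<integral>\<^sup>+x. ennreal (k n) * R (1 + k n) (\<lambda>y. ennreal (g y)) x \<partial>\<mu>) =
          (\<integral>\<^sup>+x. ennreal (g x) * ennreal (G n x) \<partial>m)" for n
        by (subst G_int) (auto simp: nn_integral_cmult)
      moreover have "(\<integral>\<^sup>+x. ennreal (g x) \<partial>\<mu>) < top"
      proof -
        have "(\<integral>\<^sup>+x. ennreal (g x) \<partial>\<mu>) \<le> (\<integral>\<^sup>+x. ennreal C \<partial>\<mu>)"
          using g(2) by (intro nn_integral_mono ennreal_leI)
        also have "\<dots> < top"
          using finite_\<mu> sets_eq_imp_space_eq[OF sets_\<mu>] by (simp add: ennreal_mult_less_top)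
        finally show ?thesis .
      qed
      ultimately show ?thesis
        by (intro tendsto_enn2real) auto
    qed
    have "E1 f (u n) = enn2real (\<integral>\<^sup>+x. ennreal (f x) * ennreal (G n x) \<partial>m) - enn2real (\<integral>\<^sup>+x. ennreal (- f x) * ennreal (G n x) \<partial>m)" for n
    proof -
      have "E1 f (u n) = (\<integral>x. f x * G n x \<partial>m)"
        using u_E1[OF fF] E1_sym[OF fF uF] by (simp add: mult.commute)
      also have "\<dots> = enn2real (\<integral>\<^sup>+x. ennreal (f x * G n x) \<partial>m) - enn2real (\<integral>\<^sup>+x. ennreal (- (f x * G n x)) \<partial>m)"
        using fF dom_L2 G_L2 by (intro real_lebesgue_integral_def L2_integrable_mult) auto
      finally show ?thesis
        by (simp only: minus_mult_left ennreal_mult''[OF G_nonneg])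
    qed
    moreover have "(\<integral>x. f x \<partial>\<mu>) = enn2real (\<integral>\<^sup>+x. ennreal (f x) \<partial>\<mu>) - enn2real (\<integral>\<^sup>+x. ennreal (- f x) \<partial>\<mu>)"
      using f by (intro real_lebesgue_integral_def Cc_integrable[OF sets_\<mu> finite_\<mu>]) auto
    moreover have "f x \<le> C" "- f x \<le> C" for x
      using C[of x] by auto
    ultimately show "(\<lambda>n. E1 f (u n)) \<longlonglongrightarrow> (\<integral>x. f x \<partial>\<mu>)"
      using f_cont by (auto intro!: tendsto_diff conv continuous_intros)
  qed
  show ?thesis using U rep U_bound by blast
qed

end

context symmetric_hunt_process
begin

lemma S_00_of_dominated_resolvent:
  assumes \<mu>: "\<mu> \<in> finite_smooth m \<F> \<E>" and M: "0 < M"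
    and dom: "\<And>h. h \<in> borel_measurable borel \<Longrightarrow> (\<integral>\<^sup>+x. R 1 h x \<partial>\<mu>) \<le> ennreal M * (\<integral>\<^sup>+x. h x \<partial>m)"
  shows "\<mu> \<in> S_00 m \<F> \<E>"
proof -
  have sets: "sets \<mu> = sets borel" and fin: "emeasure \<mu> UNIV < \<infinity>"
    and null: "\<And>B. B \<in> sets borel \<Longrightarrow> cap m \<F> \<E> B = 0 \<Longrightarrow> emeasure \<mu> B = 0"
    using \<mu> by (auto simp: finite_smooth_def smooth_def)
  interpret bounded_potential m \<F> \<E> X \<theta> P \<mu> M
    by unfold_locales (use sets fin M dom in auto)
  obtain U where U: "U \<in> \<F>" "\<And>f. f \<in> \<F> \<inter> Cc \<Longrightarrow> (\<integral>x. f x \<partial>\<mu>) = E1 f U" "AE x in m. \<bar>U x\<bar> \<le> M"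
    using representation by blast
  then show ?thesis
    using S_0_of_representation[OF sets fin U(1,2)] one_potential_of_representation[OF sets fin U(1,2) null] fin
    unfolding S_00_def by blast
qed

lemma dynkin_S_00:
  assumes "\<mu> \<in> dynkin_class m \<F> \<E> X \<theta> P" "\<mu> \<in> finite_smooth m \<F> \<E>"
  shows "\<mu> \<in> S_00 m \<F> \<E>"
proof -
  obtain A where A: "revuz m X P A \<mu>" "qe_norm m \<F> \<E> (af_potential P A 1) < \<infinity>"
    using assms(1) by (auto simp: dynkin_class_def)
  obtain l where "0 < l" "\<And>h. h \<in> borel_measurable borel \<Longrightarrow> (\<integral>\<^sup>+x. R 1 h x \<partial>\<mu>) \<le> ennreal l * (\<integral>\<^sup>+x. h x \<partial>m)"
    using revuz_norm_dominates[OF A(1) _ A(2)] by auto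
  then show ?thesis by (intro S_00_of_dominated_resolvent[OF assms(2)])
qed

lemma kato_S_00:
  assumes "\<mu> \<in> kato_class m \<F> \<E> X \<theta> P" "\<mu> \<in> finite_smooth m \<F> \<E>"
  shows "\<mu> \<in> S_00 m \<F> \<E>"
proof -
  have sets: "sets \<mu> = sets borel"
    using assms(2) by (auto simp: finite_smooth_def smooth_def)
  obtain A where A: "revuz m X P A \<mu>" "((\<lambda>\<alpha>. qe_norm m \<F> \<E> (af_potential P A \<alpha>)) \<longlongrightarrow> 0) at_top"
    using assms(1) by (auto simp: kato_class_def)
  have "\<forall>\<^sub>F \<alpha> in at_top. qe_norm m \<F> \<E> (af_potential P A \<alpha>) < \<infinity>"
    using A(2) by (rule order_tendstoD) simp
  then have "\<forall>\<^sub>F \<alpha> in at_top. qe_norm m \<F> \<E> (af_potential P A \<alpha>) < \<infinity> \<and> 1 \<le> \<alpha>"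
    using eventually_ge_at_top[of 1] by (rule eventually_conj)
  then obtain \<alpha> where \<alpha>: "qe_norm m \<F> \<E> (af_potential P A \<alpha>) < \<infinity>" "1 \<le> \<alpha>"
    using eventually_happens by fastforce
  obtain l where l: "0 < l" "\<And>h. h \<in> borel_measurable borel \<Longrightarrow> (\<integral>\<^sup>+x. R \<alpha> h x \<partial>\<mu>) \<le> ennreal l * (\<integral>\<^sup>+x. h x \<partial>m)"
    using revuz_norm_dominates[OF A(1) _ \<alpha>(1)] \<alpha>(2) by auto
  show ?thesis
    using l(1) \<alpha>(2) by (intro S_00_of_dominated_resolvent[OF assms(2) _ domination_order_one[OF sets \<alpha>(2) l]]) auto
qed

end

theorem lemma2p13:
  fixes m :: "'a::{metric_space, second_countable_topology} measure"
    and \<F> :: "('a \<Rightarrow> real) set"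
    and \<E> :: "('a \<Rightarrow> real) \<Rightarrow> ('a \<Rightarrow> real) \<Rightarrow> real"
    and X :: "ennreal \<Rightarrow> 'w \<Rightarrow> 'a option"
    and \<theta> :: "ennreal \<Rightarrow> 'w \<Rightarrow> 'w"
    and P :: "'a option \<Rightarrow> 'w measure"
  assumes "regular_dirichlet_form m \<F> \<E>"
    and "hunt_process X \<theta> P"
    and "symmetric_process m X P"
    and "associated m \<F> \<E> X P"
  shows "kato_00 m \<F> \<E> X \<theta> P = kato_class m \<F> \<E> X \<theta> P \<inter> finite_smooth m \<F> \<E> \<and>
    dynkin_00 m \<F> \<E> X \<theta> P = dynkin_class m \<F> \<E> X \<theta> P \<inter> finite_smooth m \<F> \<E>"
proof -
  interpret symmetric_hunt_process m \<F> \<E> X \<theta> P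
    using assms unfolding symmetric_hunt_process_def symmetric_hunt_process_axioms_def by blast
  have "\<mu> \<in> finite_smooth m \<F> \<E>" if "\<mu> \<in> smooth m \<F> \<E>" "\<mu> \<in> S_00 m \<F> \<E>" for \<mu>
    using that by (simp add: finite_smooth_def S_00_def)
  then have "kato_00 m \<F> \<E> X \<theta> P \<subseteq> finite_smooth m \<F> \<E>" "dynkin_00 m \<F> \<E> X \<theta> P \<subseteq> finite_smooth m \<F> \<E>"
    by (auto simp: kato_00_def dynkin_00_def kato_class_def dynkin_class_def)
  then show ?thesis
    using kato_S_00 dynkin_S_00 unfolding kato_00_def dynkin_00_def by blast
qed

end
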